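(* Let $A \in M_n(\mathbb{C})$. If $f_A^{-1}$ is weakly continuous at every point of $F(A)$, then there is a continuous selection of $f_A^{-1}$ on all of $F(A)$. If the points of $F(A)$ at which $f_A^{-1}$ fails to be weakly continuous are $w_1, \ldots, w_k \in \partial F(A)$, then for any open set $G \subseteq \mathbb{C}$ containing $\{w_1, \ldots, w_k\}$ there is a continuous selection of $f_A^{-1}$ on $F(A) \setminus G$.
   Context: $M_n(\mathbb{C})$ is the set of complex $n\times n$ matrices and $\mathbb{C}S^n = \{x \in \mathbb{C}^n : x^*x = 1\}$ is the unit sphere of $\mathbb{C}^n$. For $A \in M_n(\mathbb{C})$, the map $f_A : \mathbb{C}S^n \to \mathbb{C}$ is $f_A(x) = x^*Ax$. The numerical range $F(A)$ is the image of $f_A$ (a compact convex subset of $\mathbb{C}$), and $\partial F(A)$ is its boundary in $\mathbb{C}$. The inverse numerical range map $f_A^{-1}$ is the multivalued map from $F(A)$ to $\mathbb{C}S^n$ sending $z$ to $f_A^{-1}(z)=\{x \in \mathbb{C}S^n : f_A(x) = z\}$. A multivalued map $g$ from a metric space $X$ to a metric space $Y$ is weakly continuous at $x \in X$ if for all sequences $x_k \to x$ in $X$ there exist $y \in g(x)$ and a sequence $y_k \in g(x_k)$ such that $y_k \to y$. Here this is applied with $X = F(A)$, $Y = \mathbb{C}S^n$, $g = f_A^{-1}$. For $V \subseteq F(A)$, a continuous selection of $f_A^{-1}$ on $V$ is a continuous single-valued function $h : V \to \mathbb{C}S^n$ with $f_A(h(z)) = z$ for all $z \in V$. *)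

theory Defs
  imports "HOL-Analysis.Analysis"
begin

text \<open>The sesquilinear pairing \<open>x\<^sup>* y\<close>, conjugate-linear in the first argument.\<close>

definition cdot :: "complex ^ 'n \<Rightarrow> complex ^ 'n \<Rightarrow> complex" where
  "cdot x y = (\<Sum>i\<in>UNIV. cnj (x $ i) * y $ i)"

definition csphere :: "(complex ^ 'n) set" where
  "csphere = {x. cdot x x = 1}"

text \<open>\<open>x\<^sup>* A x\<close>, written as a total function; its intended domain is
  \<^const>\<open>csphere\<close>, to which every notion below restricts it.\<close>

definition fov_map :: "complex ^ 'n ^ 'n \<Rightarrow> complex ^ 'n \<Rightarrow> complex" where
  "fov_map A x = cdot x (A *v x)"

definition numerical_range :: "complex ^ 'n ^ 'n \<Rightarrow> complex set" where
  "numerical_range A = fov_map A ` csphere"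

definition inv_fov_map :: "complex ^ 'n ^ 'n \<Rightarrow> complex \<Rightarrow> (complex ^ 'n) set" where
  "inv_fov_map A z = {x \<in> csphere. fov_map A x = z}"

text \<open>A multivalued map from \<open>X\<close> is a set-valued function of which only the values on
  \<open>X\<close> matter.\<close>

definition weakly_continuous_at ::
    "'a::metric_space set \<Rightarrow> ('a \<Rightarrow> 'b::metric_space set) \<Rightarrow> 'a \<Rightarrow> bool" where
  "weakly_continuous_at X g x \<longleftrightarrow>
     (\<forall>\<xi>. (\<forall>k. \<xi> k \<in> X) \<and> \<xi> \<longlonglongrightarrow> x \<longrightarrow>
        (\<exists>y\<in>g x. \<exists>\<eta>. (\<forall>k. \<eta> k \<in> g (\<xi> k)) \<and> \<eta> \<longlonglongrightarrow> y))"

definition continuous_selection ::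
    "complex ^ 'n ^ 'n \<Rightarrow> complex set \<Rightarrow> (complex \<Rightarrow> complex ^ 'n) \<Rightarrow> bool" where
  "continuous_selection A V h \<longleftrightarrow>
     continuous_on V h \<and> h ` V \<subseteq> csphere \<and> (\<forall>z\<in>V. fov_map A (h z) = z)"

end

theory Submission
  imports Defs
begin

text \<open>The selection is \<open>h(z)\<close> = the point \<open>x\<close> of the fibre over \<open>z\<close> that maximises \<open>|v(z)\<^sup>* x|\<close>, with the phase fixed by
  \<open>v(z)\<^sup>* h(z) > 0\<close>, for a suitable continuous vector field \<open>v\<close>. Such an \<open>h\<close> is continuous wherever the
  maximiser is unique up to phase and is a limit of points of every neighbouring fibre.

  The squared maximum of \<open>|v\<^sup>* x|\<close> over the fibres is a concave function of \<open>z\<close> by the Toeplitz--Hausdorff argument, and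
  two essentially different maximisers at \<open>z\<close> force it to decay linearly to zero along some segment
  from \<open>z\<close> to a point of the numerical range. Hence, for constant \<open>v\<close>, maximisers are unique as soon
  as \<open>v\<close> is not orthogonal to any fibre, which holds for almost every \<open>v\<close>.

  All points of a fibre are limits of points of the neighbouring fibres, except over finitely many extreme points. This
  follows from the semicontinuity of the top eigenspace of the Hermitian part of \<open>cnj w A\<close> in all but
  finitely many directions \<open>w\<close>. At an exceptional point \<open>z0\<close> over which at least one point \<open>y\<close> of the fibre is such a
  limit, the functional is deformed along a path ending in a vector whose projection to
  the fibre's span is a multiple of \<open>y\<close>; the path avoids the functionals for which uniqueness fails near \<open>z0\<close>,
  and running through it as \<open>z\<close> approaches \<open>z0\<close> defines \<open>v(z)\<close>.\<close>

section \<open>The sesquilinear pairing\<close>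

text \<open>Call a fibre vector approximable if \<open>lsc_at\<close> holds for it. One selection
  \<open>h\<close> serves both claims: it is continuous on the set of points whose fibre contains an
  approximable vector, and compactness shows that weak continuity provides such a vector. The
  obstacle is a point whose fibre contains both approximable and non-approximable vectors. There the
  maximiser of a constant functional may be of the wrong kind and \<open>h\<close> may jump. The
  functional must single out an approximable \<open>y\<close>, but turning it straight to
  \<open>y\<close> may create decay to zero towards some point of the range, which is what destroys
  uniqueness nearby. The functionals to be avoided have an explicit real form, computed from the
  contact of the concave maximum with an affine majorant, and this dictates the shape of the path.
  Genericity of \<open>v\<close> has to hold against one-parameter families of eigenspaces. A merely
  continuous curve of complex hyperplanes can fill the space, which is why Lipschitz dependence of
  the eigenspaces is established. A range with empty interior has no such geometry and gets an
  explicit formula.\<close>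

lemma cdot_add_left: "cdot (x + y) z = cdot x z + cdot y z"
  by (simp add: cdot_def algebra_simps sum.distrib)

lemma cdot_add_right: "cdot z (x + y) = cdot z x + cdot z y"
  by (simp add: cdot_def algebra_simps sum.distrib)

lemma cdot_diff_left: "cdot (x - y) z = cdot x z - cdot y z"
  by (simp add: cdot_def algebra_simps sum_subtractf)

lemma cdot_diff_right: "cdot z (x - y) = cdot z x - cdot z y"
  by (simp add: cdot_def algebra_simps sum_subtractf)

lemma cdot_minus_left: "cdot (- x) z = - cdot x z"
  by (simp add: cdot_def sum_negf)

lemma cdot_minus_right: "cdot z (- x) = - cdot z x"
  by (simp add: cdot_def sum_negf)

lemma cdot_scale_left: "cdot (c *s x) y = cnj c * cdot x y"
  by (simp add: cdot_def sum_distrib_left mult_ac)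

lemma cdot_scale_right: "cdot x (c *s y) = c * cdot x y"
  by (simp add: cdot_def sum_distrib_left mult_ac)

lemma cdot_zero_left [simp]: "cdot 0 x = 0"
  by (simp add: cdot_def)

lemma cdot_zero_right [simp]: "cdot x 0 = 0"
  by (simp add: cdot_def)

lemma scaleR_eq_scale: "r *\<^sub>R (x :: complex ^ 'n) = complex_of_real r *s x"
  by (simp add: vec_eq_iff) (simp add: scaleR_conv_of_real)

lemma cdot_scaleR_left: "cdot (r *\<^sub>R x) y = complex_of_real r * cdot x y"
  by (simp add: scaleR_eq_scale cdot_scale_left)

lemma cdot_scaleR_right: "cdot x (r *\<^sub>R y) = complex_of_real r * cdot x y"
  by (simp add: scaleR_eq_scale cdot_scale_right)

lemmas cdot_algebra = cdot_add_left cdot_add_right cdot_diff_left cdot_diff_right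
  cdot_minus_left cdot_minus_right cdot_scale_left cdot_scale_right
  cdot_scaleR_left cdot_scaleR_right

lemma cnj_cdot: "cnj (cdot x y) = cdot y x"
  by (simp add: cdot_def mult.commute)

lemma inner_eq_Re_cdot: "x \<bullet> y = Re (cdot x y)"
  by (simp add: cdot_def inner_vec_def inner_complex_def)

lemma cdot_self: "cdot x x = complex_of_real ((norm x)\<^sup>2)"
proof -
  have "Im (cdot x x) = 0"
    by (metis cnj_cdot complex_cnj_cancel_iff complex_eq_iff cnj.sel(2) equal_neg_zero)
  then show ?thesis
    by (simp add: complex_eq_iff power2_norm_eq_inner inner_eq_Re_cdot)
qed

lemma csphere_iff: "x \<in> csphere \<longleftrightarrow> norm x = 1"
  by (simp add: csphere_def cdot_self power2_eq_1_iff del: of_real_power)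
     (metis abs_norm_cancel of_real_1 of_real_eq_iff power2_eq_1_iff abs_1 abs_neg_one)

lemma csphere_eq_sphere: "(csphere :: (complex ^ 'n) set) = sphere 0 1"
  by (auto simp: csphere_iff)

lemma norm_scale: "norm (c *s x) = cmod c * norm (x :: complex ^ 'n)"
proof -
  have "complex_of_real ((norm (c *s x))\<^sup>2) = complex_of_real ((cmod c * norm x)\<^sup>2)"
    unfolding cdot_self[symmetric] power_mult_distrib of_real_mult complex_norm_square
    by (simp add: cdot_scale_left cdot_scale_right)
  then show ?thesis
    by (metis of_real_eq_iff norm_ge_zero power2_eq_iff_nonneg mult_nonneg_nonneg)
qed

lemma cmod_cdot_le: "cmod (cdot x y) \<le> norm x * norm y"
proof (cases "cdot x y = 0")
  case False
  define c where "c = cnj (cdot x y) / cmod (cdot x y)"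
  have "cmod c = 1" using False by (simp add: c_def norm_divide)
  have "cdot x (c *s y) = cmod (cdot x y)"
    using False
    by (simp add: cdot_scale_right c_def complex_norm_square[symmetric] mult.commute[of "cnj _"] power2_eq_square)
  then have "cmod (cdot x y) = x \<bullet> (c *s y)" by (simp add: inner_eq_Re_cdot)
  also have "\<dots> \<le> norm x * norm (c *s y)" by (rule norm_cauchy_schwarz)
  finally show ?thesis using \<open>cmod c = 1\<close> by (simp add: norm_scale)
qed simp

lemma bounded_bilinear_cdot: "bounded_bilinear cdot"
proof
  show "\<exists>K. \<forall>a b. norm (cdot a b) \<le> norm a * norm b * K"
    by (intro exI[of _ 1]) (simp add: cmod_cdot_le)
qed (simp_all add: cdot_algebra scaleR_conv_of_real[where 'a=complex])

lemmas tendsto_cdot = bounded_bilinear.tendsto[OF bounded_bilinear_cdot]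
lemmas continuous_on_cdot = bounded_bilinear.continuous_on[OF bounded_bilinear_cdot]

lemma bounded_linear_matrix: "bounded_linear (\<lambda>x. (A :: complex ^ 'n ^ 'm) *v x)"
  unfolding linear_conv_bounded_linear[symmetric]
  by (rule linearI) (simp_all add: matrix_vector_right_distrib scaleR_eq_scale vector_scalar_commute)

lemmas tendsto_matrix = bounded_linear.tendsto[OF bounded_linear_matrix]
lemmas continuous_on_matrix = bounded_linear.continuous_on[OF bounded_linear_matrix]

lemma norm_add_cdot: "(norm (x + y))\<^sup>2 = (norm x)\<^sup>2 + (norm y)\<^sup>2 + 2 * Re (cdot x y)"
  by (simp add: power2_norm_eq_inner inner_add_left inner_add_right inner_commute inner_eq_Re_cdot[symmetric])

lemma norm_diff_cdot: "(norm (x - y))\<^sup>2 = (norm x)\<^sup>2 + (norm y)\<^sup>2 - 2 * Re (cdot x y)"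
  by (simp add: power2_norm_eq_inner inner_diff_left inner_diff_right inner_commute inner_eq_Re_cdot[symmetric])

section \<open>The quadratic map and the Toeplitz--Hausdorff argument\<close>

lemma fov_map_scale: "fov_map A (c *s x) = complex_of_real ((cmod c)\<^sup>2) * fov_map A x"
  unfolding complex_norm_square by (simp add: fov_map_def vector_scalar_commute cdot_algebra mult_ac)

lemma fov_map_0 [simp]: "fov_map A 0 = 0"
  by (simp add: fov_map_def)

lemma fov_map_add:
  "fov_map A (x + y) = fov_map A x + fov_map A y + cdot x (A *v y) + cdot y (A *v x)"
  by (simp add: fov_map_def matrix_vector_right_distrib cdot_algebra)

lemma tendsto_fov_map: "(u \<longlongrightarrow> x) G \<Longrightarrow> ((\<lambda>k. fov_map A (u k)) \<longlongrightarrow> fov_map A x) G"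
  unfolding fov_map_def by (intro tendsto_cdot tendsto_matrix)

lemma continuous_on_fov_map: "continuous_on S (fov_map A)"
  unfolding fov_map_def by (intro continuous_on_cdot continuous_on_matrix continuous_on_id)

lemma inv_fov_map_iff: "x \<in> inv_fov_map A z \<longleftrightarrow> norm x = 1 \<and> fov_map A x = z"
  by (simp add: inv_fov_map_def csphere_iff)

lemma inv_fov_map_scale: "x \<in> inv_fov_map A z \<Longrightarrow> cmod c = 1 \<Longrightarrow> c *s x \<in> inv_fov_map A z"
  by (simp add: inv_fov_map_iff norm_scale fov_map_scale)

lemma numerical_range_iff: "z \<in> numerical_range A \<longleftrightarrow> (\<exists>x. x \<in> inv_fov_map A z)"
  by (auto simp: numerical_range_def inv_fov_map_def)

lemma fov_map_mem: "norm x = 1 \<Longrightarrow> fov_map A x \<in> numerical_range A"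
  by (auto simp: numerical_range_def csphere_iff)

lemma inv_fov_map_nonempty: "z \<in> numerical_range A \<Longrightarrow> \<exists>x. x \<in> inv_fov_map A z"
  by (simp add: numerical_range_iff)

lemma normalize_mem:
  assumes "fov_map A x = z * complex_of_real ((norm x)\<^sup>2)" "x \<noteq> 0"
  shows "complex_of_real (1 / norm x) *s x \<in> inv_fov_map A z"
  using assms by (simp add: inv_fov_map_iff norm_scale fov_map_scale norm_divide power_divide)

lemma compact_numerical_range: "compact (numerical_range A)"
  unfolding numerical_range_def csphere_eq_sphere
  by (intro compact_continuous_image continuous_on_fov_map) simp

lemma compact_inv_fov_map: "compact (inv_fov_map A z)"
proof -
  have "inv_fov_map A z = sphere 0 1 \<inter> fov_map A -` {z}"
    by (auto simp: inv_fov_map_iff)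
  moreover have "closed (fov_map A -` {z})"
    by (intro continuous_closed_vimage closed_singleton)
       (use continuous_on_fov_map[of UNIV A] in \<open>simp add: continuous_on_eq_continuous_at\<close>)
  ultimately show ?thesis by (metis compact_Int_closed compact_sphere)
qed

text \<open>A unitary rotation of the pair \<open>(a1, a2)\<close> preserves the density matrix
  \<open>a1 a1\<^sup>* + a2 a2\<^sup>*\<close>; it can be chosen so that both new vectors have the same value.\<close>

lemma equal_value_decomposition:
  fixes z :: complex
  assumes "(fov_map A a1 - z * (norm a1)\<^sup>2) + (fov_map A a2 - z * (norm a2)\<^sup>2) = 0"
  obtains b1 b2 where
    "fov_map A b1 = z * (norm b1)\<^sup>2" "fov_map A b2 = z * (norm b2)\<^sup>2"
    "(norm b1)\<^sup>2 + (norm b2)\<^sup>2 = (norm a1)\<^sup>2 + (norm a2)\<^sup>2"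
    "\<And>v. (cmod (cdot v b1))\<^sup>2 + (cmod (cdot v b2))\<^sup>2 = (cmod (cdot v a1))\<^sup>2 + (cmod (cdot v a2))\<^sup>2"
proof -
  define q where "q x = fov_map A x - z * (norm x)\<^sup>2" for x
  have q: "q x = fov_map A x - z * cdot x x" for x by (simp add: q_def cdot_self)
  have q0: "q a1 + q a2 = 0" using assms by (simp add: q_def)
  have rot: "\<exists>b1 b2. q b1 = 0 \<and> q b2 = 0 \<and> (norm b1)\<^sup>2 + (norm b2)\<^sup>2 = (norm a1)\<^sup>2 + (norm a2)\<^sup>2
     \<and> (\<forall>v. (cmod (cdot v b1))\<^sup>2 + (cmod (cdot v b2))\<^sup>2 = (cmod (cdot v a1))\<^sup>2 + (cmod (cdot v a2))\<^sup>2)"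
    if C: "C\<^sup>2 + S\<^sup>2 = 1" and w: "cmod w = 1" and z0: "q (complex_of_real C *s a1 + (complex_of_real S * w) *s a2) = 0"
    for C S :: real and w
  proof -
    let ?b1 = "complex_of_real C *s a1 + (complex_of_real S * w) *s a2"
    let ?b2 = "complex_of_real (-S) *s a1 + (complex_of_real C * w) *s a2"
    have w': "w * cnj w = 1" using w by (simp add: complex_norm_square[symmetric])
    have C': "complex_of_real C * C + complex_of_real S * S = 1"
      using arg_cong[OF C, of complex_of_real] by (simp add: power2_eq_square)
    \<comment> \<open>Every sesquilinear form has the same trace over the rotated pair as over the
      original one; \<open>q\<close>, the squared norm and the squared functional are
      instances.\<close>
    have sq: "h ?b1 ?b1 + h ?b2 ?b2 = h a1 a1 + h a2 a2"
      if h: "\<And>x y u. h (x + y) u = h x u + h y u" "\<And>x y u. h u (x + y) = h u x + h u y"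
        "\<And>c x y. h (c *s x) y = cnj c * h x y" "\<And>c x y. h x (c *s y) = c * h x y"
      for h :: "complex ^ 'a \<Rightarrow> complex ^ 'a \<Rightarrow> complex"
    proof -
      have minus: "h (x - y) u = h x u - h y u" "h u (x - y) = h u x - h u y" for x y u
        using h(1)[of x "(-1) *s y" u] h(3)[of "-1" y u] h(2)[of u x "(-1) *s y"] h(4)[of u "-1" y]
        by (simp_all add: vector_smult_lneg)
      have "h ?b1 ?b1 + h ?b2 ?b2 = (complex_of_real C * C + complex_of_real S * S) * (h a1 a1 + (w * cnj w) * h a2 a2)"
        by (simp add: h minus algebra_simps)
      then show ?thesis by (simp add: C' w')
    qed
    have 1: "q ?b1 + q ?b2 = q a1 + q a2"
      unfolding q fov_map_def
      using sq[of "\<lambda>x y. cdot x (A *v y) - z * cdot x y"]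
      by (simp add: cdot_algebra matrix_vector_right_distrib vector_scalar_commute algebra_simps)
    have 2: "(norm ?b1)\<^sup>2 + (norm ?b2)\<^sup>2 = (norm a1)\<^sup>2 + (norm a2)\<^sup>2"
    proof -
      have "complex_of_real ((norm ?b1)\<^sup>2 + (norm ?b2)\<^sup>2) = complex_of_real ((norm a1)\<^sup>2 + (norm a2)\<^sup>2)"
        using sq[of cdot] by (simp only: of_real_add cdot_self[symmetric]) (simp add: cdot_algebra algebra_simps)
      then show ?thesis using of_real_eq_iff by blast
    qed
    have 3: "(cmod (cdot v ?b1))\<^sup>2 + (cmod (cdot v ?b2))\<^sup>2 = (cmod (cdot v a1))\<^sup>2 + (cmod (cdot v a2))\<^sup>2" for v
    proof -
      have "complex_of_real ((cmod (cdot v ?b1))\<^sup>2 + (cmod (cdot v ?b2))\<^sup>2)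
          = complex_of_real ((cmod (cdot v a1))\<^sup>2 + (cmod (cdot v a2))\<^sup>2)"
        using sq[of "\<lambda>x y. cdot x v * cdot v y"]
        by (simp only: of_real_add complex_norm_square cnj_cdot) (simp add: cdot_algebra algebra_simps)
      then show ?thesis using of_real_eq_iff by blast
    qed
    show ?thesis using 1 2 3 z0 q0 by (intro exI[of _ ?b1] exI[of _ ?b2]) auto
  qed
  have "\<exists>(C::real) (S::real) w. C\<^sup>2 + S\<^sup>2 = 1 \<and> cmod w = 1 \<and> q (complex_of_real C *s a1 + (complex_of_real S * w) *s a2) = 0"
  proof (cases "q a1 = 0")
    case True
    then show ?thesis by (intro exI[of _ 1] exI[of _ 0] exI[of _ 1]) simp
  next
    case False
    define p where "p = cdot a1 (A *v a2) - z * cdot a1 a2"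
    define p' where "p' = cdot a2 (A *v a1) - z * cdot a2 a1"
    \<comment> \<open>The imaginary part of the normalised cross term equals that of
      \<open>w * P\<close>, so the phase \<open>w\<close> that makes \<open>w * P\<close> real makes
      the cross term a real multiple \<open>r\<close> of \<open>q a1\<close>.\<close>
    define P where "P = p / q a1 - cnj (p' / q a1)"
    define w where "w = (if P = 0 then 1 else cnj P / cmod P)"
    have w1: "cmod w = 1" by (simp add: w_def norm_divide)
    have "Im (w * P) = 0"
      by (cases "P = 0") (simp_all add: w_def complex_norm_square[symmetric] mult.commute[of "cnj P"] del: of_real_power)
    then have im: "Im (w * (p / q a1) + cnj w * (p' / q a1)) = 0"
    proof -
      have "w * P = w * (p / q a1) - cnj (cnj w * (p' / q a1))"
        by (simp add: P_def right_diff_distrib)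
      then have "Im (w * P) = Im (w * (p / q a1)) + Im (cnj w * (p' / q a1))"
        by (simp only: minus_complex.sel cnj.sel diff_minus_eq_add)
      then show ?thesis using \<open>Im (w * P) = 0\<close> by (simp only: plus_complex.sel)
    qed
    define r where "r = Re (w * (p / q a1) + cnj w * (p' / q a1))"
    have "w * (p / q a1) + cnj w * (p' / q a1) = r"
      using im by (simp add: complex_eq_iff r_def)
    then have cross: "w * p + cnj w * p' = r * q a1"
      using False by (simp add: field_simps)
    \<comment> \<open>As \<open>q a2 = - q a1\<close>, the value of \<open>q\<close> at
      \<open>a1 + t w a2\<close> is \<open>(1 - t^2 + t r) q a1\<close>; \<open>t\<close> is a root
      of this factor, and \<open>C\<close> normalises the coefficients.\<close>
    define t where "t = (r + sqrt (r\<^sup>2 + 4)) / 2"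
    have t: "1 - t\<^sup>2 + t * r = 0"
    proof -
      have "(sqrt (r\<^sup>2 + 4))\<^sup>2 = r\<^sup>2 + 4" by simp
      then show ?thesis unfolding t_def by (simp add: power2_eq_square field_simps)
    qed
    define C where "C = 1 / sqrt (1 + t\<^sup>2)"
    define S where "S = t * C"
    have C2: "C\<^sup>2 * (1 + t\<^sup>2) = 1" by (simp add: C_def power_divide add_nonneg_eq_0_iff)
    have one: "C\<^sup>2 + S\<^sup>2 = 1" using C2 by (simp add: S_def power_mult_distrib algebra_simps)
    have w': "w * cnj w = 1" using w1 by (simp add: complex_norm_square[symmetric])
    have "q (complex_of_real C *s a1 + (complex_of_real S * w) *s a2)
        = C * C * q a1 + S * S * (w * cnj w) * q a2 + C * S * (w * p + cnj w * p')"
      by (simp add: q fov_map_def p_def p'_def matrix_vector_right_distrib vector_scalar_commute cdot_algebra algebra_simps)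
    also have "\<dots> = complex_of_real (C\<^sup>2 * (1 - t\<^sup>2 + t * r)) * q a1"
      unfolding cross w' add_eq_0_iff[THEN iffD1, OF q0] S_def
      by (simp add: power2_eq_square algebra_simps)
    also have "\<dots> = 0" by (simp add: t del: of_real_add of_real_diff of_real_mult)
    finally show ?thesis using one w1 by blast
  qed
  then obtain C S :: real and w where "C\<^sup>2 + S\<^sup>2 = 1" "cmod w = 1"
    "q (complex_of_real C *s a1 + (complex_of_real S * w) *s a2) = 0" by blast
  from rot[OF this] obtain b1 b2 where "q b1 = 0" "q b2 = 0"
    "(norm b1)\<^sup>2 + (norm b2)\<^sup>2 = (norm a1)\<^sup>2 + (norm a2)\<^sup>2"
    "\<forall>v. (cmod (cdot v b1))\<^sup>2 + (cmod (cdot v b2))\<^sup>2 = (cmod (cdot v a1))\<^sup>2 + (cmod (cdot v a2))\<^sup>2"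
    by blast
  then show ?thesis by (intro that[of b1 b2]) (simp_all add: q_def del: of_real_power)
qed

text \<open>The vectors \<open>sqrt (1 - t) x\<close> and \<open>sqrt t y\<close> are rotated into
  two vectors that both have normalised value \<open>z\<close> where nonzero, with the same total
  squared norm 1 and the same total squared functional. One of them attains at least the average
  ratio; normalised, it is \<open>p\<close>. Besides convexity of the range this gives concavity in
  \<open>z\<close> of the squared maximum over the fibres.\<close>

lemma convex_combination_value:
  assumes x: "x \<in> inv_fov_map A z1" and y: "y \<in> inv_fov_map A z2" and t: "0 \<le> t" "t \<le> 1"
  obtains p where "p \<in> inv_fov_map A ((1 - t) *\<^sub>R z1 + t *\<^sub>R z2)"
    "(cmod (cdot v p))\<^sup>2 \<ge> (1 - t) * (cmod (cdot v x))\<^sup>2 + t * (cmod (cdot v y))\<^sup>2"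
proof -
  define a1 where "a1 = complex_of_real (sqrt (1 - t)) *s x"
  define a2 where "a2 = complex_of_real (sqrt t) *s y"
  define z where "z = (1 - t) *\<^sub>R z1 + t *\<^sub>R z2"
  define c where "c = (1 - t) * (cmod (cdot v x))\<^sup>2 + t * (cmod (cdot v y))\<^sup>2"
  have n: "(norm a1)\<^sup>2 = 1 - t" "(norm a2)\<^sup>2 = t"
    using x y t by (simp_all add: a1_def a2_def norm_scale power_mult_distrib inv_fov_map_iff)
  have "(fov_map A a1 - z * (norm a1)\<^sup>2) + (fov_map A a2 - z * (norm a2)\<^sup>2) = 0"
    unfolding n using x y t
    by (simp add: a1_def a2_def fov_map_scale inv_fov_map_iff z_def scaleR_conv_of_real) (simp add: algebra_simps)
  then obtain b1 b2 where b: "fov_map A b1 = z * (norm b1)\<^sup>2" "fov_map A b2 = z * (norm b2)\<^sup>2"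
    "(norm b1)\<^sup>2 + (norm b2)\<^sup>2 = 1"
    and bv: "(cmod (cdot v b1))\<^sup>2 + (cmod (cdot v b2))\<^sup>2 = (cmod (cdot v a1))\<^sup>2 + (cmod (cdot v a2))\<^sup>2"
    by (rule equal_value_decomposition[of A a1 z a2]) (auto simp: n)
  have "(cmod (cdot v a1))\<^sup>2 + (cmod (cdot v a2))\<^sup>2 = c"
    using t by (simp add: a1_def a2_def c_def cdot_scale_right norm_mult power_mult_distrib)
  then have bc: "(cmod (cdot v b1))\<^sup>2 + (cmod (cdot v b2))\<^sup>2 = c" using bv by simp
  have ex: "\<exists>b. b \<noteq> 0 \<and> fov_map A b = z * (norm b)\<^sup>2 \<and> c * (norm b)\<^sup>2 \<le> (cmod (cdot v b))\<^sup>2"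
  proof (rule ccontr)
    assume "\<not> ?thesis"
    then have *: "(cmod (cdot v b))\<^sup>2 < c * (norm b)\<^sup>2 \<or> b = 0" if "fov_map A b = z * (norm b)\<^sup>2" for b
      using that by force
    have "c = c * ((norm b1)\<^sup>2 + (norm b2)\<^sup>2)" using b(3) by simp
    then have "c = c * (norm b1)\<^sup>2 + c * (norm b2)\<^sup>2" by (simp only: distrib_left)
    moreover have "b1 \<noteq> 0 \<or> b2 \<noteq> 0" using b(3) by auto
    ultimately show False using *[OF b(1)] *[OF b(2)] bc by auto
  qed
  then obtain b where b: "b \<noteq> 0" "fov_map A b = z * (norm b)\<^sup>2" "c * (norm b)\<^sup>2 \<le> (cmod (cdot v b))\<^sup>2" by blast
  show ?thesis
  proof (rule that)
    show "complex_of_real (1 / norm b) *s b \<in> inv_fov_map A ((1 - t) *\<^sub>R z1 + t *\<^sub>R z2)"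
      using normalize_mem[OF b(2) b(1)] by (simp add: z_def)
    show "(1 - t) * (cmod (cdot v x))\<^sup>2 + t * (cmod (cdot v y))\<^sup>2 \<le> (cmod (cdot v (complex_of_real (1 / norm b) *s b)))\<^sup>2"
      using b by (simp add: c_def cdot_scale_right norm_mult norm_divide power_divide power_mult_distrib divide_simps mult.commute)
  qed
qed

lemma convex_numerical_range: "convex (numerical_range A)"
proof (rule convexI)
  fix z1 z2 and u v :: real
  assume "z1 \<in> numerical_range A" "z2 \<in> numerical_range A" and uv: "0 \<le> u" "0 \<le> v" "u + v = 1"
  then obtain x y where x: "x \<in> inv_fov_map A z1" and y: "y \<in> inv_fov_map A z2" by (auto simp: numerical_range_iff)
  have v: "u = 1 - v" "v \<le> 1" using uv by auto
  obtain p where "p \<in> inv_fov_map A ((1 - v) *\<^sub>R z1 + v *\<^sub>R z2)"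
    by (rule convex_combination_value[OF x y uv(2) v(2)])
  then show "u *\<^sub>R z1 + v *\<^sub>R z2 \<in> numerical_range A"
    unfolding numerical_range_iff v(1) by blast
qed

text \<open>Concavity is applied to the functional of \<open>x\<close> itself, which is 1 at
  \<open>x\<close>: some \<open>p\<close> has squared overlap at least \<open>1 - t\<close> with
  \<open>x\<close>, and a phase brings it within \<open>sqrt (2 * t)\<close>.\<close>

lemma segment_near:
  assumes x: "x \<in> inv_fov_map A z1" and z2: "z2 \<in> numerical_range A" and t: "0 \<le> t" "t \<le> 1"
  obtains p where "p \<in> inv_fov_map A ((1 - t) *\<^sub>R z1 + t *\<^sub>R z2)" "dist p x \<le> sqrt (2 * t)"
proof -
  obtain y where y: "y \<in> inv_fov_map A z2" using z2 by (auto simp: numerical_range_iff)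
  obtain p where p: "p \<in> inv_fov_map A ((1 - t) *\<^sub>R z1 + t *\<^sub>R z2)"
    and le: "(cmod (cdot x p))\<^sup>2 \<ge> (1 - t) * (cmod (cdot x x))\<^sup>2 + t * (cmod (cdot x y))\<^sup>2"
    by (rule convex_combination_value[OF x y t])
  have nx: "norm x = 1" and np: "norm p = 1" using x p by (auto simp: inv_fov_map_iff)
  define s where "s = cmod (cdot x p)"
  have "0 \<le> t * (cmod (cdot x y))\<^sup>2" using t by simp
  then have s: "s\<^sup>2 \<ge> 1 - t" using le nx by (simp add: s_def cdot_self)
  have s1: "0 \<le> s" "s \<le> 1" using cmod_cdot_le[of x p] nx np by (simp_all add: s_def)
  then have "s \<ge> s\<^sup>2" by (simp add: power2_eq_square mult_left_le)
  with s have s2: "s \<ge> 1 - t" by simp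
  define c where "c = (if s = 0 then 1 else cnj (cdot x p) / s)"
  have c: "cmod c = 1" by (simp add: c_def norm_divide s_def)
  have "cdot x (c *s p) = s"
    by (simp add: c_def cdot_scale_right s_def complex_norm_square[symmetric] mult.commute[of "cnj _"] power2_eq_square)
  then have "(norm (x - c *s p))\<^sup>2 = 2 - 2 * s"
    using nx np c by (simp add: norm_diff_cdot norm_scale)
  also have "\<dots> \<le> 2 * t" using s2 by simp
  finally have "dist (c *s p) x \<le> sqrt (2 * t)"
    by (simp add: dist_norm norm_minus_commute real_le_rsqrt)
  then show ?thesis using that inv_fov_map_scale[OF p c] by blast
qed

section \<open>Planar convex sets\<close>

lemma planar_orthogonal:
  fixes w x :: complex
  assumes "w \<bullet> x = 0" "w \<noteq> 0"
  obtains r where "x = r *\<^sub>R (\<i> * w)"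
proof -
  have n: "(Re w)\<^sup>2 + (Im w)\<^sup>2 \<noteq> 0" using assms(2) by (simp add: complex_eq_iff sum_power2_eq_zero_iff)
  have o: "Re w * Re x + Im w * Im x = 0" using assms(1) by (simp add: inner_complex_def)
  define r where "r = (Re w * Im x - Im w * Re x) / ((Re w)\<^sup>2 + (Im w)\<^sup>2)"
  have 1: "Im w * (Re w * Im x - Im w * Re x) = - Re x * ((Re w)\<^sup>2 + (Im w)\<^sup>2)"
    using o by algebra
  have 2: "Re w * (Re w * Im x - Im w * Re x) = Im x * ((Re w)\<^sup>2 + (Im w)\<^sup>2)"
    using o by algebra
  have "Re x = - r * Im w" using 1 n by (simp add: r_def field_simps)
  moreover have "Im x = r * Re w" using 2 n by (simp add: r_def field_simps)
  ultimately show ?thesis by (intro that[of r]) (simp add: complex_eq_iff)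
qed

definition supports :: "complex \<Rightarrow> complex set \<Rightarrow> complex \<Rightarrow> bool" where
  "supports w S z \<longleftrightarrow> z \<in> S \<and> (\<forall>z'\<in>S. w \<bullet> z' \<le> w \<bullet> z)"

lemma supports_scale: "0 < r \<Longrightarrow> supports (r *\<^sub>R w) S z \<longleftrightarrow> supports w S z"
  by (simp add: supports_def)

lemma supports_exists:
  assumes "convex S" "z \<in> S" "z \<notin> interior S" "interior S \<noteq> {}"
  obtains w where "norm w = 1" "supports w S z"
proof -
  have "convex (interior S)" using assms by simp
  then obtain a b where a: "a \<noteq> 0" "\<forall>x\<in>interior S. a \<bullet> x \<le> b" "\<forall>x\<in>{z}. a \<bullet> x \<ge> b"
    using separating_hyperplane_sets[of "interior S" "{z}"] assms by auto
  have "closure (interior S) \<subseteq> {x. a \<bullet> x \<le> b}"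
    by (rule closure_minimal) (use a in \<open>auto simp: closed_halfspace_le\<close>)
  then have "S \<subseteq> {x. a \<bullet> x \<le> b}"
    using convex_closure_interior[OF assms(1,4)] closure_subset by blast
  with a assms have "supports ((1 / norm a) *\<^sub>R a) S z"
    by (subst supports_scale) (force simp: supports_def)+
  then show ?thesis using that a(1) by force
qed

lemma supports_interior_less:
  assumes "supports w S z" "p \<in> interior S" "w \<noteq> 0"
  shows "w \<bullet> p < w \<bullet> z"
proof -
  obtain e where e: "e > 0" "ball p e \<subseteq> S" using assms(2) by (meson mem_interior)
  define q where "q = p + (e / 2 / norm w) *\<^sub>R w"
  have "dist p q = e / 2" using e(1) assms(3) by (simp add: q_def dist_norm)
  then have "q \<in> S" using e by (auto simp: subset_iff)
  then have "w \<bullet> q \<le> w \<bullet> z" using assms(1) by (simp add: supports_def)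
  moreover have "w \<bullet> p < w \<bullet> q" using e(1) assms(3) by (simp add: q_def inner_add_right)
  ultimately show ?thesis by simp
qed

text \<open>Every ray from \<open>z\<close> that meets \<open>S\<close> within \<open>\<rho>\<close>
  reaches a point of \<open>S\<close> at distance exactly \<open>\<rho>\<close>. For convex
  \<open>S\<close> this means agreement with a cone near \<open>z\<close>, and it excludes
  arbitrarily short rays.\<close>

definition conical :: "complex set \<Rightarrow> complex \<Rightarrow> bool" where
  "conical S z \<longleftrightarrow> (\<exists>\<rho>>0. \<forall>\<xi>\<in>S. \<xi> \<noteq> z \<and> dist \<xi> z < \<rho> \<longrightarrow> z + (\<rho> / dist \<xi> z) *\<^sub>R (\<xi> - z) \<in> S)"

lemma conical_interior:
  assumes "z \<in> interior S"
  shows "conical S z"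
proof -
  obtain e where e: "e > 0" "ball z e \<subseteq> S" using assms by (meson mem_interior)
  have "z + (e / 2 / dist \<xi> z) *\<^sub>R (\<xi> - z) \<in> S" if "\<xi> \<noteq> z" for \<xi>
  proof -
    have "dist z (z + (e / 2 / dist \<xi> z) *\<^sub>R (\<xi> - z)) = e / 2"
      using that e(1) by (simp add: dist_norm)
    then show ?thesis using e by (auto simp: subset_iff)
  qed
  then show ?thesis unfolding conical_def using e(1) by (intro exI[of _ "e / 2"]) auto
qed

text \<open>A point \<open>r\<close> near \<open>q\<close> is projected from \<open>p\<close> onto
  the line through \<open>a\<close> and \<open>b\<close>. The image \<open>a' r\<close> depends
  continuously on \<open>r\<close>, hence stays on the segment, and \<open>r\<close> lies between it
  and \<open>p\<close>. Here \<open>g r\<close> is the barycentric weight of \<open>p\<close>, and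
  \<open>t r\<close> the displacement of \<open>a' r\<close> from \<open>q\<close> in units of
  \<open>b - a\<close>.\<close>

lemma half_disc:
  fixes S :: "complex set"
  assumes "convex S" "p \<in> S" "a \<in> S" "b \<in> S" "w \<bullet> a = c" "w \<bullet> b = c" "w \<bullet> p < c"
    and q: "q \<in> open_segment a b"
  obtains \<rho> where "\<rho> > 0" "\<And>r. dist r q < \<rho> \<Longrightarrow> w \<bullet> r \<le> c \<Longrightarrow> r \<in> S"
proof -
  have ab: "a \<noteq> b" using q by auto
  obtain s where s: "0 < s" "s < 1" "q = (1 - s) *\<^sub>R a + s *\<^sub>R b" using q by (auto simp: in_segment)
  have w0: "w \<noteq> 0" using assms(5,7) by auto
  have wq: "w \<bullet> q = c" unfolding s(3) using assms(5,6) by (simp add: inner_add_right algebra_simps)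
  define g where "g r = (c - w \<bullet> r) / (c - w \<bullet> p)" for r
  define a' where "a' r = (1 / (1 - g r)) *\<^sub>R (r - g r *\<^sub>R p)" for r
  define t where "t r = ((a' r - q) \<bullet> (b - a)) / ((b - a) \<bullet> (b - a))" for r
  have g: "(g \<longlongrightarrow> 0) (nhds q)"
  proof -
    have "(g \<longlongrightarrow> g q) (nhds q)" unfolding g_def by (intro tendsto_intros filterlim_ident) (use assms(7) in auto)
    then show ?thesis by (simp add: g_def wq)
  qed
  have a': "(a' \<longlongrightarrow> q) (nhds q)"
  proof -
    have "(a' \<longlongrightarrow> (1 / (1 - 0)) *\<^sub>R (q - 0 *\<^sub>R p)) (nhds q)"
      unfolding a'_def by (intro tendsto_intros g filterlim_ident) auto
    then show ?thesis by simp
  qed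
  have t: "(t \<longlongrightarrow> 0) (nhds q)"
  proof -
    have "(t \<longlongrightarrow> ((q - q) \<bullet> (b - a)) / ((b - a) \<bullet> (b - a))) (nhds q)"
      unfolding t_def by (intro tendsto_intros a') (use ab in auto)
    then show ?thesis by simp
  qed
  have "\<forall>\<^sub>F r in nhds q. g r < 1 \<and> - s < t r \<and> t r < 1 - s"
    using s by (intro eventually_conj order_tendstoD[OF g] order_tendstoD[OF t]) auto
  then obtain \<rho> where \<rho>: "\<rho> > 0" "\<And>r. dist r q < \<rho> \<Longrightarrow> g r < 1 \<and> - s < t r \<and> t r < 1 - s"
    by (auto simp: eventually_nhds_metric)
  show ?thesis
  proof (rule that[OF \<rho>(1)])
    fix r assume r: "dist r q < \<rho>" "w \<bullet> r \<le> c"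
    note * = \<rho>(2)[OF r(1)]
    have g0: "0 \<le> g r" using r(2) assms(7) by (simp add: g_def)
    have gr: "w \<bullet> r - g r * (w \<bullet> p) = c * (1 - g r)"
      using assms(7) by (simp add: g_def field_simps)
    have wa': "w \<bullet> a' r = c"
      unfolding a'_def using * gr by (simp add: inner_diff_right)
    obtain r1 where r1: "a' r - q = r1 *\<^sub>R (\<i> * w)"
      by (rule planar_orthogonal[of w "a' r - q"]) (use w0 wa' wq in \<open>auto simp: inner_diff_right\<close>)
    obtain r2 where r2: "b - a = r2 *\<^sub>R (\<i> * w)"
      by (rule planar_orthogonal[of w "b - a"]) (use w0 assms in \<open>auto simp: inner_diff_right\<close>)
    have r20: "r2 \<noteq> 0" using r2 ab by auto
    have tr: "t r = r1 / r2" using w0 r20 unfolding t_def r1 r2 by simp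
    have "a' r - q = t r *\<^sub>R (b - a)" unfolding r1 r2 tr using r20 by simp
    then have "a' r = (1 - (s + t r)) *\<^sub>R a + (s + t r) *\<^sub>R b"
      using s(3) by (simp add: algebra_simps)
    then have "a' r \<in> S"
      using convexD[OF assms(1,3,4), of "1 - (s + t r)" "s + t r"] * by simp
    moreover have "r = (1 - g r) *\<^sub>R a' r + g r *\<^sub>R p"
      using * by (simp add: a'_def)
    ultimately show "r \<in> S"
      using convexD[OF assms(1) _ assms(2), of "a' r" "1 - g r" "g r"] * g0 by simp
  qed
qed

text \<open>At a boundary point inside a segment the supporting line must contain the segment, so
  \<open>half_disc\<close> applies; a ray into \<open>S\<close> never leaves the half plane.\<close>

lemma conical_nonextreme:
  assumes S: "convex S" "interior S \<noteq> {}" "q \<in> S" and q: "\<not> q extreme_point_of S"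
  shows "conical S q"
proof (cases "q \<in> interior S")
  case False
  obtain w where w: "norm w = 1" "supports w S q" using supports_exists[OF S(1,3) False S(2)] .
  obtain a b where ab: "a \<in> S" "b \<in> S" "q \<in> open_segment a b" using q S(3) by (auto simp: extreme_point_of_def)
  obtain p where p: "p \<in> interior S" using S(2) by blast
  obtain s where s: "0 < s" "s < 1" "q = (1 - s) *\<^sub>R a + s *\<^sub>R b" using ab by (auto simp: in_segment)
  have le: "w \<bullet> a \<le> w \<bullet> q" "w \<bullet> b \<le> w \<bullet> q" using w ab by (auto simp: supports_def)
  have eq: "(1 - s) * (w \<bullet> q - w \<bullet> a) + s * (w \<bullet> q - w \<bullet> b) = 0"
  proof -
    have "w \<bullet> q = (1 - s) * (w \<bullet> a) + s * (w \<bullet> b)" by (subst s(3)) (simp add: inner_add_right)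
    then show ?thesis by (simp add: algebra_simps)
  qed
  have "(1 - s) * (w \<bullet> q - w \<bullet> a) = 0" "s * (w \<bullet> q - w \<bullet> b) = 0"
    using eq le s by (smt (verit) mult_nonneg_nonneg)+
  then have wab: "w \<bullet> a = w \<bullet> q" "w \<bullet> b = w \<bullet> q" using s by auto
  have "w \<bullet> p < w \<bullet> q" using supports_interior_less[OF w(2) p] w(1) by force
  then obtain \<rho> where \<rho>: "\<rho> > 0" "\<And>r. dist r q < \<rho> \<Longrightarrow> w \<bullet> r \<le> w \<bullet> q \<Longrightarrow> r \<in> S"
    using half_disc[OF S(1) _ ab(1,2) wab _ ab(3)] p interior_subset by blast
  show ?thesis unfolding conical_def
  proof (intro exI[of _ "\<rho> / 2"] conjI ballI impI)
    fix \<xi> assume \<xi>: "\<xi> \<in> S" "\<xi> \<noteq> q \<and> dist \<xi> q < \<rho> / 2"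
    show "q + (\<rho> / 2 / dist \<xi> q) *\<^sub>R (\<xi> - q) \<in> S"
    proof (rule \<rho>(2))
      show "dist (q + (\<rho> / 2 / dist \<xi> q) *\<^sub>R (\<xi> - q)) q < \<rho>"
        using \<xi> \<rho>(1) by (simp add: dist_norm)
      have "w \<bullet> (\<xi> - q) \<le> 0" using w(2) \<xi>(1) by (simp add: supports_def inner_diff_right)
      then show "w \<bullet> (q + (\<rho> / 2 / dist \<xi> q) *\<^sub>R (\<xi> - q)) \<le> w \<bullet> q"
        using \<rho>(1) mult_nonneg_nonpos[of "\<rho> / 2 / dist \<xi> q" "w \<bullet> (\<xi> - q)"] by (simp add: inner_add_right)
    qed
  qed (use \<rho> in auto)
qed (rule conical_interior)

section \<open>Lower semicontinuity of the inverse map\<close>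

text \<open>Here \<open>y\<close> is fixed before the approach to \<open>z\<close>, whereas in
  \<open>weakly_continuous_at\<close> it may depend on the sequence;
  \<open>weakly_continuous_at_common_limit\<close> bridges the difference.\<close>

definition lsc_at :: "complex ^ 'n ^ 'n \<Rightarrow> complex \<Rightarrow> complex ^ 'n \<Rightarrow> bool" where
  "lsc_at A z y \<longleftrightarrow> y \<in> inv_fov_map A z \<and>
     (\<forall>e>0. \<exists>d>0. \<forall>z'\<in>numerical_range A. dist z' z < d \<longrightarrow> (\<exists>x\<in>inv_fov_map A z'. dist x y < e))"

lemma lsc_at_mem: "lsc_at A z y \<Longrightarrow> y \<in> inv_fov_map A z"
  by (simp add: lsc_at_def)

lemma lsc_at_sequence:
  assumes "lsc_at A z y" "\<And>k. \<xi> k \<in> numerical_range A" "\<xi> \<longlonglongrightarrow> z"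
  obtains \<eta> where "\<And>k. \<eta> k \<in> inv_fov_map A (\<xi> k)" "\<eta> \<longlonglongrightarrow> y"
proof -
  have ne: "\<exists>x. x \<in> inv_fov_map A (\<xi> k)" for k using assms(2) by (simp add: numerical_range_iff)
  \<comment> \<open>A nearest point of the compact fibre to \<open>y\<close>, so that any
    approximant in the fibre bounds its distance.\<close>
  define \<eta> where "\<eta> k = (SOME x. x \<in> inv_fov_map A (\<xi> k) \<and>
    (\<forall>x'\<in>inv_fov_map A (\<xi> k). dist x y \<le> dist x' y))" for k
  have \<eta>: "\<eta> k \<in> inv_fov_map A (\<xi> k) \<and> (\<forall>x'\<in>inv_fov_map A (\<xi> k). dist (\<eta> k) y \<le> dist x' y)" for k
  proof -
    have "\<exists>x\<in>inv_fov_map A (\<xi> k). \<forall>x'\<in>inv_fov_map A (\<xi> k). dist x y \<le> dist x' y"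
      by (rule continuous_attains_inf[OF compact_inv_fov_map]) (use ne in \<open>auto intro!: continuous_intros\<close>)
    then show ?thesis unfolding \<eta>_def by (rule someI2_bex) auto
  qed
  have "\<eta> \<longlonglongrightarrow> y"
  proof (rule tendstoI)
    fix e :: real assume "e > 0"
    then obtain d where d: "d > 0" "\<And>z'. z' \<in> numerical_range A \<Longrightarrow> dist z' z < d \<Longrightarrow> \<exists>x\<in>inv_fov_map A z'. dist x y < e"
      using assms(1) by (auto simp: lsc_at_def)
    have "\<forall>\<^sub>F k in sequentially. dist (\<xi> k) z < d" using assms(3) d(1) by (simp add: tendstoD)
    then show "\<forall>\<^sub>F k in sequentially. dist (\<eta> k) y < e"
    proof (rule eventually_mono)
      fix k assume "dist (\<xi> k) z < d"
      then obtain x where "x \<in> inv_fov_map A (\<xi> k)" "dist x y < e" using d(2) assms(2) by blast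
      then show "dist (\<eta> k) y < e" using \<eta>[of k] by force
    qed
  qed
  then show ?thesis using that \<eta> by blast
qed

lemma lsc_atI_sequence:
  assumes y: "y \<in> inv_fov_map A z"
    and *: "\<And>\<xi> e. (\<And>k. \<xi> k \<in> numerical_range A) \<Longrightarrow> \<xi> \<longlonglongrightarrow> z \<Longrightarrow> e > 0 \<Longrightarrow>
      \<exists>k. \<exists>x\<in>inv_fov_map A (\<xi> k). dist x y < e"
  shows "lsc_at A z y"
proof (rule ccontr)
  assume "\<not> ?thesis"
  then obtain e where e: "e > 0" "\<forall>d>0. \<exists>z'\<in>numerical_range A. dist z' z < d \<and> (\<forall>x\<in>inv_fov_map A z'. \<not> dist x y < e)"
    using y by (auto simp: lsc_at_def)
  then have "\<forall>k. \<exists>z'\<in>numerical_range A. dist z' z < inverse (real (Suc k)) \<and> (\<forall>x\<in>inv_fov_map A z'. \<not> dist x y < e)"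
    by auto
  then obtain \<xi> where \<xi>: "\<And>k. \<xi> k \<in> numerical_range A" "\<And>k. dist (\<xi> k) z < inverse (real (Suc k))"
    "\<And>k. \<forall>x\<in>inv_fov_map A (\<xi> k). \<not> dist x y < e" by metis
  have "\<xi> \<longlonglongrightarrow> z"
    by (rule tendsto_dist_iff[THEN iffD2], rule tendsto_sandwich[OF _ _ tendsto_const LIMSEQ_inverse_real_of_nat])
       (use \<xi>(2) in \<open>auto intro!: always_eventually less_imp_le\<close>)
  from *[OF \<xi>(1) this e(1)] \<xi>(3) show False by blast
qed

lemma lsc_at_scale: "lsc_at A z y \<Longrightarrow> cmod c = 1 \<Longrightarrow> lsc_at A z (c *s y)"
  unfolding lsc_at_def
proof (intro conjI allI impI)
  assume *: "y \<in> inv_fov_map A z \<and> (\<forall>e>0. \<exists>d>0. \<forall>z'\<in>numerical_range A. dist z' z < d \<longrightarrow> (\<exists>x\<in>inv_fov_map A z'. dist x y < e))"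
    and c: "cmod c = 1"
  show "c *s y \<in> inv_fov_map A z" using * c by (simp add: inv_fov_map_scale)
  fix e :: real assume "e > 0"
  then obtain d where d: "d > 0" "\<forall>z'\<in>numerical_range A. dist z' z < d \<longrightarrow> (\<exists>x\<in>inv_fov_map A z'. dist x y < e)"
    using * by blast
  have dist: "dist (c *s x) (c *s y) = dist x y" for x
    using norm_scale[of c "x - y"] c by (simp add: dist_norm vector_ssub_ldistrib)
  have "\<exists>x\<in>inv_fov_map A z'. dist x (c *s y) < e" if z': "z' \<in> numerical_range A" "dist z' z < d" for z'
  proof -
    obtain x where "x \<in> inv_fov_map A z'" "dist x y < e" using d z' by blast
    then show ?thesis using dist[of x] inv_fov_map_scale[OF _ c] by (intro bexI[of _ "c *s x"]) auto
  qed
  then show "\<exists>d>0. \<forall>z'\<in>numerical_range A. dist z' z < d \<longrightarrow> (\<exists>x\<in>inv_fov_map A z'. dist x (c *s y) < e)"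
    using d(1) by blast
qed

text \<open>If every \<open>y\<close> had its own bad sequence, finitely many of these sequences, interleaved,
  would contradict weak continuity by compactness of the value.\<close>

lemma weakly_continuous_at_common_limit:
  fixes g :: "'a::metric_space \<Rightarrow> 'b::metric_space set"
  assumes wc: "weakly_continuous_at X g x" and comp: "compact (g x)" and x: "x \<in> X"
  shows "\<exists>y\<in>g x. \<forall>e>0. \<exists>d>0. \<forall>x'\<in>X. dist x' x < d \<longrightarrow> (\<exists>y'\<in>g x'. dist y' y < e)"
proof (rule ccontr)
  assume "\<not> ?thesis"
  then have "\<forall>y\<in>g x. \<exists>e>0. \<forall>d>0. \<exists>x'\<in>X. dist x' x < d \<and> (\<forall>y'\<in>g x'. e \<le> dist y' y)"
    by (meson not_less)
  then obtain e where e: "\<And>y. y \<in> g x \<Longrightarrow> e y > 0"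
    "\<And>y d. y \<in> g x \<Longrightarrow> d > 0 \<Longrightarrow> \<exists>x'\<in>X. dist x' x < d \<and> (\<forall>y'\<in>g x'. e y \<le> dist y' y)"
    by metis
  obtain C where C: "C \<subseteq> g x" "finite C" "g x \<subseteq> (\<Union>y\<in>C. ball y (e y / 2))"
  proof (rule compactE_image[OF comp, of "g x" "\<lambda>y. ball y (e y / 2)"])
    show "g x \<subseteq> (\<Union>y\<in>g x. ball y (e y / 2))" using e(1) by force
  qed auto
  obtain m and f :: "nat \<Rightarrow> 'b" where f: "C = f ` {i. i < m}"
    using finite_imp_nat_seg_image_inj_on[OF C(2)] by blast
  obtain y0 where y0: "y0 \<in> g x"
    using wc x unfolding weakly_continuous_at_def by (metis tendsto_const)
  with C(3) f have m: "m > 0" by (cases m) auto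
  have fm: "f (k mod m) \<in> g x" for k using C(1) f m by auto
  have "\<forall>k. \<exists>x'\<in>X. dist x' x < inverse (real (Suc k)) \<and> (\<forall>y'\<in>g x'. e (f (k mod m)) \<le> dist y' (f (k mod m)))"
    using e(2)[OF fm] by simp
  then obtain \<xi> where \<xi>: "\<And>k. \<xi> k \<in> X" "\<And>k. dist (\<xi> k) x < inverse (real (Suc k))"
    "\<And>k y'. y' \<in> g (\<xi> k) \<Longrightarrow> e (f (k mod m)) \<le> dist y' (f (k mod m))" by metis
  have "\<xi> \<longlonglongrightarrow> x"
    by (rule tendsto_dist_iff[THEN iffD2], rule tendsto_sandwich[OF _ _ tendsto_const LIMSEQ_inverse_real_of_nat])
       (use \<xi>(2) in \<open>auto intro!: always_eventually less_imp_le\<close>)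
  then obtain y \<eta> where y: "y \<in> g x" "\<And>k. \<eta> k \<in> g (\<xi> k)" "\<eta> \<longlonglongrightarrow> y"
    using wc \<xi>(1) unfolding weakly_continuous_at_def by blast
  then obtain i where i: "i < m" "dist (f i) y < e (f i) / 2" using C(3) f by auto
  have "e (f i) > 0" using e(1)[OF fm[of i]] i by simp
  then have "\<forall>\<^sub>F k in sequentially. dist (\<eta> k) y < e (f i) / 2"
    using tendstoD[OF y(3), of "e (f i) / 2"] by simp
  then obtain N where N: "\<And>k. k \<ge> N \<Longrightarrow> dist (\<eta> k) y < e (f i) / 2" by (auto simp: eventually_sequentially)
  define k where "k = N * m + i"
  have "k mod m = i" "k \<ge> N" using i m by (auto simp: k_def intro: trans_le_add1)
  with N[of k] \<xi>(3)[OF y(2), of k] i(2) show False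
    using dist_triangle[of "\<eta> k" "f i" y] by (simp add: dist_commute)
qed

lemma weakly_continuous_lsc:
  assumes "weakly_continuous_at (numerical_range A) (inv_fov_map A) z" "z \<in> numerical_range A"
  obtains y where "lsc_at A z y"
  using weakly_continuous_at_common_limit[OF assms(1) compact_inv_fov_map assms(2)] that
  by (auto simp: lsc_at_def)

text \<open>A nearby \<open>z'\<close> divides the segment from \<open>z\<close> to the point at
  distance \<open>\<rho>\<close> on its ray in the ratio \<open>t = dist z' z / \<rho>\<close>, and
  \<open>segment_near\<close> reaches the fibre over \<open>z'\<close> within
  \<open>sqrt (2 * t)\<close>. The bound \<open>\<rho> * e\<^sup>2 / 2\<close> makes this less than
  \<open>e\<close>.\<close>

lemma conical_lsc:
  assumes con: "conical (numerical_range A) z" and y: "y \<in> inv_fov_map A z"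
  shows "lsc_at A z y"
  unfolding lsc_at_def
proof (intro conjI y allI impI)
  fix e :: real assume e: "e > 0"
  obtain \<rho> where \<rho>: "\<rho> > 0" and in_F: "\<And>\<xi>. \<xi> \<in> numerical_range A \<Longrightarrow> \<xi> \<noteq> z \<Longrightarrow> dist \<xi> z < \<rho> \<Longrightarrow>
      z + (\<rho> / dist \<xi> z) *\<^sub>R (\<xi> - z) \<in> numerical_range A"
    using con by (auto simp: conical_def)
  show "\<exists>d>0. \<forall>z'\<in>numerical_range A. dist z' z < d \<longrightarrow> (\<exists>x\<in>inv_fov_map A z'. dist x y < e)"
  proof (intro exI[of _ "min \<rho> (\<rho> * e\<^sup>2 / 2)"] conjI ballI impI)
    show "0 < min \<rho> (\<rho> * e\<^sup>2 / 2)" using \<rho> e by simp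
    fix z' assume z': "z' \<in> numerical_range A" "dist z' z < min \<rho> (\<rho> * e\<^sup>2 / 2)"
    show "\<exists>x\<in>inv_fov_map A z'. dist x y < e"
    proof (cases "z' = z")
      case True
      then show ?thesis using y e by (intro bexI[of _ y]) auto
    next
      case False
      define t where "t = dist z' z / \<rho>"
      have t: "0 \<le> t" "t \<le> 1" "2 * t < e\<^sup>2" using z' \<rho> by (auto simp: t_def field_simps)
      obtain p where p: "p \<in> inv_fov_map A ((1 - t) *\<^sub>R z + t *\<^sub>R (z + (\<rho> / dist z' z) *\<^sub>R (z' - z)))"
        "dist p y \<le> sqrt (2 * t)"
        using segment_near[OF y in_F[OF z'(1) False] t(1,2)] z'(2) by auto
      have "(1 - t) *\<^sub>R z + t *\<^sub>R (z + (\<rho> / dist z' z) *\<^sub>R (z' - z)) = z'"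
        using False \<rho> by (simp add: t_def algebra_simps)
      moreover have "sqrt (2 * t) < e" using t e by (simp add: real_less_lsqrt)
      ultimately show ?thesis using p by (intro bexI[of _ p]) auto
    qed
  qed
qed

section \<open>Hermitian parts and supporting directions\<close>

definition adj :: "complex ^ 'n ^ 'n \<Rightarrow> complex ^ 'n ^ 'n" where
  "adj A = (\<chi> i j. cnj (A $ j $ i))"

lemma cdot_adj_right: "cdot x (adj A *v y) = cdot (A *v x) y"
proof -
  have "cdot x (adj A *v y) = (\<Sum>i\<in>UNIV. \<Sum>j\<in>UNIV. cnj (x $ i) * (cnj (A $ j $ i) * y $ j))"
    by (simp add: cdot_def adj_def matrix_vector_mult_def sum_distrib_left)
  also have "\<dots> = (\<Sum>j\<in>UNIV. \<Sum>i\<in>UNIV. cnj (x $ i) * (cnj (A $ j $ i) * y $ j))"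
    by (rule sum.swap)
  also have "\<dots> = cdot (A *v x) y"
    by (simp add: cdot_def matrix_vector_mult_def sum_distrib_left sum_distrib_right mult_ac)
  finally show ?thesis .
qed

text \<open>The Hermitian part of \<open>cnj w * A\<close>. The conjugate makes its quadratic form
  at \<open>x\<close> the real inner product of \<open>w\<close> with the value of
  \<open>x\<close>.\<close>

definition herm :: "complex ^ 'n ^ 'n \<Rightarrow> complex \<Rightarrow> complex ^ 'n ^ 'n" where
  "herm A w = (\<chi> i j. (cnj w * A $ i $ j + w * cnj (A $ j $ i)) / 2)"

lemma herm_mult: "herm A w *v x = (cnj w / 2) *s (A *v x) + (w / 2) *s (adj A *v x)"
  by (simp add: vec_eq_iff herm_def adj_def matrix_vector_mult_def sum_distrib_left
      add_divide_distrib distrib_right sum.distrib mult.assoc)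

lemma herm_linear: "herm A (a *\<^sub>R w + b *\<^sub>R w') *v x = a *\<^sub>R (herm A w *v x) + b *\<^sub>R (herm A w' *v x)"
  unfolding herm_mult by (simp add: vec_eq_iff scaleR_conv_of_real[where 'a=complex] algebra_simps add_divide_distrib)

lemma herm_decomp: "herm A w *v x = Re w *\<^sub>R (herm A 1 *v x) + Im w *\<^sub>R (herm A \<i> *v x)"
proof -
  have "w = Re w *\<^sub>R 1 + Im w *\<^sub>R \<i>" by (simp add: complex_eq_iff)
  then show ?thesis using herm_linear by metis
qed

lemma herm_scaleR: "herm A (r *\<^sub>R w) *v x = r *\<^sub>R (herm A w *v x)"
  using herm_linear[of A r w 0 w] by simp

lemma cdot_herm: "cdot x (herm A w *v y) = (cnj w * cdot x (A *v y) + w * cdot (A *v x) y) / 2"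
  by (simp add: herm_mult cdot_algebra cdot_adj_right)

lemma cnj_cdot_herm: "cnj (cdot x (herm A w *v y)) = cdot y (herm A w *v x)"
  by (simp add: cdot_herm cnj_cdot)

lemma cdot_herm_left: "cdot (herm A w *v x) y = cdot x (herm A w *v y)"
  using cnj_cdot_herm[of y A w x] cnj_cdot by metis

lemma cdot_herm_self: "cdot x (herm A w *v x) = complex_of_real (w \<bullet> fov_map A x)"
proof -
  have "cdot (A *v x) x = cnj (fov_map A x)" "cdot x (A *v x) = fov_map A x" by (simp_all add: fov_map_def cnj_cdot)
  then show ?thesis unfolding cdot_herm by (simp add: complex_eq_iff inner_complex_def)
qed

lemma matrix_eq_herm: "A *v x = herm A 1 *v x + \<i> *s (herm A \<i> *v x)"
  unfolding herm_mult by (simp add: vec_eq_iff algebra_simps)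

lemma adj_eq_herm: "adj A *v x = herm A 1 *v x - \<i> *s (herm A \<i> *v x)"
  unfolding herm_mult by (simp add: vec_eq_iff algebra_simps)

text \<open>A nonnegative Hermitian form that vanishes at \<open>m\<close> is minimal there, so its
  first variation vanishes in every direction of \<open>V\<close>.\<close>

lemma psd_form:
  fixes B :: "complex ^ 'n \<Rightarrow> complex ^ 'n \<Rightarrow> complex"
  assumes B: "\<And>x y u. B u (x + y) = B u x + B u y" "\<And>c x u. B u (c *s x) = c * B u x"
    "\<And>x y. B x y = cnj (B y x)"
    and V: "\<And>x y. x \<in> V \<Longrightarrow> y \<in> V \<Longrightarrow> x + y \<in> V" "\<And>c x. x \<in> V \<Longrightarrow> c *s x \<in> V"
    and pos: "\<And>x. x \<in> V \<Longrightarrow> Re (B x x) \<ge> 0" and m: "m \<in> V" "Re (B m m) = 0" and x: "x \<in> V"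
  shows "B x m = 0"
proof -
  define c where "c = B x m"
  define q where "q = Re (B x x)"
  \<comment> \<open>Small enough that \<open>t * q < 2\<close>, so that at \<open>m + s x\<close>
    the linear term outweighs the quadratic one unless \<open>c = 0\<close>.\<close>
  define t where "t = 1 / (q + 1)"
  have q: "q \<ge> 0" using pos x by (simp add: q_def)
  define s where "s = - complex_of_real t * c"
  have B1: "B (x + y) u = B x u + B y u" "B (c *s x) u = cnj c * B x u" for x y u c
    using B(1)[of u x y] B(2)[of u c x] B(3)[of "x + y" u] B(3)[of "c *s x" u] B(3)[of x u] B(3)[of y u]
    by simp_all
  have "0 \<le> Re (B (m + s *s x) (m + s *s x))" using pos V m x by blast
  also have "B (m + s *s x) (m + s *s x) = B m m + (cnj s * c + cnj (cnj s * c)) + s * cnj s * B x x"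
    using B(3)[of m x] by (simp add: B(1,2) B1 c_def algebra_simps)
  also have "s * cnj s = complex_of_real (t\<^sup>2 * (cmod c)\<^sup>2)"
    unfolding of_real_mult complex_norm_square by (simp add: s_def power2_eq_square)
  also have "cnj s * c = - complex_of_real (t * (cmod c)\<^sup>2)"
    unfolding of_real_mult complex_norm_square by (simp add: s_def)
  finally have "0 \<le> - 2 * t * (cmod c)\<^sup>2 + t\<^sup>2 * (cmod c)\<^sup>2 * q"
    using m(2) by (simp add: q_def)
  also have "\<dots> = - t * (cmod c)\<^sup>2 * (2 - t * q)" by (simp add: power2_eq_square algebra_simps)
  finally have "t * (cmod c)\<^sup>2 * (2 - t * q) \<le> 0" by simp
  moreover have "t > 0" "t * q < 2" using q by (simp_all add: t_def divide_simps)
  ultimately have "(cmod c)\<^sup>2 \<le> 0" by (simp add: mult_le_0_iff)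
  then show ?thesis by (simp add: c_def)
qed

section \<open>Support function and top eigenspaces\<close>

definition lam :: "complex ^ 'n ^ 'n \<Rightarrow> complex \<Rightarrow> real" where
  "lam A w = Sup ((\<lambda>z. w \<bullet> z) ` numerical_range A)"

text \<open>\<open>lam A w\<close> is the largest eigenvalue of \<open>herm A w\<close>; the unit
  vectors of its eigenspace are those whose value maximises the inner product with
  \<open>w\<close>.\<close>

definition eig :: "complex ^ 'n ^ 'n \<Rightarrow> complex \<Rightarrow> (complex ^ 'n) set" where
  "eig A w = {x. herm A w *v x = complex_of_real (lam A w) *s x}"

lemma numerical_range_nonempty: "numerical_range A \<noteq> {}"
proof -
  obtain x :: "complex ^ 'a" where "norm x = 1" using vector_choose_size[of 1] by auto
  then show ?thesis using fov_map_mem by blast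
qed

lemma lam_upper: "z \<in> numerical_range A \<Longrightarrow> w \<bullet> z \<le> lam A w"
  unfolding lam_def
  by (intro cSUP_upper bounded_imp_bdd_above compact_imp_bounded compact_continuous_image
      compact_numerical_range continuous_intros) auto

lemma lam_attained: obtains z where "z \<in> numerical_range A" "w \<bullet> z = lam A w"
proof -
  have "continuous_on (numerical_range A) (\<lambda>z. w \<bullet> z)" by (intro continuous_intros)
  then obtain z where z: "z \<in> numerical_range A" "\<And>z'. z' \<in> numerical_range A \<Longrightarrow> w \<bullet> z' \<le> w \<bullet> z"
    using continuous_attains_sup[OF compact_numerical_range[of A] numerical_range_nonempty[of A], of "\<lambda>z. w \<bullet> z"]
    by blast
  then have "lam A w = w \<bullet> z" unfolding lam_def by (intro cSup_eq_maximum) auto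
  with z that show ?thesis by simp
qed

lemma supports_iff_lam: "supports w (numerical_range A) z \<longleftrightarrow> z \<in> numerical_range A \<and> w \<bullet> z = lam A w"
  by (metis supports_def lam_attained lam_upper order_antisym)

lemma lam_scale: "0 < r \<Longrightarrow> lam A (r *\<^sub>R w) = r * lam A w"
  by (metis lam_attained supports_iff_lam supports_scale inner_scaleR_left)

lemma fov_map_scaled_mem:
  obtains z where "z \<in> numerical_range A" "fov_map A x = z * complex_of_real ((norm x)\<^sup>2)"
proof (cases "x = 0")
  case True
  then show ?thesis using that numerical_range_nonempty[of A] by auto
next
  case False
  define z where "z = fov_map A (complex_of_real (1 / norm x) *s x)"
  have "z \<in> numerical_range A" unfolding z_def using False by (intro fov_map_mem) (simp add: norm_scale norm_divide)
  moreover have "fov_map A x = z * complex_of_real ((norm x)\<^sup>2)"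
    using False by (simp add: z_def fov_map_scale norm_divide power_divide)
  ultimately show ?thesis using that by blast
qed

lemma inner_times_of_real: "w \<bullet> (z * complex_of_real r) = r * (w \<bullet> z)" for w z :: complex
  by (simp add: inner_complex_def algebra_simps)

lemma fov_map_le_lam: "w \<bullet> fov_map A x \<le> lam A w * (norm x)\<^sup>2"
proof -
  obtain z where "z \<in> numerical_range A" "fov_map A x = z * complex_of_real ((norm x)\<^sup>2)"
    by (rule fov_map_scaled_mem)
  then show ?thesis
    using mult_right_mono[OF lam_upper[of z A w], of "(norm x)\<^sup>2"]
    by (simp add: inner_times_of_real mult.commute del: of_real_power)
qed

text \<open>The form \<open>c - herm A w\<close> is nonnegative on \<open>V\<close> and vanishes at
  \<open>m\<close>. The eigenvector equation is tested only against \<open>V\<close>, which may fail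
  to be invariant: it says that \<open>m\<close> is an eigenvector of the compression to
  \<open>V\<close>.\<close>

lemma psd_herm:
  assumes V: "\<And>x y. x \<in> V \<Longrightarrow> y \<in> V \<Longrightarrow> x + y \<in> V" "\<And>c x. x \<in> V \<Longrightarrow> c *s x \<in> V"
    and pos: "\<And>x. x \<in> V \<Longrightarrow> w \<bullet> fov_map A x \<le> c * (norm x)\<^sup>2"
    and m: "m \<in> V" "w \<bullet> fov_map A m = c * (norm m)\<^sup>2" and x: "x \<in> V"
  shows "cdot x (herm A w *v m) = complex_of_real c * cdot x m"
proof -
  let ?B = "\<lambda>x y. complex_of_real c * cdot x y - cdot x (herm A w *v y)"
  have "?B x m = 0"
  proof (rule psd_form[where V = V and B = ?B, OF _ _ _ V _ m(1) _ x])
    show "?B x y = cnj (?B y x)" for x y by (simp add: cnj_cdot cdot_herm_left)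
    show "Re (?B x x) \<ge> 0" if "x \<in> V" for x
      using pos[OF that] by (simp add: cdot_herm_self cdot_self del: of_real_power)
    show "Re (?B m m) = 0" using m(2) by (simp add: cdot_herm_self cdot_self del: of_real_power)
  qed (simp_all add: cdot_algebra matrix_vector_right_distrib vector_scalar_commute algebra_simps)
  then show ?thesis by simp
qed

lemma eq_of_cdot: "(\<And>u. cdot u x = cdot u y) \<Longrightarrow> x = y"
  by (metis cdot_diff_right cdot_self eq_iff_diff_eq_0 norm_eq_zero of_real_eq_0_iff power2_eq_square mult_eq_0_iff)

lemma eig_iff_value: "x \<in> eig A w \<longleftrightarrow> w \<bullet> fov_map A x = lam A w * (norm x)\<^sup>2"
proof
  assume "x \<in> eig A w"
  then have "cdot x (herm A w *v x) = complex_of_real (lam A w) * cdot x x"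
    by (simp add: eig_def cdot_scale_right)
  then show "w \<bullet> fov_map A x = lam A w * (norm x)\<^sup>2"
    unfolding cdot_herm_self cdot_self of_real_mult[symmetric] of_real_eq_iff .
next
  assume *: "w \<bullet> fov_map A x = lam A w * (norm x)\<^sup>2"
  have "cdot u (herm A w *v x) = complex_of_real (lam A w) * cdot u x" for u
    by (rule psd_herm[where V = UNIV]) (auto simp: fov_map_le_lam *)
  then show "x \<in> eig A w" unfolding eig_def by (auto intro!: eq_of_cdot simp: cdot_scale_right)
qed

lemma eig_add: "x \<in> eig A w \<Longrightarrow> y \<in> eig A w \<Longrightarrow> x + y \<in> eig A w"
  by (simp add: eig_def matrix_vector_right_distrib vector_add_ldistrib)

lemma eig_scale: "x \<in> eig A w \<Longrightarrow> c *s x \<in> eig A w"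
  by (simp add: eig_def vector_scalar_commute vector_smult_assoc mult.commute)

lemma eig_scaleR: "x \<in> eig A w \<Longrightarrow> r *\<^sub>R x \<in> eig A w"
  by (simp add: scaleR_eq_scale eig_scale)

lemma subspace_eig: "subspace (eig A w)"
  by (simp add: subspace_def eig_add eig_scaleR) (simp add: eig_def)

lemma eig_homogeneous: "0 < r \<Longrightarrow> eig A (r *\<^sub>R w) = eig A w"
proof -
  assume r: "0 < r"
  have "complex_of_real (r * lam A w) *s x = r *\<^sub>R (complex_of_real (lam A w) *s x)" for x :: "complex ^ 'a"
    by (simp add: scaleR_eq_scale vector_smult_assoc)
  then show ?thesis using r by (simp add: eig_def herm_scaleR lam_scale)
qed

lemma eig_iff_supports:
  assumes "x \<in> inv_fov_map A z"
  shows "x \<in> eig A w \<longleftrightarrow> supports w (numerical_range A) z"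
  using assms by (auto simp: eig_iff_value supports_iff_lam inv_fov_map_iff fov_map_mem)

lemma eig_unit_supports:
  assumes "x \<in> eig A w" "norm x = 1"
  shows "supports w (numerical_range A) (fov_map A x)"
  using assms eig_iff_supports[of x A "fov_map A x"] by (simp add: inv_fov_map_iff)

lemma eig_unit_exists: obtains x where "x \<in> eig A w" "norm x = 1"
proof -
  obtain z where z: "z \<in> numerical_range A" "w \<bullet> z = lam A w" by (rule lam_attained)
  then obtain x where "x \<in> inv_fov_map A z" by (auto simp: numerical_range_iff)
  then show ?thesis using that eig_iff_supports z supports_iff_lam by (metis inv_fov_map_iff)
qed

section \<open>Extreme points\<close>

text \<open>The cone over the fibre. For an extreme point \<open>z\<close> it is a complex subspace,
  on which the compression of \<open>A\<close> is the scalar \<open>z\<close>.\<close>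

definition ext_space :: "complex ^ 'n ^ 'n \<Rightarrow> complex \<Rightarrow> (complex ^ 'n) set" where
  "ext_space A z = {x. fov_map A x = z * complex_of_real ((norm x)\<^sup>2)}"

lemma ext_space_unit: "norm x = 1 \<Longrightarrow> x \<in> ext_space A z \<longleftrightarrow> x \<in> inv_fov_map A z"
  by (simp add: ext_space_def inv_fov_map_iff)

lemma ext_space_normalize:
  "x \<in> ext_space A z \<Longrightarrow> x \<noteq> 0 \<Longrightarrow> complex_of_real (1 / norm x) *s x \<in> inv_fov_map A z"
  unfolding ext_space_def using normalize_mem by blast

lemma ext_space_scale: "x \<in> ext_space A z \<Longrightarrow> c *s x \<in> ext_space A z"
  by (simp add: ext_space_def fov_map_scale norm_scale power_mult_distrib)

text \<open>By the parallelogram law \<open>z\<close> is an average of the normalised values of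
  \<open>x + y\<close> and \<open>x - y\<close> with weights proportional to \<open>N1\<close> and
  \<open>N2\<close>; if both are positive, extremality makes both values equal to
  \<open>z\<close>.\<close>

lemma ext_space_parallelogram:
  assumes z: "z extreme_point_of numerical_range A" and x: "x \<in> ext_space A z" and y: "y \<in> ext_space A z"
  shows "x + y \<in> ext_space A z"
proof -
  obtain z1 where z1: "z1 \<in> numerical_range A" "fov_map A (x + y) = z1 * complex_of_real ((norm (x + y))\<^sup>2)"
    by (rule fov_map_scaled_mem)
  obtain z2 where z2: "z2 \<in> numerical_range A" "fov_map A (x - y) = z2 * complex_of_real ((norm (x - y))\<^sup>2)"
    by (rule fov_map_scaled_mem)
  define N1 where "N1 = (norm (x + y))\<^sup>2"
  define N2 where "N2 = (norm (x - y))\<^sup>2"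
  have "fov_map A (x + y) + fov_map A (x - y) = 2 * fov_map A x + 2 * fov_map A y"
    by (simp add: fov_map_def matrix_vector_right_distrib matrix_vector_mult_diff_distrib cdot_algebra)
  moreover have N: "N1 + N2 = 2 * (norm x)\<^sup>2 + 2 * (norm y)\<^sup>2"
    unfolding N1_def N2_def norm_add_cdot norm_diff_cdot by simp
  ultimately have eq: "z1 * complex_of_real N1 + z2 * complex_of_real N2 = z * complex_of_real (N1 + N2)"
    using x y z1 z2 unfolding N by (simp add: ext_space_def N1_def N2_def algebra_simps)
  show ?thesis
  proof (cases "N1 = 0")
    case True
    then show ?thesis by (simp add: N1_def ext_space_def)
  next
    case False
    then have N1: "N1 > 0" by (simp add: N1_def)
    have "z1 = z"
    proof (cases "N2 = 0")
      case True
      then show ?thesis using eq False by simp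
    next
      case False2: False
      then have N2: "N2 > 0" by (simp add: N2_def)
      define u where "u = N2 / (N1 + N2)"
      have u: "0 < u" "u < 1" using N1 N2 by (auto simp: u_def)
      have "complex_of_real (N1 + N2) \<noteq> 0" using N1 N2 by (metis add_pos_pos less_irrefl of_real_eq_0_iff)
      then have "z = (1 - u) *\<^sub>R z1 + u *\<^sub>R z2"
        using eq N1 N2 by (simp add: u_def scaleR_conv_of_real divide_simps) (simp add: algebra_simps)
      then have "z1 \<noteq> z2 \<Longrightarrow> z \<in> open_segment z1 z2" using u by (auto simp: in_segment)
      then have "z1 = z2" using z z1 z2 by (auto simp: extreme_point_of_def)
      then show ?thesis using \<open>z = _\<close> by (simp add: algebra_simps)
    qed
    then show ?thesis using z1 by (simp add: ext_space_def)
  qed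
qed

text \<open>Polarisation: the sums of \<open>x\<close> with \<open>y\<close> and with
  \<open>\<i> *s y\<close> lie in the subspace, which determines the form on the pair.\<close>

lemma ext_space_sesquilinear:
  assumes z: "z extreme_point_of numerical_range A" and x: "x \<in> ext_space A z" and y: "y \<in> ext_space A z"
  shows "cdot x (A *v y) = z * cdot x y"
proof -
  have pol: "cdot x (A *v y) + cdot y (A *v x) = z * (cdot x y + cdot y x)" if "y \<in> ext_space A z" for y
  proof -
    have "fov_map A (x + y) = z * cdot (x + y) (x + y)" "fov_map A x = z * cdot x x" "fov_map A y = z * cdot y y"
      using ext_space_parallelogram[OF z x that] x that unfolding cdot_self by (simp_all add: ext_space_def)
    then show ?thesis by (simp add: fov_map_add cdot_algebra algebra_simps)
  qed
  have 1: "cdot x (A *v y) + cdot y (A *v x) = z * (cdot x y + cdot y x)" by (rule pol[OF y])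
  have 2: "\<i> * cdot x (A *v y) - \<i> * cdot y (A *v x) = z * (\<i> * cdot x y - \<i> * cdot y x)"
    using pol[OF ext_space_scale[OF y, of \<i>]]
    by (simp add: vector_scalar_commute cdot_algebra)
  have "2 * cdot x (A *v y) = (cdot x (A *v y) + cdot y (A *v x)) - \<i> * (\<i> * cdot x (A *v y) - \<i> * cdot y (A *v x))"
    by (simp add: algebra_simps)
  also have "\<dots> = 2 * (z * cdot x y)" unfolding 1 2 by (simp add: algebra_simps)
  finally show ?thesis by simp
qed

lemma ext_space_herm:
  assumes z: "z extreme_point_of numerical_range A" and x: "x \<in> ext_space A z" and y: "y \<in> ext_space A z"
  shows "cdot x (herm A w *v y) = complex_of_real (w \<bullet> z) * cdot x y"
proof -
  have "cdot (A *v x) y = cnj z * cdot x y"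
    using ext_space_sesquilinear[OF z y x] cnj_cdot[of y "A *v x"] by (simp add: cnj_cdot)
  moreover have "complex_of_real (w \<bullet> z) = (cnj w * z + w * cnj z) / 2"
    by (simp add: complex_eq_iff inner_complex_def)
  ultimately show ?thesis
    by (simp add: cdot_herm ext_space_sesquilinear[OF z x y] algebra_simps add_divide_distrib)
qed

section \<open>Reducing eigenvectors\<close>

text \<open>A joint eigenvector of \<open>A\<close> and its adjoint: the line of \<open>x\<close>
  and its orthogonal complement are both invariant under \<open>A\<close>.\<close>

definition reducing :: "complex ^ 'n ^ 'n \<Rightarrow> complex \<Rightarrow> complex ^ 'n \<Rightarrow> bool" where
  "reducing A z x \<longleftrightarrow> A *v x = z *s x \<and> adj A *v x = cnj z *s x"

lemma reducing_two_directions: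
  assumes "herm A w *v x = complex_of_real (w \<bullet> z) *s x" "herm A w' *v x = complex_of_real (w' \<bullet> z) *s x"
    and D: "Im (cnj w * w') \<noteq> 0"
  shows "reducing A z x"
proof -
  have all: "herm A u *v x = complex_of_real (u \<bullet> z) *s x" for u
  proof -
    \<comment> \<open>Cramer's rule in the real basis \<open>w\<close>, \<open>w'\<close> of the
      plane, whose determinant is \<open>Im (cnj w * w')\<close>. The eigenvector equation is linear
      in the direction and so extends to every \<open>u\<close>.\<close>
    define a where "a = Im (cnj u * w') / Im (cnj w * w')"
    define b where "b = Im (cnj w * u) / Im (cnj w * w')"
    have "u = a *\<^sub>R w + b *\<^sub>R w'"
      using D unfolding a_def b_def complex_eq_iff by (simp add: divide_simps) (simp add: algebra_simps)
    then show ?thesis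
      using assms(1,2) by (simp add: herm_linear inner_add_left) (simp add: scaleR_eq_scale vec_eq_iff algebra_simps)
  qed
  show ?thesis
    unfolding reducing_def matrix_eq_herm[of A x] adj_eq_herm all
    by (simp add: vec_eq_iff complex_eq_iff inner_complex_def algebra_simps)
qed

lemma unit_parallel:
  assumes "norm w = 1" "norm w' = 1" "Im (cnj w * w') = 0"
  shows "w' = w \<or> w' = - w"
proof -
  define r where "r = Re (cnj w * w')"
  have cw: "cnj w * w' = complex_of_real r" using assms(3) by (simp add: complex_eq_iff r_def)
  have ww: "w * cnj w = 1" using assms(1) by (simp add: complex_norm_square[symmetric])
  have "w' = (w * cnj w) * w'" by (simp add: ww)
  also have "\<dots> = complex_of_real r * w" using cw by (simp add: mult_ac)
  finally have w': "w' = complex_of_real r * w" .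
  then have "\<bar>r\<bar> = 1" using assms by (simp add: norm_mult)
  then show ?thesis using w' by (auto simp: abs_if split: if_splits)
qed

text \<open>At a corner every fibre vector is a top eigenvector in two directions. They are not
  opposite, since an interior point lies strictly below both supporting lines, so they span the
  plane.\<close>

lemma reducing_two_supports:
  assumes int: "interior (numerical_range A) \<noteq> {}"
    and w: "norm w = 1" "supports w (numerical_range A) z"
    and w': "norm w' = 1" "supports w' (numerical_range A) z" and ne: "w \<noteq> w'"
    and x: "x \<in> inv_fov_map A z"
  shows "reducing A z x"
proof (rule reducing_two_directions)
  show "herm A w *v x = complex_of_real (w \<bullet> z) *s x" "herm A w' *v x = complex_of_real (w' \<bullet> z) *s x"
    using eig_iff_supports[OF x] w w' by (auto simp: eig_def supports_iff_lam)
  show "Im (cnj w * w') \<noteq> 0"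
  proof
    assume "Im (cnj w * w') = 0"
    then have "w' = - w" using unit_parallel w(1) w'(1) ne by blast
    obtain p where p: "p \<in> interior (numerical_range A)" using int by blast
    have "w \<bullet> p < w \<bullet> z" "w' \<bullet> p < w' \<bullet> z"
      using supports_interior_less[OF w(2) p] supports_interior_less[OF w'(2) p] w(1) w'(1) by force+
    then show False using \<open>w' = - w\<close> by simp
  qed
qed

lemma reducing_split:
  assumes r: "reducing A z r" "norm r = 1" and c: "c = cdot r x"
  shows "fov_map A x = complex_of_real ((cmod c)\<^sup>2) * z + fov_map A (x - c *s r)"
    and "(norm (x - c *s r))\<^sup>2 = (norm x)\<^sup>2 - (cmod c)\<^sup>2"
proof -
  have rr: "cdot r r = 1" using r(2) by (simp add: cdot_self)
  have xr: "cdot x r = cnj c" by (simp add: c cnj_cdot)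
  have A: "cdot r (A *v u) = z * cdot r u" for u
  proof -
    have "cdot r (A *v u) = cnj (cdot (A *v u) r)" by (simp add: cnj_cdot)
    also have "cdot (A *v u) r = cnj z * cdot u r"
      using r(1) by (metis cdot_adj_right cdot_scale_right reducing_def)
    finally show ?thesis by (simp add: cnj_cdot)
  qed
  have Ar: "A *v r = z *s r" using r(1) by (simp add: reducing_def)
  show "fov_map A x = complex_of_real ((cmod c)\<^sup>2) * z + fov_map A (x - c *s r)"
    unfolding complex_norm_square
    by (simp add: fov_map_def matrix_vector_mult_diff_distrib vector_scalar_commute cdot_algebra Ar A rr xr c[symmetric])
  have "complex_of_real ((norm (x - c *s r))\<^sup>2) = complex_of_real ((norm x)\<^sup>2 - (cmod c)\<^sup>2)"
    unfolding of_real_diff complex_norm_square cdot_self[symmetric]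
    by (simp add: cdot_algebra rr xr c[symmetric])
  then show "(norm (x - c *s r))\<^sup>2 = (norm x)\<^sup>2 - (cmod c)\<^sup>2" using of_real_eq_iff by blast
qed

text \<open>Splitting off the reducing component moves a point of the range further away from \<open>z\<close>
  on the same ray, so no ray from \<open>z\<close> can end near \<open>z\<close>.\<close>

lemma reducing_conical:
  assumes z: "z \<in> numerical_range A" and c: "c > 0" and \<rho>: "\<rho> > 0"
    and near: "\<And>\<xi>. \<xi> \<in> numerical_range A \<Longrightarrow> dist \<xi> z < \<rho> \<Longrightarrow>
       \<exists>x\<in>inv_fov_map A \<xi>. \<exists>r. norm r = 1 \<and> reducing A z r \<and> c \<le> cmod (cdot r x)"
  shows "conical (numerical_range A) z"
  unfolding conical_def
proof (intro exI[of _ "\<rho> / 2"] conjI ballI impI)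
  fix \<xi> assume \<xi>: "\<xi> \<in> numerical_range A" "\<xi> \<noteq> z \<and> dist \<xi> z < \<rho> / 2"
  define d where "d = (1 / dist \<xi> z) *\<^sub>R (\<xi> - z)"
  have nd: "norm d = 1" using \<xi> by (simp add: d_def dist_norm)
  define T where "T = {s. 0 \<le> s \<and> z + s *\<^sub>R d \<in> numerical_range A}"
  have T0: "dist \<xi> z \<in> T" using \<xi> by (simp add: T_def d_def)
  have "T = {0..} \<inter> (\<lambda>s. z + s *\<^sub>R d) -` numerical_range A" by (auto simp: T_def)
  moreover have "closed ((\<lambda>s. z + s *\<^sub>R d) -` numerical_range A)"
    by (intro closed_vimage compact_imp_closed compact_numerical_range continuous_intros)
  moreover have "bounded T"
  proof -
    obtain b where b: "\<And>x. x \<in> numerical_range A \<Longrightarrow> norm x \<le> b"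
      using compact_imp_bounded[OF compact_numerical_range[of A]] unfolding bounded_iff by auto
    have "norm s \<le> b + norm z" if "s \<in> T" for s
      using b[of "z + s *\<^sub>R d"] that nd norm_triangle_ineq2[of "s *\<^sub>R d" "- z"] by (simp add: T_def add.commute)
    then show ?thesis by (auto simp: bounded_iff)
  qed
  ultimately have "compact T" by (metis closed_Int closed_atLeast compact_eq_bounded_closed)
  then obtain s where s: "s \<in> T" "\<And>t. t \<in> T \<Longrightarrow> t \<le> s"
    using continuous_attains_sup[of T "\<lambda>s. s"] T0 by (auto intro: continuous_intros)
  have s0: "s > 0" using s(2)[OF T0] \<xi> by (simp add: dist_norm less_le_trans[of 0 "norm (\<xi> - z)"])
  have "s \<ge> \<rho> / 2"
  proof (rule ccontr)
    assume small: "\<not> ?thesis"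
    define \<omega> where "\<omega> = z + s *\<^sub>R d"
    have \<omega>: "\<omega> \<in> numerical_range A" "dist \<omega> z < \<rho>"
      using s(1) small s0 \<rho> nd by (auto simp: \<omega>_def T_def dist_norm)
    then obtain x r where x: "x \<in> inv_fov_map A \<omega>" and r: "norm r = 1" "reducing A z r" "c \<le> cmod (cdot r x)"
      using near by blast
    define u where "u = x - cdot r x *s r"
    define n where "n = (norm u)\<^sup>2"
    have sp: "\<omega> = complex_of_real (1 - n) * z + fov_map A u" "n = 1 - (cmod (cdot r x))\<^sup>2"
      using reducing_split[OF r(2,1) refl, of x] x by (simp_all add: u_def n_def inv_fov_map_iff)
    have n1: "n < 1" using sp(2) r(3) c by (smt (verit) zero_less_power2)
    obtain \<omega>' where \<omega>': "\<omega>' \<in> numerical_range A" "fov_map A u = \<omega>' * complex_of_real n"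
      unfolding n_def by (rule fov_map_scaled_mem)
    have eq: "s *\<^sub>R d = n *\<^sub>R (\<omega>' - z)"
      using sp(1) \<omega>'(2) by (simp add: \<omega>_def scaleR_conv_of_real algebra_simps)
    have n0: "n > 0"
    proof (rule ccontr)
      assume "\<not> n > 0"
      then have "n = 0" by (simp add: n_def)
      then show False using eq s0 nd by (metis norm_eq_zero scaleR_eq_0_iff less_irrefl zero_neq_one)
    qed
    have "\<omega>' = z + (s / n) *\<^sub>R d"
    proof -
      have "(1 / n) *\<^sub>R (s *\<^sub>R d) = \<omega>' - z" unfolding eq using n0 by simp
      then show ?thesis by (simp add: algebra_simps)
    qed
    then have "s / n \<in> T" using \<omega>'(1) s0 n0 by (simp add: T_def)
    then have "s / n \<le> s" by (rule s(2))
    then show False using s0 n0 n1 by (simp add: divide_simps)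
  qed
  define t where "t = (\<rho> / 2) / s"
  have t: "0 \<le> t" "t \<le> 1" using \<open>s \<ge> \<rho> / 2\<close> \<rho> s0 by (simp_all add: t_def)
  have "(1 - t) *\<^sub>R z + t *\<^sub>R (z + s *\<^sub>R d) \<in> numerical_range A"
    using convexD[OF convex_numerical_range z, of "z + s *\<^sub>R d" "1 - t" t] s(1) t by (simp add: T_def)
  moreover have "(1 - t) *\<^sub>R z + t *\<^sub>R (z + s *\<^sub>R d) = z + (\<rho> / 2 / dist \<xi> z) *\<^sub>R (\<xi> - z)"
    using s0 by (simp add: t_def d_def algebra_simps)
  ultimately show "z + (\<rho> / 2 / dist \<xi> z) *\<^sub>R (\<xi> - z) \<in> numerical_range A" by simp
qed (use \<rho> in auto)

lemma inv_fov_map_usc: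
  assumes e: "e > 0"
  obtains d where "d > 0" "\<And>z' x. dist z' z < d \<Longrightarrow> x \<in> inv_fov_map A z' \<Longrightarrow> \<exists>r\<in>inv_fov_map A z. dist x r < e"
proof (rule ccontr)
  assume "\<not> thesis"
  then have "\<forall>k. \<exists>z' x. dist z' z < inverse (real (Suc k)) \<and> x \<in> inv_fov_map A z' \<and> (\<forall>r\<in>inv_fov_map A z. \<not> dist x r < e)"
    using that by (metis inverse_positive_iff_positive of_nat_0_less_iff zero_less_Suc)
  then obtain \<zeta> x where \<zeta>: "\<And>k. dist (\<zeta> k) z < inverse (real (Suc k))" "\<And>k. x k \<in> inv_fov_map A (\<zeta> k)"
    "\<And>k r. r \<in> inv_fov_map A z \<Longrightarrow> \<not> dist (x k) r < e" by metis
  have \<zeta>z: "\<zeta> \<longlonglongrightarrow> z"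
    by (rule tendsto_dist_iff[THEN iffD2], rule tendsto_sandwich[OF _ _ tendsto_const LIMSEQ_inverse_real_of_nat])
       (use \<zeta>(1) in \<open>auto intro!: always_eventually less_imp_le\<close>)
  have "\<forall>k. x k \<in> sphere 0 1" using \<zeta>(2) by (simp add: inv_fov_map_iff)
  moreover have "compact (sphere (0 :: complex ^ 'a) 1)" by simp
  ultimately obtain l f where l: "l \<in> sphere 0 1" "strict_mono f" "(x \<circ> f) \<longlonglongrightarrow> l"
    unfolding compact_def by blast
  have "(\<lambda>k. fov_map A ((x \<circ> f) k)) \<longlonglongrightarrow> fov_map A l" by (intro tendsto_fov_map l)
  moreover have "(\<lambda>k. fov_map A ((x \<circ> f) k)) = \<zeta> \<circ> f" using \<zeta>(2) by (auto simp: inv_fov_map_iff)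
  ultimately have "fov_map A l = z" using LIMSEQ_subseq_LIMSEQ[OF \<zeta>z l(2)] LIMSEQ_unique by metis
  then have "l \<in> inv_fov_map A z" using l(1) by (simp add: inv_fov_map_iff)
  moreover have "\<forall>\<^sub>F k in sequentially. dist ((x \<circ> f) k) l < e" by (rule tendstoD[OF l(3) e])
  then obtain k where "dist (x (f k)) l < e" using eventually_happens'[OF sequentially_bot] by fastforce
  ultimately show False using \<zeta>(3) by blast
qed

text \<open>By upper semicontinuity every vector over a nearby point is within 1 of some unit vector
  \<open>r\<close> over \<open>z\<close>, so its overlap with the reducing vector \<open>r\<close>
  is at least 1/2 and \<open>reducing_conical\<close> applies.\<close>

lemma corner_lsc:
  assumes red: "\<And>x. x \<in> inv_fov_map A z \<Longrightarrow> reducing A z x" and y: "y \<in> inv_fov_map A z"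
  shows "lsc_at A z y"
proof (rule conical_lsc[OF _ y])
  obtain d where d: "d > 0" "\<And>z' x. dist z' z < d \<Longrightarrow> x \<in> inv_fov_map A z' \<Longrightarrow> \<exists>r\<in>inv_fov_map A z. dist x r < 1"
    using inv_fov_map_usc[of 1 z A] by (auto)
  show "conical (numerical_range A) z"
  proof (rule reducing_conical[where c = "1/2" and \<rho> = d])
    show "z \<in> numerical_range A" using y by (auto simp: numerical_range_iff)
    fix \<xi> assume \<xi>: "\<xi> \<in> numerical_range A" "dist \<xi> z < d"
    then obtain x r where x: "x \<in> inv_fov_map A \<xi>" and r: "r \<in> inv_fov_map A z" "dist x r < 1"
      using d(2) inv_fov_map_nonempty by metis
    have "(norm (r - x))\<^sup>2 < 1"
      using r(2) by (simp add: dist_norm norm_minus_commute power2_eq_square mult_less_cancel_left2 abs_square_less_1 flip: power2_eq_square)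
    then have "1 / 2 \<le> Re (cdot r x)"
      using x r(1) by (simp add: norm_diff_cdot inv_fov_map_iff)
    also have "\<dots> \<le> cmod (cdot r x)" by (rule complex_Re_le_cmod)
    finally show "\<exists>x\<in>inv_fov_map A \<xi>. \<exists>r. norm r = 1 \<and> reducing A z r \<and> 1 / 2 \<le> cmod (cdot r x)"
      using r(1) red by (intro bexI[OF _ x] exI[of _ r]) (auto simp: inv_fov_map_iff)
  qed (use d in auto)
qed

text \<open>Fibres near \<open>z\<close> contain vectors close to \<open>y\<close>, whose overlap
  with \<open>r\<close> is at least half that of \<open>y\<close>. Read backwards: at a point that
  is not conical, approximable vectors are orthogonal to the reducing ones of the fibre.\<close>

lemma lsc_reducing_conical:
  assumes y: "lsc_at A z y" and r: "r \<in> inv_fov_map A z" "reducing A z r" "cdot y r \<noteq> 0"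
  shows "conical (numerical_range A) z"
proof -
  define c where "c = cmod (cdot r y) / 2"
  have c: "c > 0" using r(3) cnj_cdot[of y r] by (auto simp: c_def)
  obtain d where d: "d > 0" "\<And>z'. z' \<in> numerical_range A \<Longrightarrow> dist z' z < d \<Longrightarrow> \<exists>x\<in>inv_fov_map A z'. dist x y < c"
    using y c by (auto simp: lsc_at_def)
  show ?thesis
  proof (rule reducing_conical[OF _ c d(1)])
    show "z \<in> numerical_range A" using r by (auto simp: numerical_range_iff)
    fix \<xi> assume "\<xi> \<in> numerical_range A" "dist \<xi> z < d"
    then obtain x where x: "x \<in> inv_fov_map A \<xi>" "dist x y < c" using d(2) by blast
    have "cmod (cdot r y) \<le> cmod (cdot r x) + cmod (cdot r (y - x))"
      using norm_triangle_ineq[of "cdot r x" "cdot r (y - x)"] by (simp add: cdot_diff_right)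
    also have "cmod (cdot r (y - x)) \<le> norm (y - x)" using cmod_cdot_le[of r "y - x"] r(1) by (simp add: inv_fov_map_iff)
    also have "\<dots> < c" using x(2) by (simp add: dist_norm norm_minus_commute)
    finally have "c \<le> cmod (cdot r x)" by (simp add: c_def)
    then show "\<exists>x\<in>inv_fov_map A \<xi>. \<exists>r. norm r = 1 \<and> reducing A z r \<and> c \<le> cmod (cdot r x)"
      using x r by (auto simp: inv_fov_map_iff)
  qed
qed

lemma nonlsc_unique_support:
  assumes int: "interior (numerical_range A) \<noteq> {}" and y: "y \<in> inv_fov_map A z" "\<not> lsc_at A z y"
    and w: "norm w = 1" "supports w (numerical_range A) z" "norm w' = 1" "supports w' (numerical_range A) z"
  shows "w = w'"
  using corner_lsc[OF _ y(1)] reducing_two_supports[OF int w] y(2) by blast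

lemma nonlsc_extreme:
  assumes int: "interior (numerical_range A) \<noteq> {}" and y: "y \<in> inv_fov_map A z" "\<not> lsc_at A z y"
  shows "z extreme_point_of numerical_range A"
  using conical_nonextreme[OF convex_numerical_range int] conical_lsc[OF _ y(1)] y
  by (auto simp: numerical_range_iff)

text \<open>On the eigenspace of \<open>w\<close> the Rayleigh quotient in direction
  \<open>T\<close> is least at \<open>x\<close> and greatest at \<open>e\<close>, so both are
  eigenvectors of the compression, with different eigenvalues, hence orthogonal. The cross terms
  vanish in directions \<open>w\<close> and \<open>\<i> * w\<close>, so in every direction.\<close>

lemma edge_orthogonal:
  assumes w: "norm w = 1" "supports w (numerical_range A) z" "supports w (numerical_range A) b"
    and T: "T = \<i> * w \<or> T = - (\<i> * w)"
    and min: "\<And>\<zeta>. supports w (numerical_range A) \<zeta> \<Longrightarrow> T \<bullet> z \<le> T \<bullet> \<zeta> \<and> T \<bullet> \<zeta> \<le> T \<bullet> b"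
    and lt: "T \<bullet> z < T \<bullet> b"
    and x: "x \<in> inv_fov_map A z" and e: "e \<in> inv_fov_map A b"
  shows "cdot e x = 0" "cdot e (herm A \<alpha> *v x) = 0"
proof -
  have V: "x \<in> eig A w" "e \<in> eig A w" using eig_iff_supports x e w by auto
  have val: "T \<bullet> z * (norm u)\<^sup>2 \<le> T \<bullet> fov_map A u \<and> T \<bullet> fov_map A u \<le> T \<bullet> b * (norm u)\<^sup>2" if u: "u \<in> eig A w" for u
  proof (cases "u = 0")
    case False
    define u' where "u' = complex_of_real (1 / norm u) *s u"
    have "supports w (numerical_range A) (fov_map A u')"
      using False u by (intro eig_unit_supports) (auto simp: u'_def eig_scale norm_scale norm_divide)
    moreover have "fov_map A u = fov_map A u' * complex_of_real ((norm u)\<^sup>2)"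
      using False by (simp add: u'_def fov_map_scale norm_divide power_divide)
    ultimately show ?thesis using min[of "fov_map A u'"]
      by (auto simp: inner_times_of_real mult.commute[of "(norm u)\<^sup>2"] simp del: of_real_power intro: mult_right_mono)
  qed simp
  have "(- T) \<bullet> fov_map A x = (- (T \<bullet> z)) * (norm x)\<^sup>2" using x by (simp add: inv_fov_map_iff)
  then have "cdot e (herm A (- T) *v x) = complex_of_real (- (T \<bullet> z)) * cdot e x"
    by (intro psd_herm[of "eig A w"]) (use val V in \<open>auto simp: eig_add eig_scale\<close>)
  then have 1: "cdot e (herm A T *v x) = complex_of_real (T \<bullet> z) * cdot e x"
    using herm_scaleR[of A "-1" T x] by (simp add: cdot_algebra)
  have "cdot x (herm A T *v e) = complex_of_real (T \<bullet> b) * cdot x e"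
    using e by (intro psd_herm[of "eig A w"]) (auto simp: eig_add eig_scale val V inv_fov_map_iff)
  then have "cnj (cdot x (herm A T *v e)) = complex_of_real (T \<bullet> b) * cdot e x" by (simp add: cnj_cdot)
  then have "complex_of_real (T \<bullet> b) * cdot e x = complex_of_real (T \<bullet> z) * cdot e x"
    using 1 by (auto simp: cnj_cdot_herm)
  then show ex: "cdot e x = 0" using lt by simp
  have 2: "cdot e (herm A w *v x) = 0" using V(1) ex by (simp add: eig_def cdot_scale_right)
  have 3: "cdot e (herm A (\<i> * w) *v x) = 0"
    using 1 ex T herm_scaleR[of A "-1" "\<i> * w" x] by (auto simp: cdot_algebra)
  have "\<alpha> = (w \<bullet> \<alpha>) *\<^sub>R w + ((\<i> * w) \<bullet> \<alpha>) *\<^sub>R (\<i> * w)"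
  proof -
    have "(Re w)\<^sup>2 + (Im w)\<^sup>2 = 1" using w(1) by (simp add: cmod_def)
    then show ?thesis by (simp add: complex_eq_iff inner_complex_def) algebra
  qed
  then have "herm A \<alpha> *v x = (w \<bullet> \<alpha>) *\<^sub>R (herm A w *v x) + ((\<i> * w) \<bullet> \<alpha>) *\<^sub>R (herm A (\<i> * w) *v x)"
    using herm_linear by metis
  then show "cdot e (herm A \<alpha> *v x) = 0" by (simp add: cdot_algebra 2 3)
qed

section \<open>Polynomial families of vectors\<close>

definition polyvec :: "(real \<Rightarrow> 'a::euclidean_space) \<Rightarrow> bool" where
  "polyvec f \<longleftrightarrow> (\<forall>b. \<exists>P. \<forall>t. f t \<bullet> b = poly P t)"

lemma polyvec_const: "polyvec (\<lambda>t. c)"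
  unfolding polyvec_def
proof
  fix b
  show "\<exists>P. \<forall>t. c \<bullet> b = poly P t" by (intro exI[of _ "[:c \<bullet> b:]"]) simp
qed

lemma polyvec_add: "polyvec f \<Longrightarrow> polyvec g \<Longrightarrow> polyvec (\<lambda>t. f t + g t)"
  unfolding polyvec_def
proof
  fix b assume "\<forall>b. \<exists>P. \<forall>t. f t \<bullet> b = poly P t" "\<forall>b. \<exists>P. \<forall>t. g t \<bullet> b = poly P t"
  then obtain P Q where "\<forall>t. f t \<bullet> b = poly P t" "\<forall>t. g t \<bullet> b = poly Q t" by meson
  then show "\<exists>P. \<forall>t. (f t + g t) \<bullet> b = poly P t"
    by (intro exI[of _ "P + Q"]) (simp add: inner_add_left)
qed

lemma polyvec_scale: "polyvec f \<Longrightarrow> (\<And>t. s t = poly S t) \<Longrightarrow> polyvec (\<lambda>t. s t *\<^sub>R f t)"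
  unfolding polyvec_def
proof
  fix b assume "\<forall>b. \<exists>P. \<forall>t. f t \<bullet> b = poly P t" and s: "\<And>t. s t = poly S t"
  then obtain P where "\<forall>t. f t \<bullet> b = poly P t" by meson
  then show "\<exists>P. \<forall>t. (s t *\<^sub>R f t) \<bullet> b = poly P t"
    by (intro exI[of _ "S * P"]) (simp add: s)
qed

lemma polyvec_linear: "polyvec f \<Longrightarrow> linear L \<Longrightarrow> polyvec (\<lambda>t. L (f t))"
  unfolding polyvec_def
proof
  fix b assume "\<forall>b. \<exists>P. \<forall>t. f t \<bullet> b = poly P t" and L: "linear L"
  then obtain P where "\<forall>t. f t \<bullet> adjoint L b = poly P t" by meson
  then show "\<exists>P. \<forall>t. L (f t) \<bullet> b = poly P t"
    by (intro exI[of _ P]) (simp add: adjoint_clauses(2)[OF L, symmetric] adjoint_works[OF L])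
qed

lemma polyvec_vec:
  fixes f :: "real \<Rightarrow> 'n::finite \<Rightarrow> 'a::euclidean_space"
  assumes "\<And>j. polyvec (\<lambda>t. f t j)"
  shows "polyvec (\<lambda>t. (\<chi> j. f t j) :: 'a ^ 'n)"
  unfolding polyvec_def
proof
  fix b :: "'a ^ 'n"
  have "\<forall>j. \<exists>P. \<forall>t. f t j \<bullet> (b $ j) = poly P t" using assms unfolding polyvec_def by blast
  then obtain P where P: "\<And>j t. f t j \<bullet> (b $ j) = poly (P j) t" by metis
  show "\<exists>P. \<forall>t. (\<chi> j. f t j) \<bullet> b = poly P t"
    by (intro exI[of _ "\<Sum>j\<in>UNIV. P j"]) (simp add: inner_vec_def P poly_sum)
qed

text \<open>Independence of an indexed family, so that repeated vectors count as dependent.\<close>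

definition lin_indep :: "nat \<Rightarrow> (nat \<Rightarrow> 'a::real_vector) \<Rightarrow> bool" where
  "lin_indep d x \<longleftrightarrow> (\<forall>c. (\<Sum>i<d. c i *\<^sub>R x i) = 0 \<longrightarrow> (\<forall>i<d. c i = (0::real)))"

text \<open>Gaussian elimination of the last vector.\<close>

lemma finite_dependent_parameters:
  fixes x :: "nat \<Rightarrow> real \<Rightarrow> 'a::euclidean_space"
  assumes "\<And>i. i < d \<Longrightarrow> polyvec (x i)" "lin_indep d (\<lambda>i. x i t0)"
  shows "finite {t. \<not> lin_indep d (\<lambda>i. x i t)}"
  using assms
proof (induction d arbitrary: x)
  case 0
  then show ?case by (simp add: lin_indep_def)
next
  case (Suc d)
  \<comment> \<open>Pairing with the last vector at \<open>t0\<close> gives a polynomial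
    \<open>P\<close> that is nonzero at \<open>t0\<close>: a pivot that fails only for finitely many
    parameters.\<close>
  define b where "b = x d t0"
  have "b \<noteq> 0"
  proof
    assume "b = 0"
    then have "(\<Sum>i<Suc d. (if i = d then 1 else 0) *\<^sub>R x i t0) = 0" by (simp add: b_def)
    then show False
      using Suc.prems(2)[unfolded lin_indep_def, rule_format, of "\<lambda>i. if i = d then 1 else 0" d] by simp
  qed
  obtain P where P: "\<And>t. x d t \<bullet> b = poly P t" using Suc.prems(1)[of d] by (auto simp: polyvec_def)
  have "poly P t0 = b \<bullet> b" using P[of t0] unfolding b_def by (rule sym)
  moreover have "b \<bullet> b \<noteq> 0" using \<open>b \<noteq> 0\<close> by simp
  ultimately have "poly P t0 \<noteq> 0" by argo
  then have "P \<noteq> 0" by auto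
  then have fin: "finite {t. poly P t = 0}" by (rule poly_roots_finite)
  \<comment> \<open>Elimination without division: \<open>y i t\<close> is orthogonal to
    \<open>b\<close> and stays polynomial in \<open>t\<close>.\<close>
  define y where "y i t = poly P t *\<^sub>R x i t + (- (x i t \<bullet> b)) *\<^sub>R x d t" for i t
  have y: "polyvec (y i)" if i: "i < d" for i
  proof -
    obtain Q where Q: "\<And>t. x i t \<bullet> b = poly Q t" using Suc.prems(1)[of i] i by (auto simp: polyvec_def)
    show ?thesis unfolding y_def
      by (intro polyvec_add polyvec_scale[where S = P] polyvec_scale[where S = "- Q"] Suc.prems) (use i Q in auto)
  qed
  have ysum: "(\<Sum>i<k. c i *\<^sub>R y i t) = poly P t *\<^sub>R (\<Sum>i<k. c i *\<^sub>R x i t) - ((\<Sum>i<k. c i *\<^sub>R x i t) \<bullet> b) *\<^sub>R x d t" for c t k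
    by (induction k) (simp_all add: y_def inner_add_left algebra_simps)
  have "lin_indep d (\<lambda>i. y i t0)"
    unfolding lin_indep_def
  proof (intro allI impI)
    fix c :: "nat \<Rightarrow> real" and i assume c: "(\<Sum>i<d. c i *\<^sub>R y i t0) = 0" and i: "i < d"
    \<comment> \<open>These coefficients rewrite a relation among the \<open>y i t0\<close> as one
      among the original vectors, the last included.\<close>
    define c' where "c' j = (if j = d then - ((\<Sum>i<d. c i *\<^sub>R x i t0) \<bullet> b) else poly P t0 * c j)" for j
    have "(\<Sum>j<d. c' j *\<^sub>R x j t0) = poly P t0 *\<^sub>R (\<Sum>i<d. c i *\<^sub>R x i t0)"
      by (simp add: c'_def scaleR_sum_right)
    then have "(\<Sum>j<Suc d. c' j *\<^sub>R x j t0) = 0"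
      using c unfolding ysum by (simp add: c'_def)
    then have "c' i = 0"
      using Suc.prems(2)[unfolded lin_indep_def, rule_format, of c' i] i by simp
    then show "c i = 0" using i \<open>poly P t0 \<noteq> 0\<close> by (simp add: c'_def)
  qed
  then have fin2: "finite {t. \<not> lin_indep d (\<lambda>i. y i t)}" by (intro Suc.IH y)
  have "{t. \<not> lin_indep (Suc d) (\<lambda>i. x i t)} \<subseteq> {t. poly P t = 0} \<union> {t. \<not> lin_indep d (\<lambda>i. y i t)}"
  proof (intro subsetI, rule ccontr)
    fix t assume t: "t \<in> {t. \<not> lin_indep (Suc d) (\<lambda>i. x i t)}" "t \<notin> {t. poly P t = 0} \<union> {t. \<not> lin_indep d (\<lambda>i. y i t)}"
    then have Pt: "poly P t \<noteq> 0" and ind: "lin_indep d (\<lambda>i. y i t)" by auto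
    have "lin_indep (Suc d) (\<lambda>i. x i t)"
      unfolding lin_indep_def
    proof (intro allI impI)
      fix c :: "nat \<Rightarrow> real" and i assume c: "(\<Sum>i<Suc d. c i *\<^sub>R x i t) = 0" and i: "i < Suc d"
      define s where "s = (\<Sum>i<d. c i *\<^sub>R x i t)"
      have s: "s = - c d *\<^sub>R x d t" using c by (simp add: s_def add_eq_0_iff2)
      have "(\<Sum>i<d. c i *\<^sub>R y i t) = 0"
        unfolding ysum s_def[symmetric] s by (simp add: P)
      then have z: "\<forall>i<d. c i = 0" using ind unfolding lin_indep_def by blast
      then have "s = 0" by (simp add: s_def)
      then have "c d = 0" using s P[of t] Pt by auto
      then show "c i = 0" using z i by (auto simp: less_Suc_eq)
    qed
    then show False using t(1) by simp
  qed
  then show ?case using fin fin2 finite_subset by blast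
qed

lemma dependent_coefficients:
  fixes x :: "nat \<Rightarrow> 'a::euclidean_space"
  assumes "DIM('a) < d"
  shows "\<not> lin_indep d x"
proof (cases "inj_on x {..<d}")
  case True
  have "dependent (x ` {..<d})"
    by (rule dependent_biggerset) (use True assms card_image[OF True] in auto)
  then obtain u where u: "\<exists>v\<in>x ` {..<d}. u v \<noteq> 0" "(\<Sum>v\<in>x ` {..<d}. u v *\<^sub>R v) = 0"
    by (subst (asm) dependent_finite) auto
  have "(\<Sum>i<d. u (x i) *\<^sub>R x i) = 0" using u(2) sum.reindex[OF True, of "\<lambda>v. u v *\<^sub>R v"] by simp
  moreover obtain i where "i < d" "u (x i) \<noteq> 0" using u(1) by auto
  ultimately show ?thesis unfolding lin_indep_def by (auto intro!: exI[of _ "\<lambda>i. u (x i)"])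
next
  case False
  then obtain i j where ij: "i < d" "j < d" "i \<noteq> j" "x i = x j" by (auto simp: inj_on_def)
  define c :: "nat \<Rightarrow> real" where "c k = (if k = i then 1 else if k = j then -1 else 0)" for k
  have "(\<Sum>k<d. c k *\<^sub>R x k) = (\<Sum>k\<in>{i, j}. c k *\<^sub>R x k)"
    by (rule sum.mono_neutral_right) (use ij in \<open>auto simp: c_def\<close>)
  also have "\<dots> = 0" using ij by (simp add: c_def)
  finally show ?thesis using ij unfolding lin_indep_def by (metis c_def zero_neq_one)
qed

lemma bounded_coefficients_subsequence:
  fixes a :: "nat \<Rightarrow> nat \<Rightarrow> real"
  assumes "\<And>k i. i < d \<Longrightarrow> \<bar>a k i\<bar> \<le> 1"
  obtains f a' where "strict_mono f" "\<And>i. i < d \<Longrightarrow> (\<lambda>k. a (f k) i) \<longlonglongrightarrow> a' i"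
proof -
  have "\<exists>f a'. strict_mono f \<and> (\<forall>i<d. (\<lambda>k. a (f k) i) \<longlonglongrightarrow> a' i)"
    using assms
  proof (induction d)
    case 0
    then show ?case by (intro exI[of _ id]) (simp add: strict_mono_def)
  next
    case (Suc d)
    then obtain f a' where f: "strict_mono f" "\<And>i. i < d \<Longrightarrow> (\<lambda>k. a (f k) i) \<longlonglongrightarrow> a' i" by auto
    have "\<forall>k. a (f k) d \<in> {-1..1}" using Suc.prems[of d] by (simp add: abs_le_iff minus_le_iff)
    then obtain l g where g: "strict_mono g" "((\<lambda>k. a (f k) d) \<circ> g) \<longlonglongrightarrow> l"
      using compact_Icc[of "-1::real" 1] unfolding compact_def by metis
    have "(\<lambda>k. a ((f \<circ> g) k) i) \<longlonglongrightarrow> (a'(d := l)) i" if "i < Suc d" for i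
    proof (cases "i = d")
      case True
      then show ?thesis using g(2) by (simp add: o_def)
    next
      case False
      then have "(\<lambda>k. a (f k) i) \<longlonglongrightarrow> a' i" using f(2) that by simp
      from LIMSEQ_subseq_LIMSEQ[OF this g(1)] show ?thesis using False by (simp add: o_def)
    qed
    then show ?case using f(1) g(1) strict_mono_o by blast
  qed
  then show ?thesis using that by blast
qed

section \<open>Polynomials of a matrix\<close>

abbreviation vpow :: "complex ^ 'n ^ 'n \<Rightarrow> nat \<Rightarrow> complex ^ 'n \<Rightarrow> complex ^ 'n" where
  "vpow M i \<equiv> ((*v) M) ^^ i"

text \<open>The vector \<open>p(M) x\<close>. The coefficients are real, as are the top eigenvalues
  to be divided out.\<close>

definition pmv :: "real poly \<Rightarrow> complex ^ 'n ^ 'n \<Rightarrow> complex ^ 'n \<Rightarrow> complex ^ 'n" where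
  "pmv p M x = (\<Sum>i\<le>degree p. coeff p i *\<^sub>R vpow M i x)"

lemma pmv_bound: "degree p < d \<Longrightarrow> pmv p M x = (\<Sum>i<d. coeff p i *\<^sub>R vpow M i x)"
  unfolding pmv_def by (rule sum.mono_neutral_left) (auto simp: coeff_eq_0)

lemma matrix_mult_scaleR: "(M :: complex ^ 'n ^ 'm) *v (r *\<^sub>R x) = r *\<^sub>R (M *v x)"
  by (simp add: scaleR_eq_scale vector_scalar_commute)

lemma matrix_mult_sum: "(M :: complex ^ 'n ^ 'm) *v (\<Sum>i\<in>I. f i) = (\<Sum>i\<in>I. M *v f i)"
  by (induction I rule: infinite_finite_induct) (simp_all add: matrix_vector_right_distrib)

lemma pmv_mult_linear: "pmv ([:- c, 1:] * q) M x = M *v pmv q M x - c *\<^sub>R pmv q M x"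
proof -
  define d where "d = Suc (degree q)"
  have dq: "degree q < d" by (simp add: d_def)
  have "degree ([:- c, 1:] * q) \<le> degree [:- c, 1:] + degree q" by (rule degree_mult_le)
  then have "degree ([:- c, 1:] * q) < Suc d" by (simp add: d_def)
  then have "pmv ([:- c, 1:] * q) M x = (\<Sum>i<Suc d. coeff ([:- c, 1:] * q) i *\<^sub>R vpow M i x)" by (rule pmv_bound)
  also have "\<dots> = (\<Sum>i<Suc d. coeff (pCons 0 q) i *\<^sub>R vpow M i x) - c *\<^sub>R (\<Sum>i<Suc d. coeff q i *\<^sub>R vpow M i x)"
    by (simp add: scaleR_sum_right sum_subtractf[symmetric] scaleR_diff_left del: sum.lessThan_Suc)
  also have "(\<Sum>i<Suc d. coeff (pCons 0 q) i *\<^sub>R vpow M i x) = M *v (\<Sum>i<d. coeff q i *\<^sub>R vpow M i x)"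
    by (subst sum.lessThan_Suc_shift) (simp add: matrix_mult_sum matrix_mult_scaleR)
  also have "(\<Sum>i<d. coeff q i *\<^sub>R vpow M i x) = pmv q M x" using pmv_bound[OF dq] by metis
  also have "(\<Sum>i<Suc d. coeff q i *\<^sub>R vpow M i x) = pmv q M x"
    using pmv_bound[of q "Suc d" M x] dq by simp
  finally show ?thesis .
qed

lemma pmv_eigenvector:
  assumes "M *v x = c *\<^sub>R x"
  shows "pmv p M x = poly p c *\<^sub>R x"
proof -
  have "vpow M i x = (c ^ i) *\<^sub>R x" for i
    by (induction i) (simp_all add: assms matrix_mult_scaleR)
  then show ?thesis by (simp add: pmv_def poly_altdef scaleR_sum_left)
qed

lemma vpow_add: "vpow M i (x + y) = vpow M i x + vpow M i y"
  by (induction i) (simp_all add: matrix_vector_right_distrib)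

lemma vpow_scale: "vpow M i (c *s x) = c *s vpow M i x"
  by (induction i) (simp_all add: vector_scalar_commute)

lemma pmv_zero_axis:
  assumes "\<And>j. pmv p M (axis j 1) = 0"
  shows "pmv p M x = 0"
proof -
  have add: "pmv p M (u + v) = pmv p M u + pmv p M v" for u v
    by (simp add: pmv_def vpow_add scaleR_add_right sum.distrib)
  have sc: "pmv p M (c *s u) = c *s pmv p M u" for c u
    by (simp add: pmv_def vpow_scale vec_eq_iff sum_distrib_left)
  have "pmv p M 0 = 0" using sc[of 0 0] by simp
  then have "pmv p M (\<Sum>j\<in>J. x $ j *s axis j 1) = 0" for J
    by (induction J rule: infinite_finite_induct) (simp_all add: add sc assms)
  then show ?thesis using basis_expansion[of x] by metis
qed

text \<open>The \<open>i\<close>-th power of \<open>M\<close> as a tuple of columns, an element of a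
  Euclidean space; real relations among these vectors are real polynomials annihilating
  \<open>M\<close>.\<close>

definition power_cols :: "complex ^ 'n ^ 'n \<Rightarrow> nat \<Rightarrow> (complex ^ 'n) ^ 'n" where
  "power_cols M i = (\<chi> j. vpow M i (axis j 1))"

lemma power_cols_indep:
  assumes "lin_indep d (power_cols M)" "degree p < d" "\<And>x. pmv p M x = 0"
  shows "p = 0"
proof -
  have "(\<Sum>i<d. coeff p i *\<^sub>R power_cols M i) = 0"
    using assms(3) unfolding pmv_bound[OF assms(2)] by (simp add: vec_eq_iff power_cols_def)
  then have "\<forall>i<d. coeff p i = 0" using assms(1) unfolding lin_indep_def by blast
  then show ?thesis using assms(2) by (metis leading_coeff_0_iff)
qed

lemma power_cols_dep:
  assumes "\<not> lin_indep d (power_cols M)"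
  obtains p where "p \<noteq> 0" "degree p < d" "\<And>x. pmv p M x = 0"
proof -
  obtain c i where c: "(\<Sum>i<d. c i *\<^sub>R power_cols M i) = 0" "i < d" "c i \<noteq> 0"
    using assms unfolding lin_indep_def by blast
  define p where "p = (\<Sum>i<d. monom (c i) i)"
  have co: "coeff p j = (if j < d then c j else 0)" for j
    unfolding p_def by (simp add: coeff_sum if_distrib cong: if_cong)
  have d: "degree p < d" using c(2) by (intro degree_lessI) (auto simp: co)
  have "pmv p M (axis j 1) = 0" for j
    using c(1) unfolding pmv_bound[OF d] by (simp add: vec_eq_iff power_cols_def co)
  then show ?thesis using that d c pmv_zero_axis by (metis co coeff_0)
qed

section \<open>Regular directions\<close>

text \<open>A regular direction: no top eigenvector is lost under small changes of \<open>w\<close>,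
  as happens where the top eigenvalue splits.\<close>

definition eig_lsc :: "complex ^ 'n ^ 'n \<Rightarrow> complex \<Rightarrow> bool" where
  "eig_lsc A w \<longleftrightarrow> (\<forall>x\<in>eig A w. \<forall>e>0. \<exists>d>0. \<forall>w'. dist w' w < d \<longrightarrow> (\<exists>x'\<in>eig A w'. dist x' x < e))"

lemma lam_lipschitz:
  "\<exists>C\<ge>0. \<forall>w w'. \<bar>lam A w - lam A w'\<bar> \<le> C * norm (w - w')"
proof -
  obtain C where C: "\<And>x. x \<in> numerical_range A \<Longrightarrow> norm x \<le> C"
    using compact_imp_bounded[OF compact_numerical_range[of A]] unfolding bounded_iff by auto
  have C0: "C \<ge> 0" using C numerical_range_nonempty[of A] norm_ge_zero order_trans by blast
  have *: "lam A w - lam A w' \<le> C * norm (w - w')" for w w'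
  proof -
    obtain z where z: "z \<in> numerical_range A" "w \<bullet> z = lam A w" by (rule lam_attained)
    have "lam A w - lam A w' \<le> (w - w') \<bullet> z" using lam_upper[OF z(1), of w'] z(2) by (simp add: inner_diff_left)
    also have "\<dots> \<le> norm (w - w') * norm z" by (rule norm_cauchy_schwarz)
    also have "\<dots> \<le> norm (w - w') * C" using C[OF z(1)] by (simp add: mult_left_mono)
    finally show ?thesis by (simp add: mult.commute)
  qed
  show ?thesis
  proof (intro exI[of _ C] conjI C0 allI)
    show "\<bar>lam A w - lam A w'\<bar> \<le> C * norm (w - w')" for w w'
      using *[of w w'] *[of w' w] by (simp add: abs_le_iff norm_minus_commute)
  qed
qed

lemma tendsto_lam: "(w \<longlongrightarrow> l) G \<Longrightarrow> ((\<lambda>k. lam A (w k)) \<longlongrightarrow> lam A l) G"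
proof -
  assume w: "(w \<longlongrightarrow> l) G"
  from lam_lipschitz[of A] obtain C where C: "\<forall>w w'. \<bar>lam A w - lam A w'\<bar> \<le> C * norm (w - w')"
    by (rule exE) (erule conjE)
  have le: "norm (lam A (w k) - lam A l) \<le> C * norm (w k - l)" for k
    using C[THEN spec, of "w k", THEN spec, of l] unfolding real_norm_def .
  have "((\<lambda>k. C * norm (w k - l)) \<longlongrightarrow> C * norm (l - l)) G" by (intro tendsto_intros w)
  then have lim: "((\<lambda>k. C * norm (w k - l)) \<longlongrightarrow> 0) G" by simp
  have "((\<lambda>k. lam A (w k) - lam A l) \<longlongrightarrow> 0) G"
    by (rule Lim_null_comparison[OF always_eventually[rule_format, OF le] lim])
  then show ?thesis by (rule LIM_zero_cancel)
qed

lemma tendsto_herm: "(w \<longlongrightarrow> l) G \<Longrightarrow> (x \<longlongrightarrow> y) G \<Longrightarrow> ((\<lambda>k. herm A (w k) *v x k) \<longlongrightarrow> herm A l *v y) G"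
proof -
  assume *: "(w \<longlongrightarrow> l) G" "(x \<longlongrightarrow> y) G"
  have "((\<lambda>k. Re (w k) *\<^sub>R (herm A 1 *v x k) + Im (w k) *\<^sub>R (herm A \<i> *v x k))
      \<longlongrightarrow> Re l *\<^sub>R (herm A 1 *v y) + Im l *\<^sub>R (herm A \<i> *v y)) G"
    by (intro tendsto_intros tendsto_matrix *)
  then show ?thesis by (simp only: herm_decomp[symmetric])
qed

lemma eig_closed_sequence:
  assumes "w \<longlonglongrightarrow> l" "x \<longlonglongrightarrow> y" "\<And>k. x k \<in> eig A (w k)"
  shows "y \<in> eig A l"
proof -
  have "(\<lambda>k. herm A (w k) *v x k) \<longlonglongrightarrow> herm A l *v y" by (intro tendsto_herm assms)
  moreover have "(\<lambda>k. lam A (w k) *\<^sub>R x k) \<longlonglongrightarrow> lam A l *\<^sub>R y" by (intro tendsto_intros tendsto_lam assms)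
  moreover have "(\<lambda>k. herm A (w k) *v x k) = (\<lambda>k. lam A (w k) *\<^sub>R x k)"
    using assms(3) by (auto simp: eig_def scaleR_eq_scale)
  ultimately have "herm A l *v y = lam A l *\<^sub>R y" by (metis LIMSEQ_unique)
  then show ?thesis by (simp add: eig_def scaleR_eq_scale)
qed

lemma eig_lscI_sequence:
  assumes "\<And>x e \<omega>. x \<in> eig A w \<Longrightarrow> e > 0 \<Longrightarrow> \<omega> \<longlonglongrightarrow> w \<Longrightarrow> \<exists>k. \<exists>x'\<in>eig A (\<omega> k). dist x' x < e"
  shows "eig_lsc A w"
  unfolding eig_lsc_def
proof (intro ballI allI impI)
  fix x and e :: real assume x: "x \<in> eig A w" and e: "e > 0"
  define Q where "Q w' \<longleftrightarrow> (\<exists>x'\<in>eig A w'. dist x' x < e)" for w'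
  have "\<exists>d>0. \<forall>w'. dist w' w < d \<longrightarrow> Q w'"
  proof (rule ccontr)
    assume *: "\<not> ?thesis"
    have "\<exists>w'. dist w' w < inverse (real (Suc k)) \<and> \<not> Q w'" for k
    proof -
      have "inverse (real (Suc k)) > 0" by simp
      then show ?thesis using * by blast
    qed
    then obtain \<omega> where \<omega>: "\<And>k. dist (\<omega> k) w < inverse (real (Suc k))" "\<And>k. \<not> Q (\<omega> k)"
      by metis
    have "\<omega> \<longlonglongrightarrow> w"
      by (rule tendsto_dist_iff[THEN iffD2], rule tendsto_sandwich[OF _ _ tendsto_const LIMSEQ_inverse_real_of_nat])
         (use \<omega>(1) in \<open>auto intro!: always_eventually less_imp_le\<close>)
    from assms[OF x e this] \<omega>(2) show False unfolding Q_def by blast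
  qed
  then show "\<exists>d>0. \<forall>w'. dist w' w < d \<longrightarrow> (\<exists>x'\<in>eig A w'. dist x' x < e)"
    unfolding Q_def .
qed

lemma eig_lsc_homogeneous:
  assumes r: "0 < r" and l: "eig_lsc A w"
  shows "eig_lsc A (r *\<^sub>R w)"
  unfolding eig_lsc_def
proof (intro ballI allI impI)
  fix x e assume x: "x \<in> eig A (r *\<^sub>R w)" and e: "(e::real) > 0"
  obtain d where d: "d > 0" "\<And>w'. dist w' w < d \<Longrightarrow> \<exists>x'\<in>eig A w'. dist x' x < e"
    using l x e eig_homogeneous[OF r, of A w] unfolding eig_lsc_def by blast
  show "\<exists>d>0. \<forall>w'. dist w' (r *\<^sub>R w) < d \<longrightarrow> (\<exists>x'\<in>eig A w'. dist x' x < e)"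
  proof (intro exI[of _ "r * d"] conjI allI impI)
    show "r * d > 0" using r d(1) by simp
    fix w' assume w': "dist w' (r *\<^sub>R w) < r * d"
    have "w' - r *\<^sub>R w = r *\<^sub>R ((1 / r) *\<^sub>R w' - w)" using r by (simp add: scaleR_diff_right)
    then have "dist w' (r *\<^sub>R w) = r * dist ((1 / r) *\<^sub>R w') w" using r by (simp add: dist_norm)
    then have "dist ((1 / r) *\<^sub>R w') w < d" using w' r by simp
    from d(2)[OF this] show "\<exists>x'\<in>eig A w'. dist x' x < e" using eig_homogeneous[of "1 / r" A w'] r by simp
  qed
qed

text \<open>The affine chart \<open>t \<mapsto> c (1 + i t)\<close>, \<open>c = \<plusminus>1\<close>, of the circle of directions
  turns \<open>herm A\<close> into a linear pencil.\<close>

definition chart :: "real \<Rightarrow> real \<Rightarrow> complex" where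
  "chart c t = Complex c (c * t)"

lemma chart_herm: "herm A (chart c t) *v x = herm A (chart c 0) *v x + t *\<^sub>R (herm A (\<i> * chart c 0) *v x)"
proof -
  have "chart c t = 1 *\<^sub>R chart c 0 + t *\<^sub>R (\<i> * chart c 0)" by (simp add: chart_def complex_eq_iff)
  then show ?thesis using herm_linear[of A 1 "chart c 0" t "\<i> * chart c 0" x] by simp
qed

lemma tendsto_chart: "(f \<longlongrightarrow> t) G \<Longrightarrow> ((\<lambda>k. chart c (f k)) \<longlongrightarrow> chart c t) G"
  unfolding chart_def by (intro tendsto_Complex tendsto_intros)

lemma polyvec_power_cols: "polyvec (\<lambda>t. power_cols (herm A (chart c t)) i)"
proof -
  have "polyvec (\<lambda>t. vpow (herm A (chart c t)) i x)" for x
  proof (induction i)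
    case 0
    then show ?case by (simp add: polyvec_const)
  next
    case (Suc i)
    have lin: "linear ((*v) (herm A w))" for w by (rule bounded_linear.linear[OF bounded_linear_matrix])
    have "polyvec (\<lambda>t. herm A (chart c 0) *v vpow (herm A (chart c t)) i x + t *\<^sub>R (herm A (\<i> * chart c 0) *v vpow (herm A (chart c t)) i x))"
      by (intro polyvec_add polyvec_scale[where S = "[:0, 1:]"] polyvec_linear[OF Suc lin]) auto
    moreover have "(\<lambda>t. vpow (herm A (chart c t)) (Suc i) x) = (\<lambda>t. herm A (chart c 0) *v vpow (herm A (chart c t)) i x + t *\<^sub>R (herm A (\<i> * chart c 0) *v vpow (herm A (chart c t)) i x))"
      by (rule ext) (simp, rule chart_herm)
    ultimately show ?case by simp
  qed
  then show ?thesis unfolding power_cols_def by (intro polyvec_vec)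
qed

lemma tendsto_vpow_herm:
  "(w \<longlongrightarrow> l) G \<Longrightarrow> ((\<lambda>k. vpow (herm A (w k)) i x) \<longlongrightarrow> vpow (herm A l) i x) G"
  by (induction i) (auto intro: tendsto_herm)

text \<open>If \<open>1, M, \<dots>, M\<^sup>d\<^sup>-\<^sup>1\<close> are independent at the limit and \<open>d\<close> bounds the degree of the
  minimal polynomials along the sequence, then the cofactors \<open>q\<close> with \<open>(M - \<lambda>) q(M) = 0\<close>, normalised,
  converge to a cofactor at the limit, and \<open>q(M)\<close> there is a multiple of the spectral projection.\<close>

lemma eig_lsc_sequence:
  assumes ind: "lin_indep d (power_cols (herm A w))"
    and dep: "\<And>k. \<not> lin_indep (Suc d) (power_cols (herm A (\<omega> k)))"
    and lim: "\<omega> \<longlonglongrightarrow> w" and x: "x \<in> eig A w" and e: "e > 0"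
  shows "\<exists>k. \<exists>x'\<in>eig A (\<omega> k). dist x' x < e"
proof -
  let ?M = "\<lambda>k. herm A (\<omega> k)" and ?l = "\<lambda>k. lam A (\<omega> k)"
  have "\<exists>a. (\<Sum>i<d. \<bar>a i\<bar>) = 1 \<and> (\<forall>x. (\<Sum>i<d. a i *\<^sub>R vpow (?M k) i x) \<in> eig A (\<omega> k))" for k
  proof -
    obtain p where p: "p \<noteq> 0" "degree p < Suc d" "\<And>x. pmv p (?M k) x = 0" using power_cols_dep[OF dep] by blast
    obtain u where u: "u \<in> eig A (\<omega> k)" "norm u = 1" by (rule eig_unit_exists)
    have "pmv p (?M k) u = poly p (?l k) *\<^sub>R u"
      using u(1) by (intro pmv_eigenvector) (simp add: eig_def scaleR_eq_scale)
    then have "poly p (?l k) = 0" using p(3) u(2) by force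
    then obtain q where q: "p = [:- ?l k, 1:] * q" by (auto simp: poly_eq_0_iff_dvd dvd_def)
    have q0: "q \<noteq> 0" using p(1) q by auto
    then have "degree p = Suc (degree q)" unfolding q by (subst degree_mult_eq) auto
    then have dq: "degree q < d" using p(2) by simp
    have mem: "pmv q (?M k) x \<in> eig A (\<omega> k)" for x
      using p(3)[of x] unfolding q pmv_mult_linear by (simp add: eig_def scaleR_eq_scale)
    define S where "S = (\<Sum>i<d. \<bar>coeff q i\<bar>)"
    have "\<bar>coeff q (degree q)\<bar> \<le> S" unfolding S_def by (rule member_le_sum) (use dq in auto)
    then have S: "S > 0" using q0 by (metis abs_le_zero_iff leading_coeff_0_iff not_le order.strict_trans2 abs_not_less_zero linorder_neqE_linordered_idom)
    show ?thesis
    proof (intro exI[of _ "\<lambda>i. coeff q i / S"] conjI allI)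
      show "(\<Sum>i<d. \<bar>coeff q i / S\<bar>) = 1" using S by (simp add: abs_divide sum_divide_distrib[symmetric] S_def[symmetric])
      fix x
      have "(\<Sum>i<d. (coeff q i / S) *\<^sub>R vpow (?M k) i x) = (1 / S) *\<^sub>R pmv q (?M k) x"
        unfolding pmv_bound[OF dq] by (simp add: scaleR_sum_right)
      then show "(\<Sum>i<d. (coeff q i / S) *\<^sub>R vpow (?M k) i x) \<in> eig A (\<omega> k)" using mem eig_scaleR by metis
    qed
  qed
  then have "\<forall>k. \<exists>a. (\<Sum>i<d. \<bar>a i\<bar>) = 1 \<and> (\<forall>x. (\<Sum>i<d. a i *\<^sub>R vpow (?M k) i x) \<in> eig A (\<omega> k))" by blast
  from choice[OF this] obtain a where a: "\<And>k. (\<Sum>i<d. \<bar>a k i\<bar>) = 1" "\<And>k x. (\<Sum>i<d. a k i *\<^sub>R vpow (?M k) i x) \<in> eig A (\<omega> k)"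
    by blast
  have a1: "\<bar>a k i\<bar> \<le> 1" if "i < d" for k i
    unfolding a(1)[of k, symmetric] by (rule member_le_sum) (use that in auto)
  obtain f a' where f: "strict_mono f" "\<And>i. i < d \<Longrightarrow> (\<lambda>k. a (f k) i) \<longlonglongrightarrow> a' i"
    by (rule bounded_coefficients_subsequence[of d a]) (use a1 in auto)
  have lf: "(\<lambda>k. \<omega> (f k)) \<longlonglongrightarrow> w" using LIMSEQ_subseq_LIMSEQ[OF lim f(1)] by (simp add: o_def)
  have "(\<lambda>k. \<Sum>i<d. \<bar>a (f k) i\<bar>) \<longlonglongrightarrow> (\<Sum>i<d. \<bar>a' i\<bar>)" by (intro tendsto_sum tendsto_rabs f) auto
  then have sum1: "(\<Sum>i<d. \<bar>a' i\<bar>) = 1" using a(1) LIMSEQ_unique[OF _ tendsto_const] by simp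
  define q where "q = (\<Sum>i<d. monom (a' i) i)"
  have co: "coeff q j = (if j < d then a' j else 0)" for j
    unfolding q_def by (simp add: coeff_sum if_distrib cong: if_cong)
  have d0: "d > 0" using sum1 by (cases d) auto
  have dq: "degree q < d" using d0 by (intro degree_lessI) (auto simp: co)
  have q0: "q \<noteq> 0"
  proof
    assume "q = 0"
    then have "a' i = 0" if "i < d" for i using co[of i] that by simp
    then show False using sum1 by simp
  qed
  let ?N = "herm A w" and ?r = "lam A w"
  have conv: "(\<lambda>k. \<Sum>i<d. a (f k) i *\<^sub>R vpow (?M (f k)) i u) \<longlonglongrightarrow> pmv q ?N u" for u
    unfolding pmv_bound[OF dq] by (intro tendsto_sum tendsto_scaleR tendsto_vpow_herm lf) (use f co in auto)
  have mem: "pmv q ?N u \<in> eig A w" for u by (rule eig_closed_sequence[OF lf conv]) (use a in auto)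
  \<comment> \<open>If \<open>lam A w\<close> were a root of \<open>q\<close>, the vectors
    \<open>q(M) u\<close> would lie in both the kernel and the range of the Hermitian matrix
    \<open>M - lam\<close>, which are orthogonal; then \<open>q(M) = 0\<close>, against
    independence.\<close>
  have "poly q ?r \<noteq> 0"
  proof
    assume "poly q ?r = 0"
    then obtain s where s: "q = [:- ?r, 1:] * s" by (auto simp: poly_eq_0_iff_dvd dvd_def)
    have "pmv q ?N u = 0" for u
    proof -
      define y where "y = pmv s ?N u"
      have y: "pmv q ?N u = ?N *v y - ?r *\<^sub>R y" unfolding s y_def by (rule pmv_mult_linear)
      have "cdot (pmv q ?N u) (pmv q ?N u) = cdot y (?N *v pmv q ?N u - ?r *\<^sub>R pmv q ?N u)"
        unfolding y by (simp add: cdot_algebra cdot_herm_left matrix_vector_mult_diff_distrib matrix_mult_scaleR)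
      also have "\<dots> = 0" using mem[of u] by (simp add: eig_def scaleR_eq_scale)
      finally show ?thesis by (simp add: cdot_self)
    qed
    then show False using power_cols_indep[OF ind dq] q0 by blast
  qed
  have "(\<lambda>k. (1 / poly q ?r) *\<^sub>R (\<Sum>i<d. a (f k) i *\<^sub>R vpow (?M (f k)) i x)) \<longlonglongrightarrow> (1 / poly q ?r) *\<^sub>R pmv q ?N x"
    by (intro tendsto_intros conv)
  also have "(1 / poly q ?r) *\<^sub>R pmv q ?N x = x"
    using x \<open>poly q ?r \<noteq> 0\<close> pmv_eigenvector[of ?N x ?r q] by (simp add: eig_def scaleR_eq_scale)
  finally have "\<forall>\<^sub>F k in sequentially. dist ((1 / poly q ?r) *\<^sub>R (\<Sum>i<d. a (f k) i *\<^sub>R vpow (?M (f k)) i x)) x < e"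
    using e by (rule tendstoD)
  then obtain k where "dist ((1 / poly q ?r) *\<^sub>R (\<Sum>i<d. a (f k) i *\<^sub>R vpow (?M (f k)) i x)) x < e"
    using eventually_happens'[OF sequentially_bot] by blast
  then show ?thesis using a(2) eig_scaleR by blast
qed

text \<open>Let \<open>d\<close> be the largest number of independent powers attained at any
  parameter. Independence of \<open>d\<close> powers fails only for finitely many parameters, while
  \<open>d + 1\<close> powers are always dependent, so \<open>eig_lsc_sequence\<close> applies at
  all the others.\<close>

lemma finite_irregular_chart:
  fixes A :: "complex ^ 'n ^ 'n"
  assumes c: "c \<noteq> 0"
  shows "finite {t. \<not> eig_lsc A (chart c t)}"
proof -
  define N where "N = DIM((complex ^ 'n) ^ 'n)"
  define P where "P d \<longleftrightarrow> (\<exists>t. lin_indep d (power_cols (herm A (chart c t))))" for d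
  have P0: "P 0" by (simp add: P_def lin_indep_def)
  have bd: "d \<le> N" if "P d" for d
  proof (rule ccontr)
    assume "\<not> d \<le> N"
    then have "\<not> lin_indep d (power_cols (herm A (chart c t)))" for t
      by (intro dependent_coefficients) (simp add: N_def)
    then show False using that by (simp add: P_def)
  qed
  define d where "d = Greatest P"
  have Pd: "P d" unfolding d_def by (rule GreatestI_nat[where P = P and k = 0 and b = N]) (use P0 bd in auto)
  have notP: "\<not> P (Suc d)" using Greatest_le_nat[of P "Suc d" N] bd unfolding d_def by auto
  obtain t0 where t0: "lin_indep d (power_cols (herm A (chart c t0)))" using Pd by (auto simp: P_def)
  have "finite {t. \<not> lin_indep d (power_cols (herm A (chart c t)))}"
    using finite_dependent_parameters[of d "\<lambda>i t. power_cols (herm A (chart c t)) i" t0, OF polyvec_power_cols] t0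
    by simp
  moreover have "eig_lsc A (chart c t)" if t: "lin_indep d (power_cols (herm A (chart c t)))" for t
  proof (rule eig_lscI_sequence)
    fix x and e :: real and \<omega> assume x: "x \<in> eig A (chart c t)" and e: "e > 0" and \<omega>: "\<omega> \<longlonglongrightarrow> chart c t"
    define \<tau> where "\<tau> k = Im (\<omega> k) / Re (\<omega> k)" for k
    have re: "(\<lambda>k. Re (\<omega> k) / c) \<longlonglongrightarrow> Re (chart c t) / c" by (intro tendsto_intros \<omega>) (use c in auto)
    have "\<tau> \<longlonglongrightarrow> Im (chart c t) / Re (chart c t)"
      unfolding \<tau>_def by (intro tendsto_intros \<omega>) (use c in \<open>simp add: chart_def\<close>)
    then have \<tau>: "\<tau> \<longlonglongrightarrow> t" using c by (simp add: chart_def)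
    have "\<forall>\<^sub>F k in sequentially. 0 < Re (\<omega> k) / c" using re c by (intro order_tendstoD) (auto simp: chart_def)
    then obtain K where K: "\<And>k. k \<ge> K \<Longrightarrow> 0 < Re (\<omega> k) / c" by (auto simp: eventually_sequentially)
    \<comment> \<open>Arbitrary nearby directions are rescaled into the chart. Beyond
      \<open>K\<close> the real part has the sign of \<open>c\<close>, so the factor is positive and
      the eigenspace unchanged.\<close>
    have \<omega>\<tau>: "eig A (\<omega> (k + K)) = eig A (chart c (\<tau> (k + K)))" for k
    proof -
      have "\<omega> (k + K) = (Re (\<omega> (k + K)) / c) *\<^sub>R chart c (\<tau> (k + K))"
        using K[of "k + K"] c by (auto simp: chart_def \<tau>_def complex_eq_iff)
      then show ?thesis using eig_homogeneous[OF K[of "k + K"]] by (metis le_add2)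
    qed
    have "\<exists>k. \<exists>x'\<in>eig A (chart c (\<tau> (k + K))). dist x' x < e"
    proof (rule eig_lsc_sequence[OF t _ _ x e])
      show "\<not> lin_indep (Suc d) (power_cols (herm A (chart c (\<tau> (k + K)))))" for k
        using notP by (auto simp: P_def)
      show "(\<lambda>k. chart c (\<tau> (k + K))) \<longlonglongrightarrow> chart c t"
        by (intro tendsto_chart LIMSEQ_ignore_initial_segment \<tau>)
    qed
    then show "\<exists>k. \<exists>x'\<in>eig A (\<omega> k). dist x' x < e" using \<omega>\<tau> by metis
  qed
  then have "{t. \<not> eig_lsc A (chart c t)} \<subseteq> {t. \<not> lin_indep d (power_cols (herm A (chart c t)))}" by blast
  ultimately show ?thesis by (rule rev_finite_subset)
qed

text \<open>The charts with \<open>c = 1\<close> and \<open>c = -1\<close> cover the directions with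
  nonzero real part; only the two imaginary units remain.\<close>

lemma finite_irregular: "finite {w. norm w = 1 \<and> \<not> eig_lsc A w}"
proof (rule finite_subset)
  define X where "X c = (\<lambda>t. (1 / norm (chart c t)) *\<^sub>R chart c t) ` {t. \<not> eig_lsc A (chart c t)}" for c
  show "{w. norm w = 1 \<and> \<not> eig_lsc A w} \<subseteq> {\<i>, - \<i>} \<union> X 1 \<union> X (-1)"
  proof
    fix w assume "w \<in> {w. norm w = 1 \<and> \<not> eig_lsc A w}"
    then have w: "norm w = 1" "\<not> eig_lsc A w" by auto
    show "w \<in> {\<i>, - \<i>} \<union> X 1 \<union> X (-1)"
    proof (rule ccontr)
      assume "w \<notin> {\<i>, - \<i>} \<union> X 1 \<union> X (-1)"
      then have w': "w \<notin> X 1" "w \<notin> X (-1)" "w \<noteq> \<i>" "w \<noteq> - \<i>" by auto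
      have re: "Re w \<noteq> 0"
      proof
        assume "Re w = 0"
        then have "\<bar>Im w\<bar> = 1" using w(1) by (simp add: cmod_def)
        then show False using w'(3,4) \<open>Re w = 0\<close> by (auto simp: complex_eq_iff abs_if split: if_splits)
      qed
      define c where "c = sgn (Re w)"
      define t where "t = Im w / Re w"
      have wc: "w = \<bar>Re w\<bar> *\<^sub>R chart c t"
        using re by (auto simp: chart_def c_def t_def complex_eq_iff sgn_if)
      have "\<not> eig_lsc A (chart c t)" using w(2) eig_lsc_homogeneous[of "\<bar>Re w\<bar>" A "chart c t"] re wc by auto
      moreover have "(1 / norm (chart c t)) *\<^sub>R chart c t = w"
      proof -
        have n: "\<bar>Re w\<bar> * norm (chart c t) = 1" using w(1) wc by (metis abs_abs norm_scaleR)
        then have "1 / norm (chart c t) = \<bar>Re w\<bar>" by (metis nonzero_eq_divide_eq mult_zero_right zero_neq_one)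
        then show ?thesis using wc by metis
      qed
      ultimately have "w \<in> X c" unfolding X_def by force
      then show False using w'(1,2) re by (auto simp: c_def sgn_if split: if_splits)
    qed
  qed
  show "finite ({\<i>, - \<i>} \<union> X 1 \<union> X (-1))" unfolding X_def using finite_irregular_chart[of 1 A] finite_irregular_chart[of "-1" A] by simp
qed

section \<open>Faces and fibres in regular directions\<close>

lemma eig_lsc_limit:
  assumes l: "eig_lsc A w" and x: "x \<in> eig A w" and \<omega>: "\<omega> \<longlonglongrightarrow> w"
  obtains u where "\<And>k. u k \<in> eig A (\<omega> k)" "u \<longlonglongrightarrow> x"
proof -
  define u where "u k = closest_point (eig A (\<omega> k)) x" for k
  have cl: "closed (eig A v)" "eig A v \<noteq> {}" for v
    using subspace_eig[of A v] by (auto simp: closed_subspace dest: subspace_0)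
  have u: "u k \<in> eig A (\<omega> k)" for k unfolding u_def by (rule closest_point_in_set[OF cl])
  have "u \<longlonglongrightarrow> x"
  proof (rule tendstoI)
    fix e :: real assume "e > 0"
    then obtain d where d: "d > 0" "\<And>w'. dist w' w < d \<Longrightarrow> \<exists>x'\<in>eig A w'. dist x' x < e"
      using l x unfolding eig_lsc_def by blast
    show "\<forall>\<^sub>F k in sequentially. dist (u k) x < e"
    proof (rule eventually_mono[OF tendstoD[OF \<omega> d(1)]])
      fix k assume "dist (\<omega> k) w < d"
      then obtain x' where x': "x' \<in> eig A (\<omega> k)" "dist x' x < e" using d(2) by blast
      have "dist x (u k) \<le> dist x x'" unfolding u_def by (rule closest_point_le[OF cl(1) x'(1)])
      then show "dist (u k) x < e" using x'(2) by (simp add: dist_commute)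
    qed
  qed
  then show ?thesis using that u by blast
qed

text \<open>At a regular direction \<open>lam\<close> is differentiable, and its derivative along the circle is the
  tangential coordinate of every point of the face.\<close>

lemma regular_face_singleton:
  assumes l: "eig_lsc A w" and w: "norm w = 1"
    and z: "supports w (numerical_range A) z" and z': "supports w (numerical_range A) z'"
  shows "z = z'"
proof -
  define s where "s k = inverse (real (Suc k))" for k
  define \<omega> where "\<omega> k = w + s k *\<^sub>R (\<i> * w)" for k
  have s: "s \<longlonglongrightarrow> 0" unfolding s_def by (rule LIMSEQ_inverse_real_of_nat)
  have s0: "s k > 0" for k by (simp add: s_def)
  have "\<omega> \<longlonglongrightarrow> w + 0 *\<^sub>R (\<i> * w)" unfolding \<omega>_def by (intro tendsto_intros s)
  then have \<omega>: "\<omega> \<longlonglongrightarrow> w" by simp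
  define D where "D k = complex_of_real ((lam A (\<omega> k) - lam A w) / s k)" for k
  have D: "D \<longlonglongrightarrow> complex_of_real ((\<i> * w) \<bullet> \<zeta>)" if \<zeta>: "supports w (numerical_range A) \<zeta>" for \<zeta>
  proof -
    obtain x where x: "x \<in> inv_fov_map A \<zeta>" using \<zeta> by (auto simp: supports_def numerical_range_iff)
    then have xe: "x \<in> eig A w" using eig_iff_supports \<zeta> by blast
    obtain u where u: "\<And>k. u k \<in> eig A (\<omega> k)" "u \<longlonglongrightarrow> x" using eig_lsc_limit[OF l xe \<omega>] by blast
    \<comment> \<open>Pairing the eigenvector equation at \<open>\<omega> k\<close> with
      \<open>x\<close> cancels the terms in direction \<open>w\<close>. What remains expresses the
      difference quotient \<open>D k\<close>, which does not depend on \<open>\<zeta>\<close>,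
      through the tangential form.\<close>
    have eq: "D k * cdot x (u k) = cdot x (herm A (\<i> * w) *v u k)" for k
    proof -
      have "complex_of_real (lam A (\<omega> k)) * cdot x (u k) = cdot x (herm A (\<omega> k) *v u k)"
        using u(1)[of k] by (simp add: eig_def cdot_scale_right)
      also have "herm A (\<omega> k) *v u k = herm A w *v u k + s k *\<^sub>R (herm A (\<i> * w) *v u k)"
        using herm_linear[of A 1 w "s k" "\<i> * w"] by (simp add: \<omega>_def)
      also have "cdot x (herm A w *v u k + s k *\<^sub>R (herm A (\<i> * w) *v u k))
          = cdot (herm A w *v x) (u k) + complex_of_real (s k) * cdot x (herm A (\<i> * w) *v u k)"
        by (simp add: cdot_algebra cdot_herm_left)
      also have "cdot (herm A w *v x) (u k) = complex_of_real (lam A w) * cdot x (u k)"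
        using xe by (simp add: eig_def cdot_scale_left)
      finally show ?thesis using s0[of k] by (simp add: D_def field_simps)
    qed
    have "(\<lambda>k. cdot x (herm A (\<i> * w) *v u k) / cdot x (u k)) \<longlonglongrightarrow> cdot x (herm A (\<i> * w) *v x) / cdot x x"
      by (intro tendsto_divide tendsto_cdot tendsto_const tendsto_matrix u)
         (use x in \<open>simp add: cdot_self inv_fov_map_iff\<close>)
    also have "cdot x (herm A (\<i> * w) *v x) / cdot x x = complex_of_real ((\<i> * w) \<bullet> \<zeta>)"
      using x by (simp add: cdot_herm_self cdot_self inv_fov_map_iff)
    finally have lim: "(\<lambda>k. cdot x (herm A (\<i> * w) *v u k) / cdot x (u k)) \<longlonglongrightarrow> complex_of_real ((\<i> * w) \<bullet> \<zeta>)" .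
    have "(\<lambda>k. cdot x (u k)) \<longlonglongrightarrow> cdot x x" by (intro tendsto_cdot tendsto_const u)
    then have "\<forall>\<^sub>F k in sequentially. cdot x (u k) \<noteq> 0"
      by (rule tendsto_imp_eventually_ne) (use x in \<open>simp add: cdot_self inv_fov_map_iff\<close>)
    then have "\<forall>\<^sub>F k in sequentially. cdot x (herm A (\<i> * w) *v u k) / cdot x (u k) = D k"
      by (rule eventually_mono) (simp add: eq[symmetric])
    then show ?thesis using lim by (rule Lim_transform_eventually[rotated])
  qed
  have "(\<i> * w) \<bullet> z = (\<i> * w) \<bullet> z'" using LIMSEQ_unique[OF D[OF z] D[OF z']] by simp
  moreover have wz: "w \<bullet> (z - z') = 0" using z z' by (simp add: supports_iff_lam inner_diff_right)
  moreover obtain r where r: "z - z' = r *\<^sub>R (\<i> * w)" by (rule planar_orthogonal[OF wz]) (use w in auto)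
  ultimately have "r * ((\<i> * w) \<bullet> (\<i> * w)) = 0" by (metis inner_diff_right inner_scaleR_right right_minus_eq)
  then have "r = 0" using w by (auto)
  then show ?thesis using r by simp
qed

lemma radial_boundary_point:
  fixes S :: "'a::euclidean_space set"
  assumes S: "compact S" "convex S" and p: "p \<in> interior S" and \<xi>: "\<xi> \<in> S"
  obtains b s where "b \<in> S" "b \<notin> interior S" "0 \<le> s" "s \<le> 1" "\<xi> = (1 - s) *\<^sub>R b + s *\<^sub>R p"
proof -
  \<comment> \<open>For \<open>\<xi> = p\<close> any ray will do, with \<open>s = 1\<close>.\<close>
  define l where "l = (if \<xi> = p then SOME i. i \<in> Basis else \<xi> - p)"
  have "l \<noteq> 0" by (auto simp: l_def SOME_Basis nonzero_Basis)
  obtain d where d: "d > 0" "p + d *\<^sub>R l \<in> frontier S"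
    using ray_to_frontier[OF compact_imp_bounded[OF S(1)] p \<open>l \<noteq> 0\<close>] by blast
  have b: "p + d *\<^sub>R l \<in> S" "p + d *\<^sub>R l \<notin> interior S"
    using d(2) compact_imp_closed[OF S(1)] by (auto simp: frontier_def)
  show ?thesis
  proof (cases "\<xi> = p")
    case True
    then show ?thesis using that[OF b, of 1] by simp
  next
    case False
    then have l: "l = \<xi> - p" by (simp add: l_def)
    have "d \<ge> 1"
    proof (rule ccontr)
      assume "\<not> d \<ge> 1"
      then have "\<xi> - (1 - d) *\<^sub>R (\<xi> - p) \<in> interior S"
        using d(1) by (intro mem_interior_convex_shrink[OF S(2) p \<xi>]) auto
      also have "\<xi> - (1 - d) *\<^sub>R (\<xi> - p) = p + d *\<^sub>R l" by (simp add: l algebra_simps)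
      finally show False using b(2) by blast
    qed
    moreover have "(1 - (1 - 1 / d)) *\<^sub>R (p + d *\<^sub>R l) + (1 - 1 / d) *\<^sub>R p = \<xi>"
      using d(1) by (simp add: l scaleR_add_right scaleR_diff_left)
    ultimately show ?thesis using that[OF b, of "1 - 1 / d"] by simp
  qed
qed

text \<open>If approximation fails, \<open>z\<close> is extreme and \<open>w0\<close> its only
  supporting direction. Points tending to \<open>z\<close> are projected from \<open>p\<close> to
  boundary points \<open>b k\<close>, whose supporting directions subconverge to \<open>w0\<close>.
  Regularity makes \<open>y\<close> a limit of top eigenvectors in these directions. They are
  eventually regular too, since only finitely many directions are not, so their faces are single
  points and the normalised eigenvectors lie over \<open>b k\<close>; \<open>segment_near\<close>
  leads back to the given points.\<close>

lemma regular_support_lsc: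
  assumes int: "interior (numerical_range A) \<noteq> {}"
    and w0: "norm w0 = 1" "supports w0 (numerical_range A) z" "eig_lsc A w0"
    and y: "y \<in> inv_fov_map A z"
  shows "lsc_at A z y"
proof (rule ccontr)
  assume not: "\<not> lsc_at A z y"
  obtain p where p: "p \<in> interior (numerical_range A)" using int by blast
  note uniq = nonlsc_unique_support[OF int y not]
  have ext: "z extreme_point_of numerical_range A" by (rule nonlsc_extreme[OF int y not])
  have zint: "z \<notin> interior (numerical_range A)" using ext by (rule extreme_point_not_in_interior)
  have "lsc_at A z y"
  proof (rule lsc_atI_sequence[OF y])
    fix \<xi> and e :: real assume \<xi>: "\<And>k. \<xi> k \<in> numerical_range A" "\<xi> \<longlonglongrightarrow> z" and e: "e > 0"
    have "\<forall>k. \<exists>b s. b \<in> numerical_range A \<and> b \<notin> interior (numerical_range A) \<and> 0 \<le> s \<and> s \<le> 1 \<and> \<xi> k = (1 - s) *\<^sub>R b + s *\<^sub>R p"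
      using radial_boundary_point[OF compact_numerical_range convex_numerical_range p \<xi>(1)] by metis
    then obtain b s where b: "\<And>k. b k \<in> numerical_range A" "\<And>k. b k \<notin> interior (numerical_range A)"
      and s: "\<And>k. 0 \<le> s k" "\<And>k. s k \<le> (1::real)" and eq: "\<And>k. \<xi> k = (1 - s k) *\<^sub>R b k + s k *\<^sub>R p" by metis
    have "\<forall>k. \<exists>w. norm w = 1 \<and> supports w (numerical_range A) (b k)"
      using supports_exists[OF convex_numerical_range b(1) b(2) int] by metis
    then obtain w where w: "\<And>k. norm (w k) = 1" "\<And>k. supports (w k) (numerical_range A) (b k)" by metis
    define X where "X k = (b k, s k, w k)" for k
    have "\<forall>k. X k \<in> numerical_range A \<times> {0..1} \<times> sphere 0 1" using b s w by (simp add: X_def)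
    moreover have "compact (numerical_range A \<times> {0..1::real} \<times> sphere (0::complex) 1)"
      by (intro compact_Times compact_numerical_range) auto
    ultimately obtain l f where l: "l \<in> numerical_range A \<times> {0..1} \<times> sphere 0 1" "strict_mono f" "(X \<circ> f) \<longlonglongrightarrow> l"
      unfolding compact_def by blast
    obtain b' s' w' where l': "l = (b', s', w')" by (cases l)
    have bl: "(\<lambda>k. b (f k)) \<longlonglongrightarrow> b'" and sl: "(\<lambda>k. s (f k)) \<longlonglongrightarrow> s'" and wl: "(\<lambda>k. w (f k)) \<longlonglongrightarrow> w'"
      using tendsto_fst[OF l(3)] tendsto_fst[OF tendsto_snd[OF l(3)]] tendsto_snd[OF tendsto_snd[OF l(3)]]
      by (simp_all add: X_def l' o_def)
    have b': "b' \<in> numerical_range A" "0 \<le> s'" "s' \<le> 1" "norm w' = 1" using l(1) l' by auto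
    have "(\<lambda>k. \<xi> (f k)) \<longlonglongrightarrow> (1 - s') *\<^sub>R b' + s' *\<^sub>R p" unfolding eq by (intro tendsto_intros bl sl)
    then have z: "z = (1 - s') *\<^sub>R b' + s' *\<^sub>R p"
      using LIMSEQ_unique[OF LIMSEQ_subseq_LIMSEQ[OF \<xi>(2) l(2)]] by (simp add: o_def)
    have s'0: "s' = 0"
    proof (rule ccontr)
      assume "s' \<noteq> 0"
      then have "b' - s' *\<^sub>R (b' - p) \<in> interior (numerical_range A)"
        using b' by (intro mem_interior_convex_shrink[OF convex_numerical_range p]) auto
      moreover have "b' - s' *\<^sub>R (b' - p) = z" by (simp add: z algebra_simps)
      ultimately show False using zint by simp
    qed
    then have bz: "b' = z" using z by simp
    have "w' \<bullet> \<zeta> \<le> w' \<bullet> z" if \<zeta>: "\<zeta> \<in> numerical_range A" for \<zeta>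
    proof (rule LIMSEQ_le)
      show "(\<lambda>k. w (f k) \<bullet> \<zeta>) \<longlonglongrightarrow> w' \<bullet> \<zeta>" "(\<lambda>k. w (f k) \<bullet> b (f k)) \<longlonglongrightarrow> w' \<bullet> z"
        using bz bl by (auto intro!: tendsto_intros wl)
      show "\<exists>N. \<forall>n\<ge>N. w (f n) \<bullet> \<zeta> \<le> w (f n) \<bullet> b (f n)" using w(2) \<zeta> by (auto simp: supports_def)
    qed
    then have "supports w' (numerical_range A) z" using bz b'(1) by (simp add: supports_def)
    then have "w' = w0" using uniq[of w' w0] b'(4) w0 by simp
    then have wl0: "(\<lambda>k. w (f k)) \<longlonglongrightarrow> w0" using wl by simp
    have ye: "y \<in> eig A w0" using eig_iff_supports[OF y] w0 by blast
    obtain u where u: "\<And>k. u k \<in> eig A (w (f k))" "u \<longlonglongrightarrow> y" using eig_lsc_limit[OF w0(3) ye wl0] by blast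
    have ny: "norm y = 1" using y by (simp add: inv_fov_map_iff)
    define u' where "u' k = (1 / norm (u k)) *\<^sub>R u k" for k
    have "u' \<longlonglongrightarrow> (1 / norm y) *\<^sub>R y" unfolding u'_def by (intro tendsto_intros u) (use ny in auto)
    then have u'l: "u' \<longlonglongrightarrow> y" using ny by simp
    let ?X = "{w. norm w = 1 \<and> \<not> eig_lsc A w}"
    have "open (- ?X)" using finite_imp_closed[OF finite_irregular[of A]] by (simp add: open_Compl)
    then have e1: "\<forall>\<^sub>F k in sequentially. w (f k) \<in> - ?X" using topological_tendstoD[OF wl0, of "- ?X"] w0(3) by simp
    have "(\<lambda>k. norm (u k)) \<longlonglongrightarrow> 1" using tendsto_norm[OF u(2)] ny by simp
    then have e2: "\<forall>\<^sub>F k in sequentially. 0 < norm (u k)" by (rule order_tendstoD) simp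
    have e3: "\<forall>\<^sub>F k in sequentially. dist (u' k) y < e / 2" using tendstoD[OF u'l, of "e / 2"] e by simp
    have "(\<lambda>k. sqrt (2 * s (f k))) \<longlonglongrightarrow> sqrt (2 * 0)" using sl s'0 by (intro tendsto_intros) auto
    then have e4: "\<forall>\<^sub>F k in sequentially. sqrt (2 * s (f k)) < e / 2" using e by (intro order_tendstoD) auto
    have "\<forall>\<^sub>F k in sequentially. w (f k) \<in> - ?X \<and> 0 < norm (u k) \<and> dist (u' k) y < e / 2 \<and> sqrt (2 * s (f k)) < e / 2"
      by (intro eventually_conj e1 e2 e3 e4)
    then obtain k where k: "w (f k) \<in> - ?X" "0 < norm (u k)" "dist (u' k) y < e / 2" "sqrt (2 * s (f k)) < e / 2"
      using eventually_happens'[OF sequentially_bot] by blast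
    have u'e: "u' k \<in> eig A (w (f k))" "norm (u' k) = 1" using u(1)[of k] k(2) by (auto simp: u'_def eig_scaleR)
    have "eig_lsc A (w (f k))" using k(1) w(1) by auto
    then have "fov_map A (u' k) = b (f k)"
      using regular_face_singleton w eig_unit_supports[OF u'e] by blast
    then have mem: "u' k \<in> inv_fov_map A (b (f k))" using u'e by (simp add: inv_fov_map_iff)
    have pN: "p \<in> numerical_range A" using p interior_subset by blast
    obtain x where x: "x \<in> inv_fov_map A ((1 - s (f k)) *\<^sub>R b (f k) + s (f k) *\<^sub>R p)" "dist x (u' k) \<le> sqrt (2 * s (f k))"
      using segment_near[OF mem pN s(1) s(2)] by blast
    have "dist x y < e" using x(2) k(3,4) dist_triangle[of x y "u' k"] by linarith
    then show "\<exists>k. \<exists>x\<in>inv_fov_map A (\<xi> k). dist x y < e" using x(1) eq by (intro exI[of _ "f k"] bexI[of _ x]) simp_all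
  qed
  then show False using not by blast
qed

section \<open>The finitely many exceptional extreme points\<close>

lemma planar_eq:
  assumes "w \<bullet> z = w \<bullet> z'" "(\<i> * w) \<bullet> z = (\<i> * w) \<bullet> z'" "w \<noteq> 0"
  shows "z = z'"
proof -
  have "w \<bullet> (z - z') = 0" using assms(1) by (simp add: inner_diff_right)
  then obtain r where r: "z - z' = r *\<^sub>R (\<i> * w)" using planar_orthogonal assms(3) by blast
  have "(\<i> * w) \<bullet> (z - z') = 0" using assms(2) by (simp add: inner_diff_right)
  then have "r = 0" unfolding r using assms(3) by simp
  then show ?thesis using r by simp
qed

lemma face_between:
  assumes w: "w \<noteq> 0" and T: "T = \<i> * w \<or> T = - (\<i> * w)"
    and "w \<bullet> a = c" "w \<bullet> b = c" "w \<bullet> z = c" and le: "T \<bullet> a < T \<bullet> z" "T \<bullet> z \<le> T \<bullet> b"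
  obtains s where "0 < s" "s \<le> 1" "z = (1 - s) *\<^sub>R a + s *\<^sub>R b" "s = 1 \<longleftrightarrow> z = b"
proof -
  define s where "s = (T \<bullet> z - T \<bullet> a) / (T \<bullet> b - T \<bullet> a)"
  have s: "0 < s" "s \<le> 1" using le by (simp_all add: s_def)
  have st: "s * (T \<bullet> b - T \<bullet> a) = T \<bullet> z - T \<bullet> a" using le by (simp add: s_def)
  have Tz: "T \<bullet> z = T \<bullet> ((1 - s) *\<^sub>R a + s *\<^sub>R b)" using st by (simp add: inner_add_right algebra_simps)
  have z: "z = (1 - s) *\<^sub>R a + s *\<^sub>R b"
    by (rule planar_eq[OF _ _ w]) (use T Tz assms(3-5) in \<open>auto simp: inner_add_right algebra_simps\<close>)
  have "s = 1 \<longleftrightarrow> z = b"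
  proof
    assume "z = b"
    then show "s = 1" using st le by auto
  qed (use z in simp)
  with s z that show ?thesis by blast
qed

lemma face_ends:
  assumes "norm w = 1"
  obtains a b where "supports w (numerical_range A) a" "supports w (numerical_range A) b"
    "\<And>\<zeta>. supports w (numerical_range A) \<zeta> \<Longrightarrow> (\<i> * w) \<bullet> a \<le> (\<i> * w) \<bullet> \<zeta> \<and> (\<i> * w) \<bullet> \<zeta> \<le> (\<i> * w) \<bullet> b"
proof -
  define S where "S = {\<zeta>. supports w (numerical_range A) \<zeta>}"
  have S: "S = numerical_range A \<inter> {\<zeta>. w \<bullet> \<zeta> = lam A w}" by (auto simp: S_def supports_iff_lam)
  have "compact S" unfolding S by (intro compact_Int_closed compact_numerical_range closed_hyperplane)
  moreover have "S \<noteq> {}" unfolding S using lam_attained by blast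
  moreover have "continuous_on S (\<lambda>\<zeta>. (\<i> * w) \<bullet> \<zeta>)" by (intro continuous_intros)
  ultimately obtain a b where "a \<in> S" "\<forall>\<zeta>\<in>S. (\<i> * w) \<bullet> a \<le> (\<i> * w) \<bullet> \<zeta>" "b \<in> S" "\<forall>\<zeta>\<in>S. (\<i> * w) \<bullet> \<zeta> \<le> (\<i> * w) \<bullet> b"
    using continuous_attains_inf continuous_attains_sup by metis
  then show ?thesis using that unfolding S_def by blast
qed

lemma extreme_face_ends:
  assumes w: "norm w = 1" and ab: "supports w (numerical_range A) a" "supports w (numerical_range A) b"
    "\<And>\<zeta>. supports w (numerical_range A) \<zeta> \<Longrightarrow> (\<i> * w) \<bullet> a \<le> (\<i> * w) \<bullet> \<zeta> \<and> (\<i> * w) \<bullet> \<zeta> \<le> (\<i> * w) \<bullet> b"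
    and z: "z extreme_point_of numerical_range A" "supports w (numerical_range A) z"
  shows "z = a \<or> z = b"
proof (rule ccontr)
  assume ne: "\<not> ?thesis"
  have w0: "w \<noteq> 0" using w by auto
  have c: "w \<bullet> a = lam A w" "w \<bullet> b = lam A w" "w \<bullet> z = lam A w" using ab z by (auto simp: supports_iff_lam)
  have "(\<i> * w) \<bullet> a \<noteq> (\<i> * w) \<bullet> z" using planar_eq[of w a z] c ne w0 by auto
  then have lt: "(\<i> * w) \<bullet> a < (\<i> * w) \<bullet> z" "(\<i> * w) \<bullet> z \<le> (\<i> * w) \<bullet> b" using ab(3)[OF z(2)] by auto
  obtain s where s: "0 < s" "s \<le> 1" "z = (1 - s) *\<^sub>R a + s *\<^sub>R b" "s = 1 \<longleftrightarrow> z = b"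
    by (rule face_between[OF w0 _ c lt]) auto
  have "a \<noteq> b" using lt by auto
  then have "z \<in> open_segment a b" using s ne by (auto simp: in_segment intro!: exI[of _ s] le_neq_trans)
  then show False using z(1) ab(1,2) by (auto simp: extreme_point_of_def supports_def)
qed

text \<open>If the range has interior, these include all points over which some fibre vector is not
  approximable, by \<open>nonlsc_exceptional\<close>.\<close>

definition exceptional_points :: "complex ^ 'n ^ 'n \<Rightarrow> complex set" where
  "exceptional_points A = {z. z extreme_point_of numerical_range A \<and>
     (\<exists>w. norm w = 1 \<and> \<not> eig_lsc A w \<and> supports w (numerical_range A) z)}"

text \<open>There are finitely many irregular directions, and only the two ends of each face can be
  extreme.\<close>

lemma finite_exceptional_points: "finite (exceptional_points A)"
proof -
  let ?S = "\<lambda>w. {z. z extreme_point_of numerical_range A \<and> supports w (numerical_range A) z}"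
  have "finite (?S w)" if w: "norm w = 1" for w
  proof -
    obtain a b where ab: "supports w (numerical_range A) a" "supports w (numerical_range A) b"
      "\<And>\<zeta>. supports w (numerical_range A) \<zeta> \<Longrightarrow> (\<i> * w) \<bullet> a \<le> (\<i> * w) \<bullet> \<zeta> \<and> (\<i> * w) \<bullet> \<zeta> \<le> (\<i> * w) \<bullet> b"
      using face_ends[OF w, of A] by metis
    have "?S w \<subseteq> {a, b}" using extreme_face_ends[OF w ab] by blast
    then show ?thesis by (rule finite_subset) simp
  qed
  then have "finite (\<Union>w\<in>{w. norm w = 1 \<and> \<not> eig_lsc A w}. ?S w)" using finite_irregular[of A] by blast
  moreover have "exceptional_points A \<subseteq> (\<Union>w\<in>{w. norm w = 1 \<and> \<not> eig_lsc A w}. ?S w)"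
    by (auto simp: exceptional_points_def)
  ultimately show ?thesis by (rule rev_finite_subset)
qed

lemma nonlsc_exceptional:
  assumes int: "interior (numerical_range A) \<noteq> {}" and y: "y \<in> inv_fov_map A z" "\<not> lsc_at A z y"
  shows "z \<in> exceptional_points A"
proof -
  have ext: "z extreme_point_of numerical_range A" by (rule nonlsc_extreme[OF int y])
  have z: "z \<in> numerical_range A" using y by (auto simp: numerical_range_iff)
  obtain w where w: "norm w = 1" "supports w (numerical_range A) z"
    using supports_exists[OF convex_numerical_range z extreme_point_not_in_interior[OF ext] int] by blast
  have "\<not> eig_lsc A w" using regular_support_lsc[OF int w _ y(1)] y(2) by blast
  then show ?thesis using ext w by (auto simp: exceptional_points_def)
qed

text \<open>\<open>T\<close> is the unit tangent pointing from the end \<open>z\<close> of the edge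
  to the other end \<open>b\<close>.\<close>

lemma edge_end:
  assumes w: "norm w = 1" and z: "z extreme_point_of numerical_range A" "supports w (numerical_range A) z"
    and \<zeta>: "supports w (numerical_range A) \<zeta>" "\<zeta> \<noteq> z"
  obtains T b s where "T = \<i> * w \<or> T = - (\<i> * w)" "supports w (numerical_range A) b"
    "\<And>\<zeta>'. supports w (numerical_range A) \<zeta>' \<Longrightarrow> T \<bullet> z \<le> T \<bullet> \<zeta>' \<and> T \<bullet> \<zeta>' \<le> T \<bullet> b"
    "T \<bullet> z < T \<bullet> b" "0 < s" "s \<le> 1" "\<zeta> = (1 - s) *\<^sub>R z + s *\<^sub>R b"
proof -
  have w0: "w \<noteq> 0" using w by auto
  obtain a b where ab: "supports w (numerical_range A) a" "supports w (numerical_range A) b"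
    "\<And>\<zeta>. supports w (numerical_range A) \<zeta> \<Longrightarrow> (\<i> * w) \<bullet> a \<le> (\<i> * w) \<bullet> \<zeta> \<and> (\<i> * w) \<bullet> \<zeta> \<le> (\<i> * w) \<bullet> b"
    using face_ends[OF w, of A] by metis
  have "z = a \<or> z = b" by (rule extreme_face_ends[OF w ab z])
  then obtain T b' where T: "T = \<i> * w \<or> T = - (\<i> * w)" and b': "supports w (numerical_range A) b'"
    and mm: "\<And>\<zeta>'. supports w (numerical_range A) \<zeta>' \<Longrightarrow> T \<bullet> z \<le> T \<bullet> \<zeta>' \<and> T \<bullet> \<zeta>' \<le> T \<bullet> b'"
  proof
    assume "z = a"
    then show ?thesis using that[of "\<i> * w" b] ab by blast
  next
    assume "z = b"
    then show ?thesis using that[of "- (\<i> * w)" a] ab by (simp del: mult_minus_right mult_minus_left)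
  qed
  have c: "w \<bullet> z = lam A w" "w \<bullet> b' = lam A w" "w \<bullet> \<zeta> = lam A w" using b' z \<zeta> by (auto simp: supports_iff_lam)
  have "T \<bullet> z \<noteq> T \<bullet> \<zeta>" using planar_eq[of w z \<zeta>] c \<zeta>(2) w0 T by auto
  then have lt: "T \<bullet> z < T \<bullet> \<zeta>" "T \<bullet> \<zeta> \<le> T \<bullet> b'" using mm[OF \<zeta>(1)] by auto
  obtain s where s: "0 < s" "s \<le> 1" "\<zeta> = (1 - s) *\<^sub>R z + s *\<^sub>R b'"
    by (rule face_between[OF w0 T c lt]) auto
  show ?thesis by (rule that[OF T b' mm _ s]) (use lt in auto)
qed

section \<open>Orthogonal projections\<close>

definition csubspace :: "(complex ^ 'n) set \<Rightarrow> bool" where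
  "csubspace V \<longleftrightarrow> 0 \<in> V \<and> (\<forall>x\<in>V. \<forall>y\<in>V. x + y \<in> V) \<and> (\<forall>c. \<forall>x\<in>V. c *s x \<in> V)"

lemma csubspace_diff: "csubspace V \<Longrightarrow> x \<in> V \<Longrightarrow> y \<in> V \<Longrightarrow> x - y \<in> V"
  unfolding csubspace_def by (metis diff_conv_add_uminus vector_sneg_minus1)

lemma csubspace_eig: "csubspace (eig A w)"
  using subspace_0[OF subspace_eig[of A w]] by (simp add: csubspace_def eig_add eig_scale)

definition proj :: "(complex ^ 'n) set \<Rightarrow> complex ^ 'n \<Rightarrow> complex ^ 'n" where
  "proj V e = (SOME p. p \<in> V \<and> (\<forall>x\<in>V. cdot x (e - p) = 0))"

lemma proj:
  assumes V: "csubspace V"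
  shows "proj V e \<in> V" "x \<in> V \<Longrightarrow> cdot x (e - proj V e) = 0"
proof -
  have sub: "subspace V" using V by (auto simp: csubspace_def subspace_def scaleR_eq_scale)
  obtain p z where p: "p \<in> span V" "\<And>u. u \<in> span V \<Longrightarrow> orthogonal z u" "e = p + z"
    using orthogonal_subspace_decomp_exists[of V e] by blast
  have pV: "p \<in> V" using p(1) span_eq_iff[THEN iffD2, OF sub] by simp
  have "cdot x (e - p) = 0" if x: "x \<in> V" for x
  proof -
    have re: "Re (cdot u z) = 0" if "u \<in> V" for u
      using p(2)[of u] span_base[OF that] by (simp add: orthogonal_def inner_commute inner_eq_Re_cdot[symmetric])
    have "\<i> *s x \<in> V" using V x by (simp add: csubspace_def)
    then have "Im (cdot x z) = 0" using re[of "\<i> *s x"] by (simp add: cdot_scale_left)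
    then show ?thesis using re[OF x] p(3) by (simp add: complex_eq_iff)
  qed
  then have "\<exists>p. p \<in> V \<and> (\<forall>x\<in>V. cdot x (e - p) = 0)" using pV by blast
  then have *: "proj V e \<in> V \<and> (\<forall>x\<in>V. cdot x (e - proj V e) = 0)" unfolding proj_def by (rule someI_ex)
  show "proj V e \<in> V" "x \<in> V \<Longrightarrow> cdot x (e - proj V e) = 0" using * by auto
qed

lemma proj_unique:
  assumes V: "csubspace V" and p: "p \<in> V" "\<And>x. x \<in> V \<Longrightarrow> cdot x (e - p) = 0"
  shows "proj V e = p"
proof -
  let ?d = "proj V e - p"
  have d: "?d \<in> V" using csubspace_diff[OF V proj(1)[OF V] p(1)] .
  have "cdot ?d ?d = cdot ?d (e - p) - cdot ?d (e - proj V e)" by (simp add: cdot_algebra)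
  also have "\<dots> = 0" using p(2)[OF d] proj(2)[OF V d] by simp
  finally show ?thesis by (simp add: cdot_self)
qed

lemma proj_pythagoras:
  assumes V: "csubspace V" and u: "u \<in> V"
  shows "(norm (e - u))\<^sup>2 = (norm (e - proj V e))\<^sup>2 + (norm (proj V e - u))\<^sup>2"
proof -
  have "proj V e - u \<in> V" using csubspace_diff[OF V proj(1)[OF V] u] .
  then have "cdot (proj V e - u) (e - proj V e) = 0" by (rule proj(2)[OF V])
  then show ?thesis using norm_add_cdot[of "proj V e - u" "e - proj V e"] by simp
qed

lemma proj_closest: "csubspace V \<Longrightarrow> u \<in> V \<Longrightarrow> norm (e - proj V e) \<le> norm (e - u)"
  using proj_pythagoras[of V u e] by (metis le_add_same_cancel1 norm_ge_zero power2_le_imp_le zero_le_power2)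

lemma proj_norm:
  assumes "csubspace V"
  shows "norm (proj V e) \<le> norm e" "norm (e - proj V e) \<le> norm e"
proof -
  have "0 \<in> V" using assms by (simp add: csubspace_def)
  from proj_pythagoras[OF assms this, of e] show "norm (proj V e) \<le> norm e" "norm (e - proj V e) \<le> norm e"
    by (simp_all add: power2_le_imp_le)
qed

lemma proj_add:
  assumes V: "csubspace V"
  shows "proj V (x + y) = proj V x + proj V y"
proof (rule proj_unique[OF V])
  show "proj V x + proj V y \<in> V" using V proj(1)[OF V] by (simp add: csubspace_def)
  fix u assume u: "u \<in> V"
  have "x + y - (proj V x + proj V y) = (x - proj V x) + (y - proj V y)" by simp
  then show "cdot u (x + y - (proj V x + proj V y)) = 0"
    by (simp only: cdot_add_right proj(2)[OF V u] add_0_left)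
qed

lemma closed_cdot_orthogonal: "closed {x. \<forall>u\<in>V. cdot u x = 0}" "subspace {x. \<forall>u\<in>V. cdot u x = 0}"
proof -
  show "subspace {x. \<forall>u\<in>V. cdot u x = 0}" by (auto simp: subspace_def cdot_algebra)
  then show "closed {x. \<forall>u\<in>V. cdot u x = 0}" by (rule closed_subspace)
qed

section \<open>Lipschitz dependence of regular eigenspaces\<close>

lemma herm_lipschitz: "\<exists>K\<ge>0. \<forall>w w' x. norm (herm A w *v x - herm A w' *v x) \<le> K * norm (w - w') * norm x"
proof -
  obtain K1 where K1: "K1 > 0" "\<And>x. norm (herm A 1 *v x) \<le> norm x * K1"
    using bounded_linear.pos_bounded[OF bounded_linear_matrix[of "herm A 1"]] by auto
  obtain K2 where K2: "K2 > 0" "\<And>x. norm (herm A \<i> *v x) \<le> norm x * K2"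
    using bounded_linear.pos_bounded[OF bounded_linear_matrix[of "herm A \<i>"]] by auto
  have "norm (herm A w *v x - herm A w' *v x) \<le> (K1 + K2) * norm (w - w') * norm x" for w w' x
  proof -
    have "herm A w *v x - herm A w' *v x = herm A (w - w') *v x"
      using herm_linear[of A 1 w "-1" w' x] by simp
    also have "\<dots> = Re (w - w') *\<^sub>R (herm A 1 *v x) + Im (w - w') *\<^sub>R (herm A \<i> *v x)" by (rule herm_decomp)
    also have "norm \<dots> \<le> \<bar>Re (w - w')\<bar> * norm (herm A 1 *v x) + \<bar>Im (w - w')\<bar> * norm (herm A \<i> *v x)"
      by (metis norm_triangle_ineq norm_scaleR)
    also have "\<dots> \<le> norm (w - w') * (norm x * K1) + norm (w - w') * (norm x * K2)"
      by (intro add_mono mult_mono K1 K2 abs_Re_le_cmod abs_Im_le_cmod) auto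
    finally show ?thesis by (simp add: algebra_simps)
  qed
  then show ?thesis using K1 K2 by (intro exI[of _ "K1 + K2"]) auto
qed

text \<open>On the orthogonal complement of the eigenspace at \<open>w1\<close> the matrix
  \<open>lam - herm\<close> is injective, hence bounded below by some \<open>g\<close>; on a unit
  top eigenvector for \<open>w\<close> it has size of order \<open>norm (w - w1)\<close>. Dividing
  bounds the orthogonal component.\<close>

lemma eig_near_eig:
  "\<exists>C\<ge>0. \<forall>w x. x \<in> eig A w \<longrightarrow> norm (x - proj (eig A w1) x) \<le> C * norm (w - w1) * norm x"
proof -
  let ?E = "eig A w1"
  let ?L = "\<lambda>x. lam A w1 *\<^sub>R x - herm A w1 *v x"
  note E = csubspace_eig[of A w1]
  have bl: "bounded_linear ?L"
    by (intro bounded_linear_sub bounded_linear_scaleR_right bounded_linear_matrix)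
  have inj: "\<forall>x\<in>{x. \<forall>u\<in>?E. cdot u x = 0}. ?L x = 0 \<longrightarrow> x = 0"
  proof (intro ballI impI)
    fix x assume x: "x \<in> {x. \<forall>u\<in>?E. cdot u x = 0}" "?L x = 0"
    then have "x \<in> ?E" by (simp add: eig_def scaleR_eq_scale)
    then have "cdot x x = 0" using x(1) by blast
    then show "x = 0" by (simp add: cdot_self)
  qed
  obtain g where g0: "g > 0" "\<forall>x\<in>{x. \<forall>u\<in>?E. cdot u x = 0}. norm (?L x) \<ge> g * norm x"
    using injective_imp_isometric[OF closed_cdot_orthogonal bl inj] by (elim exE conjE)
  have g: "g > 0" "\<And>x. (\<And>u. u \<in> ?E \<Longrightarrow> cdot u x = 0) \<Longrightarrow> norm (?L x) \<ge> g * norm x"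
    using g0 by simp_all
  obtain K where K: "K \<ge> 0" "\<And>w w' x. norm (herm A w *v x - herm A w' *v x) \<le> K * norm (w - w') * norm x"
    using herm_lipschitz[of A] by blast
  obtain C where C: "C \<ge> 0" "\<And>w w'. \<bar>lam A w - lam A w'\<bar> \<le> C * norm (w - w')" using lam_lipschitz[of A] by blast
  have "norm (x - proj ?E x) \<le> ((C + K) / g) * norm (w - w1) * norm x" if x: "x \<in> eig A w" for w x
  proof -
    have "?L (x - proj ?E x) = ?L x"
      using proj(1)[OF E, of x] by (simp add: eig_def scaleR_eq_scale matrix_vector_mult_diff_distrib vector_ssub_ldistrib)
    also have "\<dots> = (lam A w1 - lam A w) *\<^sub>R x + (herm A w *v x - herm A w1 *v x)"
      using x by (simp add: eig_def scaleR_eq_scale vector_sub_rdistrib)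
    also have "norm \<dots> \<le> \<bar>lam A w1 - lam A w\<bar> * norm x + norm (herm A w *v x - herm A w1 *v x)"
      by (metis norm_triangle_ineq norm_scaleR)
    also have "\<dots> \<le> C * norm (w - w1) * norm x + K * norm (w - w1) * norm x"
      using C(2)[of w1 w] by (intro add_mono mult_right_mono K) (auto simp: norm_minus_commute)
    finally have "norm (?L (x - proj ?E x)) \<le> (C + K) * norm (w - w1) * norm x" by (simp add: algebra_simps)
    moreover have "g * norm (x - proj ?E x) \<le> norm (?L (x - proj ?E x))" by (rule g(2)) (rule proj(2)[OF E])
    ultimately show ?thesis using g(1) by (simp add: field_simps)
  qed
  then show ?thesis using C(1) K(1) g(1) by (intro exI[of _ "(C + K) / g"]) auto
qed

text \<open>Compactness of the unit sphere makes regularity uniform over the eigenspace. The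
  constant 1/2 only has to be below 1, for the absorption in
  \<open>eig_lsc_lipschitz\<close>.\<close>

lemma eig_lsc_uniform:
  assumes l: "eig_lsc A w1"
  shows "\<exists>d>0. \<forall>w. dist w w1 < d \<longrightarrow> (\<forall>x\<in>eig A w1. norm (x - proj (eig A w) x) \<le> (1/2) * norm x)"
proof -
  define Q where "Q w \<longleftrightarrow> (\<forall>x\<in>eig A w1. norm x = 1 \<longrightarrow> norm (x - proj (eig A w) x) \<le> 1/2)" for w
  have "\<exists>d>0. \<forall>w. dist w w1 < d \<longrightarrow> Q w"
  proof (rule ccontr)
    assume *: "\<not> ?thesis"
    have "\<exists>w. dist w w1 < inverse (real (Suc k)) \<and> \<not> Q w" for k
    proof -
      have "inverse (real (Suc k)) > 0" by simp
      then show ?thesis using * by blast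
    qed
    then obtain \<omega> where \<omega>: "\<And>k. dist (\<omega> k) w1 < inverse (real (Suc k))" "\<And>k. \<not> Q (\<omega> k)" by metis
    have lim: "\<omega> \<longlonglongrightarrow> w1"
      by (rule tendsto_dist_iff[THEN iffD2], rule tendsto_sandwich[OF _ _ tendsto_const LIMSEQ_inverse_real_of_nat])
         (use \<omega>(1) in \<open>auto intro!: always_eventually less_imp_le\<close>)
    have "\<forall>k. \<exists>x\<in>eig A w1. norm x = 1 \<and> norm (x - proj (eig A (\<omega> k)) x) > 1/2"
      using \<omega>(2) unfolding Q_def by (meson not_le)
    then obtain x where x: "\<And>k. x k \<in> eig A w1" "\<And>k. norm (x k) = 1" "\<And>k. norm (x k - proj (eig A (\<omega> k)) (x k)) > 1/2"
      by metis
    have "\<forall>k. x k \<in> sphere 0 1" using x by simp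
    moreover have "compact (sphere (0 :: complex ^ 'a) 1)" by simp
    ultimately obtain y f where y: "strict_mono f" "(x \<circ> f) \<longlonglongrightarrow> y"
      unfolding compact_def by blast
    have ye: "y \<in> eig A w1"
      by (rule eig_closed_sequence[OF tendsto_const y(2)]) (use x in auto)
    have limf: "(\<lambda>k. \<omega> (f k)) \<longlonglongrightarrow> w1" using LIMSEQ_subseq_LIMSEQ[OF lim y(1)] by (simp add: o_def)
    obtain u where u: "\<And>k. u k \<in> eig A (\<omega> (f k))" "u \<longlonglongrightarrow> y" using eig_lsc_limit[OF l ye limf] by blast
    have "(\<lambda>k. norm ((x \<circ> f) k - u k)) \<longlonglongrightarrow> norm (y - y)" by (intro tendsto_intros y u)
    then have "\<forall>\<^sub>F k in sequentially. norm ((x \<circ> f) k - u k) < 1/2" by (rule order_tendstoD) simp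
    then obtain k where k: "norm (x (f k) - u k) < 1/2" using eventually_happens'[OF sequentially_bot] by fastforce
    have "norm (x (f k) - proj (eig A (\<omega> (f k))) (x (f k))) \<le> norm (x (f k) - u k)"
      by (rule proj_closest[OF csubspace_eig u(1)])
    then show False using k x(3)[of "f k"] by linarith
  qed
  then obtain d where d: "d > 0" "\<And>w. dist w w1 < d \<Longrightarrow> Q w" by blast
  have "norm (x - proj (eig A w) x) \<le> (1/2) * norm x" if w: "dist w w1 < d" and x: "x \<in> eig A w1" for w x
  proof (cases "x = 0")
    case True
    then show ?thesis using proj_norm(2)[OF csubspace_eig[of A w], of 0] by simp
  next
    case False
    define x' where "x' = (1 / norm x) *\<^sub>R x"
    have "norm (x' - proj (eig A w) x') \<le> 1/2"
      using d(2)[OF w] x False unfolding Q_def x'_def by (simp add: eig_scaleR)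
    moreover have "norm (x - proj (eig A w) x) \<le> norm (x - norm x *\<^sub>R proj (eig A w) x')"
      by (intro proj_closest csubspace_eig eig_scaleR proj(1))
    moreover have "x - norm x *\<^sub>R proj (eig A w) x' = norm x *\<^sub>R (x' - proj (eig A w) x')"
      using False by (simp add: x'_def scaleR_diff_right)
    ultimately have "norm (x - proj (eig A w) x) \<le> norm x * norm (x' - proj (eig A w) x')" by simp
    also have "\<dots> \<le> norm x * (1/2)"
      by (rule mult_left_mono[OF \<open>norm (x' - proj (eig A w) x') \<le> 1/2\<close>]) simp
    finally show ?thesis by simp
  qed
  then show ?thesis using d(1) by blast
qed

text \<open>The residual \<open>r\<close> of \<open>x\<close> is at most that of the corrected
  competitor \<open>?P x + ?P x'\<close>, where \<open>x'\<close> is the part of the residual vector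
  in the eigenspace at \<open>w1\<close>. Its own residual costs at most half of \<open>r\<close>,
  and the rest is linear in \<open>norm (w - w1)\<close> by \<open>eig_near_eig\<close>. Absorbing
  the half gives the factor 2.\<close>

lemma eig_lsc_lipschitz:
  assumes l: "eig_lsc A w1"
  shows "\<exists>d>0. \<exists>B\<ge>0. \<forall>w. dist w w1 < d \<longrightarrow>
     (\<forall>x\<in>eig A w1. norm (x - proj (eig A w) x) \<le> B * norm (w - w1) * norm x)"
proof -
  obtain C where C: "C \<ge> 0" "\<And>w x. x \<in> eig A w \<Longrightarrow> norm (x - proj (eig A w1) x) \<le> C * norm (w - w1) * norm x"
    using eig_near_eig[of A w1] by blast
  obtain d where d: "d > 0" "\<And>w x. dist w w1 < d \<Longrightarrow> x \<in> eig A w1 \<Longrightarrow> norm (x - proj (eig A w) x) \<le> (1/2) * norm x"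
    using eig_lsc_uniform[OF l] by blast
  have "norm (x - proj (eig A w) x) \<le> (2 * C) * norm (w - w1) * norm x" if w: "dist w w1 < d" and x: "x \<in> eig A w1" for w x
  proof -
    let ?P = "proj (eig A w)" and ?P1 = "proj (eig A w1)"
    note E = csubspace_eig[of A w] and E1 = csubspace_eig[of A w1]
    define r where "r = norm (x - ?P x)"
    define x' where "x' = x - ?P1 (?P x)"
    have x'E: "x' \<in> eig A w1" unfolding x'_def using x proj(1)[OF E1] by (rule csubspace_diff[OF E1])
    have "?P1 x' = x'" by (rule proj_unique[OF E1 x'E]) simp
    have "?P1 (x - ?P x) = x'"
    proof (rule proj_unique[OF E1 x'E])
      fix u assume u: "u \<in> eig A w1"
      have "x - ?P x - x' = - (?P x - ?P1 (?P x))" by (simp add: x'_def)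
      then show "cdot u (x - ?P x - x') = 0" by (simp only: cdot_minus_right proj(2)[OF E1 u] minus_zero)
    qed
    then have x'r: "norm x' \<le> r" unfolding r_def using proj_norm(1)[OF E1, of "x - ?P x"] by simp
    have "r \<le> norm (x - (?P x + ?P x'))"
      unfolding r_def by (rule proj_closest[OF E]) (intro eig_add proj(1)[OF E])
    also have "x - (?P x + ?P x') = - (?P x - ?P1 (?P x)) + (x' - ?P x')" by (simp add: x'_def)
    also have "norm \<dots> \<le> norm (?P x - ?P1 (?P x)) + norm (x' - ?P x')" by (metis norm_minus_cancel norm_triangle_ineq)
    also have "\<dots> \<le> C * norm (w - w1) * norm (?P x) + (1/2) * norm x'"
      by (intro add_mono C d x'E w proj(1)[OF E])
    also have "\<dots> \<le> C * norm (w - w1) * norm x + (1/2) * r"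
      using x'r C(1) proj_norm(1)[OF E, of x] by (intro add_mono mult_left_mono) auto
    finally show ?thesis by (simp add: r_def)
  qed
  then show ?thesis using d(1) C(1) by (intro exI[of _ d] conjI exI[of _ "2 * C"]) auto
qed

text \<open>The difference of the projections is \<open>p - ?P1 p\<close>, controlled by
  \<open>eig_near_eig\<close>, minus \<open>y = ?P1 (e - p)\<close>. The latter is bounded by
  duality: its squared norm is the pairing of \<open>y - ?P y\<close> with \<open>e - p\<close>, and
  \<open>eig_lsc_lipschitz\<close> applies. Lipschitz maps keep null sets null, which
  \<open>negligible_orthogonal_curve\<close> exploits.\<close>

lemma proj_eig_lipschitz:
  assumes l: "eig_lsc A w1"
  shows "\<exists>d>0. \<exists>B\<ge>0. \<forall>w. dist w w1 < d \<longrightarrow> norm (proj (eig A w) e - proj (eig A w1) e) \<le> B * norm (w - w1)"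
proof -
  obtain C where C: "C \<ge> 0" "\<And>w x. x \<in> eig A w \<Longrightarrow> norm (x - proj (eig A w1) x) \<le> C * norm (w - w1) * norm x"
    using eig_near_eig[of A w1] by blast
  obtain d B where d: "d > 0" and B: "B \<ge> 0"
    "\<And>w x. dist w w1 < d \<Longrightarrow> x \<in> eig A w1 \<Longrightarrow> norm (x - proj (eig A w) x) \<le> B * norm (w - w1) * norm x"
    using eig_lsc_lipschitz[OF l] by blast
  have "norm (proj (eig A w) e - proj (eig A w1) e) \<le> ((B + C) * norm e) * norm (w - w1)" if w: "dist w w1 < d" for w
  proof -
    let ?P = "proj (eig A w)" and ?P1 = "proj (eig A w1)"
    note E = csubspace_eig[of A w] and E1 = csubspace_eig[of A w1]
    define p where "p = ?P e"
    define y where "y = ?P1 (e - p)"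
    have yE: "y \<in> eig A w1" unfolding y_def by (rule proj(1)[OF E1])
    have "?P1 e = y + ?P1 p" using proj_add[OF E1, of "e - p" p] by (simp add: y_def)
    then have "p - ?P1 e = (p - ?P1 p) - y" by simp
    then have 1: "norm (p - ?P1 e) \<le> norm (p - ?P1 p) + norm y" using norm_triangle_ineq4 by metis
    have 2: "norm (p - ?P1 p) \<le> C * norm (w - w1) * norm e"
    proof -
      have "norm (p - ?P1 p) \<le> C * norm (w - w1) * norm p" unfolding p_def by (intro C(2) proj(1)[OF E])
      also have "\<dots> \<le> C * norm (w - w1) * norm e"
        unfolding p_def using C(1) by (intro mult_left_mono proj_norm(1)[OF E]) auto
      finally show ?thesis .
    qed
    have 3: "norm y \<le> B * norm (w - w1) * norm e"
    proof (cases "y = 0")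
      case False
      have "cdot y (e - p - y) = 0" unfolding y_def by (rule proj(2)[OF E1 proj(1)[OF E1]])
      moreover have "cdot (?P y) (e - p) = 0" unfolding p_def by (rule proj(2)[OF E proj(1)[OF E]])
      ultimately have "cdot y y = cdot (y - ?P y) (e - p)" by (simp add: cdot_algebra)
      then have "(norm y)\<^sup>2 = cmod (cdot (y - ?P y) (e - p))" by (metis cdot_self norm_of_real abs_power2)
      also have "\<dots> \<le> norm (y - ?P y) * norm (e - p)" by (rule cmod_cdot_le)
      also have "\<dots> \<le> (B * norm (w - w1) * norm y) * norm e"
        using B(1) unfolding p_def by (intro mult_mono B(2) w yE proj_norm(2)[OF E]) auto
      finally have "norm y * norm y \<le> norm y * (B * norm (w - w1) * norm e)" by (simp add: power2_eq_square mult_ac)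
      then show ?thesis using False by simp
    qed (use B(1) in auto)
    show ?thesis using 1 2 3 by (simp add: p_def algebra_simps)
  qed
  then show ?thesis using d B(1) C(1) by (intro exI[of _ d] conjI exI[of _ "(B + C) * norm e"]) auto
qed

section \<open>A generic vector\<close>

lemma cdot_axis: "cdot (axis i 1) x = x $ i"
  by (simp add: cdot_def axis_def if_distrib[of cnj] if_distrib[of "\<lambda>c. c * _"] cong: if_cong)

lemma normalize_lipschitz:
  fixes x y :: "'a::real_normed_vector"
  assumes "x \<noteq> 0" "y \<noteq> 0"
  shows "norm ((1 / norm x) *\<^sub>R x - (1 / norm y) *\<^sub>R y) \<le> (2 / norm y) * norm (x - y)"
proof -
  have "(1 / norm x) *\<^sub>R x - (1 / norm y) *\<^sub>R y = (1 / norm y) *\<^sub>R (x - y) + (1 / norm x - 1 / norm y) *\<^sub>R x"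
    by (simp add: algebra_simps)
  also have "norm \<dots> \<le> (1 / norm y) * norm (x - y) + \<bar>1 / norm x - 1 / norm y\<bar> * norm x"
    by (rule order_trans[OF norm_triangle_ineq]) simp
  also have "\<bar>1 / norm x - 1 / norm y\<bar> * norm x = (1 / norm y) * \<bar>norm y - norm x\<bar>"
  proof -
    have "1 / norm x - 1 / norm y = (norm y - norm x) / (norm x * norm y)" using assms by (simp add: field_simps)
    then show ?thesis using assms by (simp add: abs_divide)
  qed
  also have "\<dots> \<le> (1 / norm y) * norm (x - y)"
    using norm_triangle_ineq3[of y x] by (intro mult_left_mono) (auto simp: norm_minus_commute)
  finally show ?thesis by simp
qed

text \<open>A vector orthogonal to \<open>x t\<close> for some \<open>t\<close> lies in a one-parameter union of complex
  hyperplanes. The parameter \<open>t\<close> is encoded in the real part of the \<open>i\<close>-th coordinate, which is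
  free because \<open>x t\<close> has a nonzero \<open>i\<close>-th coordinate.\<close>

lemma negligible_orthogonal_curve:
  fixes x :: "real \<Rightarrow> complex ^ 'n"
  assumes lip: "\<And>t. t \<in> T \<Longrightarrow> \<exists>d>0. \<exists>B\<ge>0. \<forall>s\<in>T. \<bar>s - t\<bar> < d \<longrightarrow> norm (x s - x t) \<le> B * \<bar>s - t\<bar>"
    and nz: "\<And>t. t \<in> T \<Longrightarrow> x t $ i \<noteq> 0"
  shows "negligible {v. \<exists>t\<in>T. cdot (x t) v = 0}"
proof -
  define u where "u t = (1 / norm (x t)) *\<^sub>R x t" for t
  \<comment> \<open>\<open>r\<close> clears the coordinate that carries the parameter, and
    \<open>F\<close> removes the component along \<open>u\<close> at that parameter. A real
    \<open>i\<close>-th coordinate puts \<open>S\<close> into a real hyperplane, a null set.\<close>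
  define r where "r a = (\<chi> j. if j = i then 0 else a $ j)" for a :: "complex ^ 'n"
  define F where "F a = r a - cdot (u (Re (a $ i))) (r a) *s u (Re (a $ i))" for a
  define S where "S = {a :: complex ^ 'n. Im (a $ i) = 0 \<and> Re (a $ i) \<in> T}"
  have x0: "x t \<noteq> 0" if "t \<in> T" for t using nz[OF that] by auto
  have nu: "norm (u t) = 1" if "t \<in> T" for t using x0[OF that] by (simp add: u_def)
  have "axis i \<i> \<noteq> (0 :: complex ^ 'n)" by simp
  then have "negligible {a :: complex ^ 'n. axis i \<i> \<bullet> a = 0}" by (intro negligible_hyperplane) auto
  moreover have "S \<subseteq> {a. axis i \<i> \<bullet> a = 0}" by (auto simp: S_def inner_axis' inner_complex_def)
  ultimately have negS: "negligible S" by (rule negligible_subset)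
  have rlin: "r b - r a = r (b - a)" for a b by (simp add: r_def vec_eq_iff)
  have rle: "norm (r a) \<le> norm a" for a by (rule norm_le_componentwise_cart) (simp add: r_def)
  have "negligible (F ` S)"
  proof (rule negligible_locally_Lipschitz_image[OF _ negS])
    fix a assume a: "a \<in> S"
    define t where "t = Re (a $ i)"
    have t: "t \<in> T" using a by (simp add: S_def t_def)
    obtain d B where dB: "d > 0" "B \<ge> 0" "\<And>s. s \<in> T \<Longrightarrow> \<bar>s - t\<bar> < d \<Longrightarrow> norm (x s - x t) \<le> B * \<bar>s - t\<bar>"
      using lip[OF t] by blast
    define B' where "B' = (2 / norm (x t)) * B"
    have B'0: "B' \<ge> 0" using dB(2) by (simp add: B'_def)
    show "\<exists>T B. open T \<and> a \<in> T \<and> (\<forall>y\<in>S \<inter> T. norm (F y - F a) \<le> B * norm (y - a))"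
    proof (intro exI conjI ballI)
      show "open (ball a d)" "a \<in> ball a d" using dB(1) by auto
      fix b assume b: "b \<in> S \<inter> ball a d"
      define s where "s = Re (b $ i)"
      have s: "s \<in> T" using b by (simp add: S_def s_def)
      have st: "\<bar>s - t\<bar> \<le> norm (b - a)"
      proof -
        have "\<bar>s - t\<bar> = \<bar>Re ((b - a) $ i)\<bar>" by (simp add: s_def t_def)
        also have "\<dots> \<le> norm ((b - a) $ i)" by (rule abs_Re_le_cmod)
        also have "\<dots> \<le> norm (b - a)" by (rule Finite_Cartesian_Product.norm_nth_le)
        finally show ?thesis .
      qed
      then have "\<bar>s - t\<bar> < d" using b by (simp add: dist_norm norm_minus_commute)
      then have "norm (x s - x t) \<le> B * \<bar>s - t\<bar>" using dB(3) s by blast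
      then have "(2 / norm (x t)) * norm (x s - x t) \<le> (2 / norm (x t)) * (B * \<bar>s - t\<bar>)"
        by (rule mult_left_mono) simp
      then have "norm (u s - u t) \<le> (2 / norm (x t)) * (B * \<bar>s - t\<bar>)"
        unfolding u_def using normalize_lipschitz[OF x0[OF s] x0[OF t]] by linarith
      also have "\<dots> \<le> B' * norm (b - a)"
        using st dB(2) by (simp add: B'_def mult_left_mono divide_right_mono)
      finally have us: "norm (u s - u t) \<le> B' * norm (b - a)" .
      have "F b - F a = r (b - a) - cdot (u s) (r (b - a)) *s u s - cdot (u s - u t) (r a) *s u s - cdot (u t) (r a) *s (u s - u t)"
        unfolding rlin[symmetric] F_def s_def[symmetric] t_def[symmetric]
        by (simp add: cdot_algebra vec_eq_iff algebra_simps)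
      also have "norm \<dots> \<le> norm (r (b - a)) + norm (cdot (u s) (r (b - a)) *s u s)
          + norm (cdot (u s - u t) (r a) *s u s) + norm (cdot (u t) (r a) *s (u s - u t))"
        by (meson add_mono norm_triangle_ineq4 order_refl order_trans)
      also have "\<dots> \<le> norm (b - a) + norm (b - a) + norm (u s - u t) * norm (r a) + norm (r a) * norm (u s - u t)"
        unfolding norm_scale nu[OF s]
        using rle[of "b - a"] cmod_cdot_le[of "u s" "r (b - a)"] cmod_cdot_le[of "u s - u t" "r a"]
          cmod_cdot_le[of "u t" "r a"] nu[OF s] nu[OF t]
        by (intro add_mono mult_right_mono) auto
      also have "\<dots> \<le> (2 + 2 * norm (r a) * B') * norm (b - a)"
        using mult_left_mono[OF us, of "norm (r a)"] by (simp add: algebra_simps)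
      finally show "norm (F b - F a) \<le> (2 + 2 * norm (r a) * B') * norm (b - a)" .
    qed
  qed simp
  moreover have "{v. \<exists>t\<in>T. cdot (x t) v = 0} \<subseteq> F ` S"
  proof safe
    fix v t assume t: "t \<in> T" "cdot (x t) v = 0"
    have ui: "u t $ i \<noteq> 0" using nz[OF t(1)] x0[OF t(1)] by (simp add: u_def)
    have uv: "cdot (u t) v = 0" using t(2) by (simp add: u_def cdot_scaleR_left)
    \<comment> \<open>This multiple of \<open>u t\<close> makes the \<open>i\<close>-th coordinate
      vanish and so frees it for \<open>t\<close>; \<open>F\<close> removes the multiple
      again.\<close>
    define c where "c = - (v $ i) / u t $ i"
    define a where "a = (\<chi> j. if j = i then complex_of_real t else (v + c *s u t) $ j)"
    have ra: "r a = v + c *s u t" using ui by (simp add: r_def a_def vec_eq_iff c_def)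
    have ai: "a $ i = complex_of_real t" by (simp add: a_def)
    have "F a = v"
      unfolding F_def ra ai using uv nu[OF t(1)] by (simp add: cdot_algebra cdot_self)
    moreover have "a \<in> S" using t(1) by (simp add: S_def ai)
    ultimately show "v \<in> F ` S" by force
  qed
  ultimately show ?thesis by (rule negligible_subset)
qed

lemma negligible_orthogonal: "e \<noteq> 0 \<Longrightarrow> negligible {v. cdot e v = 0}"
  by (rule negligible_subset[OF negligible_hyperplane[of e 0]]) (auto simp: inner_eq_Re_cdot)

text \<open>The excluded vectors form a null set: finitely many complex hyperplanes, and for each
  chart and each \<open>i\<close> the vectors orthogonal to some nonzero projection of the
  \<open>i\<close>-th axis vector to a regular eigenspace. Eigenspaces are nonzero, so each receives
  a nonzero projection of some axis vector; \<open>e1\<close> and \<open>e2\<close> handle the two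
  directions outside the charts.\<close>

lemma generic_vector:
  fixes A :: "complex ^ 'n ^ 'n"
  assumes fin: "finite Ef" and nz: "0 \<notin> Ef"
  obtains v where "\<And>e. e \<in> Ef \<Longrightarrow> cdot e v \<noteq> 0"
    "\<And>w. norm w = 1 \<Longrightarrow> eig_lsc A w \<Longrightarrow> \<exists>x\<in>eig A w. cdot x v \<noteq> 0"
proof -
  define x where "x c i t = proj (eig A (chart c t)) (axis i 1)" for c t and i :: 'n
  define T where "T c i = {t. eig_lsc A (chart c t) \<and> x c i t \<noteq> 0}" for c i
  \<comment> \<open>The pairing of an orthogonal projection with the projected vector is its squared
    norm, so this coordinate vanishes only with the whole projection.\<close>
  have xi: "x c i t $ i = complex_of_real ((norm (x c i t))\<^sup>2)" for c t and i :: 'n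
  proof -
    let ?E = "eig A (chart c t)" and ?e = "axis i 1 :: complex ^ 'n"
    have "cdot (x c i t) (?e - x c i t) = 0" unfolding x_def by (rule proj(2)[OF csubspace_eig proj(1)[OF csubspace_eig]])
    then have "cdot (x c i t) ?e = complex_of_real ((norm (x c i t))\<^sup>2)" by (simp add: cdot_diff_right cdot_self)
    then have "cnj (cdot ?e (x c i t)) = complex_of_real ((norm (x c i t))\<^sup>2)" unfolding cnj_cdot .
    then have "cnj (x c i t $ i) = complex_of_real ((norm (x c i t))\<^sup>2)" unfolding cdot_axis .
    then show ?thesis by (metis complex_cnj_cnj complex_cnj_complex_of_real)
  qed
  have neg: "negligible {v. \<exists>t\<in>T c i. cdot (x c i t) v = 0}" if c: "\<bar>c\<bar> = 1" for c i
  proof (rule negligible_orthogonal_curve)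
    fix t assume t: "t \<in> T c i"
    then show "x c i t $ i \<noteq> 0" by (simp add: xi T_def)
    obtain d B where dB: "d > 0" "B \<ge> 0" "\<And>w. dist w (chart c t) < d \<Longrightarrow>
        norm (proj (eig A w) (axis i 1) - x c i t) \<le> B * norm (w - chart c t)"
      using proj_eig_lipschitz[of A "chart c t" "axis i 1"] t unfolding T_def x_def by blast
    have ch: "norm (chart c s - chart c t) = \<bar>s - t\<bar>" for s
    proof -
      have "chart c s - chart c t = complex_of_real (c * (s - t)) * \<i>" by (simp add: chart_def complex_eq_iff algebra_simps)
      then show ?thesis using c by (simp add: norm_mult abs_mult del: of_real_mult)
    qed
    show "\<exists>d>0. \<exists>B\<ge>0. \<forall>s\<in>T c i. \<bar>s - t\<bar> < d \<longrightarrow> norm (x c i s - x c i t) \<le> B * \<bar>s - t\<bar>"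
      using dB(1,2) dB(3)[of "chart c _"] unfolding dist_norm ch x_def by blast
  qed
  obtain e1 where e1: "e1 \<in> eig A \<i>" "norm e1 = 1" by (rule eig_unit_exists)
  obtain e2 where e2: "e2 \<in> eig A (- \<i>)" "norm e2 = 1" by (rule eig_unit_exists)
  define Bad where "Bad = (\<Union>e\<in>Ef \<union> {e1, e2}. {v. cdot e v = 0}) \<union> (\<Union>c\<in>{1, -1}. \<Union>i\<in>UNIV. {v. \<exists>t\<in>T c i. cdot (x c i t) v = 0})"
  have "negligible Bad"
    unfolding Bad_def
  proof (intro negligible_Un negligible_Union finite_imageI)
    fix S assume "S \<in> (\<lambda>e. {v. cdot e v = 0}) ` (Ef \<union> {e1, e2})"
    then show "negligible S" using nz e1 e2 by (auto intro!: negligible_orthogonal)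
  next
    fix S assume "S \<in> (\<lambda>c. \<Union>i\<in>UNIV. {v. \<exists>t\<in>T c i. cdot (x c i t) v = 0}) ` {1, -1}"
    then obtain c :: real where S: "S = (\<Union>i\<in>UNIV. {v. \<exists>t\<in>T c i. cdot (x c i t) v = 0})" and "c \<in> {1, -1}"
      by (rule imageE)
    then have c: "\<bar>c\<bar> = 1" by auto
    show "negligible S"
      unfolding S by (rule negligible_Union) (use neg[OF c] in auto)
  qed (use fin in auto)
  then have "Bad \<noteq> UNIV" using non_negligible_UNIV by metis
  then obtain v where v: "v \<notin> Bad" by blast
  show ?thesis
  proof (rule that)
    show "cdot e v \<noteq> 0" if "e \<in> Ef" for e using v that by (auto simp: Bad_def)
    fix w assume w: "norm w = 1" "eig_lsc A w"
    show "\<exists>x\<in>eig A w. cdot x v \<noteq> 0"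
    proof (cases "Re w = 0")
      case True
      then have "\<bar>Im w\<bar> = 1" using w(1) by (simp add: cmod_def)
      then have "w = \<i> \<or> w = - \<i>" using True by (auto simp: complex_eq_iff abs_if split: if_splits)
      then show ?thesis using e1 e2 v by (auto simp: Bad_def)
    next
      case re: False
      define c where "c = sgn (Re w)"
      define t where "t = Im w / Re w"
      have wc: "w = \<bar>Re w\<bar> *\<^sub>R chart c t"
        using re by (auto simp: chart_def c_def t_def complex_eq_iff sgn_if)
      have eigw: "eig A w = eig A (chart c t)" using eig_homogeneous[of "\<bar>Re w\<bar>" A "chart c t"] re wc by auto
      have "chart c t = (1 / \<bar>Re w\<bar>) *\<^sub>R w" by (subst wc) (use re in simp)
      then have lsc: "eig_lsc A (chart c t)" using eig_lsc_homogeneous[of "1 / \<bar>Re w\<bar>" A w] w(2) re by auto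
      obtain y where y: "y \<in> eig A (chart c t)" "norm y = 1" by (rule eig_unit_exists)
      then obtain i where i: "y $ i \<noteq> 0" by (metis norm_zero vec_eq_iff zero_index zero_neq_one)
      have "x c i t \<noteq> 0"
      proof
        assume "x c i t = 0"
        then have "cdot y (axis i 1) = 0" using proj(2)[OF csubspace_eig y(1), of "axis i 1"] by (simp add: x_def)
        then have "cdot (axis i 1) y = 0" using cnj_cdot[of y "axis i 1"] by simp
        then show False using i by (simp add: cdot_axis)
      qed
      then have "t \<in> T c i" using lsc by (simp add: T_def)
      moreover have "c \<in> {1, -1}" using re by (simp add: c_def sgn_if)
      ultimately have "cdot (x c i t) v \<noteq> 0" using v unfolding Bad_def by blast
      moreover have "x c i t \<in> eig A w" unfolding eigw x_def by (rule proj(1)[OF csubspace_eig])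
      ultimately show ?thesis by blast
    qed
  qed
qed

section \<open>Functionals that do not vanish on a fibre\<close>

definition nonorth :: "complex ^ 'n ^ 'n \<Rightarrow> complex ^ 'n \<Rightarrow> complex \<Rightarrow> bool" where
  "nonorth A v z \<longleftrightarrow> (\<exists>x\<in>inv_fov_map A z. cdot v x \<noteq> 0)"

lemma nonorth_combination:
  assumes "nonorth A v z1" "z2 \<in> numerical_range A" "0 \<le> t" "t < 1"
  shows "nonorth A v ((1 - t) *\<^sub>R z1 + t *\<^sub>R z2)"
proof -
  obtain x where x: "x \<in> inv_fov_map A z1" "cdot v x \<noteq> 0" using assms(1) by (auto simp: nonorth_def)
  obtain y where y: "y \<in> inv_fov_map A z2" using assms(2) by (auto simp: numerical_range_iff)
  obtain p where p: "p \<in> inv_fov_map A ((1 - t) *\<^sub>R z1 + t *\<^sub>R z2)"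
    "(cmod (cdot v p))\<^sup>2 \<ge> (1 - t) * (cmod (cdot v x))\<^sup>2 + t * (cmod (cdot v y))\<^sup>2"
    using convex_combination_value[OF x(1) y assms(3)] assms(4) less_imp_le by metis
  have "(1 - t) * (cmod (cdot v x))\<^sup>2 > 0" "t * (cmod (cdot v y))\<^sup>2 \<ge> 0" using x assms by auto
  then have "cdot v p \<noteq> 0" using p(2) by auto
  then show ?thesis using p(1) by (auto simp: nonorth_def)
qed

text \<open>The points whose fibre is not orthogonal to \<open>v\<close> form a convex set, so
  extreme points suffice. At an extreme point with a regular supporting direction the face is a
  single point, hence the eigenvector from \<open>reg\<close>, normalised, lies over it; the other
  extreme points are exceptional.\<close>

lemma nonorth_everywhere:
  assumes int: "interior (numerical_range A) \<noteq> {}"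
    and ex: "\<And>z. z \<in> exceptional_points A \<Longrightarrow> nonorth A v z"
    and reg: "\<And>w. norm w = 1 \<Longrightarrow> eig_lsc A w \<Longrightarrow> \<exists>x\<in>eig A w. cdot x v \<noteq> 0"
    and z: "z \<in> numerical_range A"
  shows "nonorth A v z"
proof -
  let ?S = "{z \<in> numerical_range A. nonorth A v z}"
  have "{z. z extreme_point_of numerical_range A} \<subseteq> ?S"
  proof safe
    fix z assume z: "z extreme_point_of numerical_range A"
    show zN: "z \<in> numerical_range A" using z by (simp add: extreme_point_of_def)
    obtain w where w: "norm w = 1" "supports w (numerical_range A) z"
      using supports_exists[OF convex_numerical_range zN extreme_point_not_in_interior[OF z] int] by blast
    show "nonorth A v z"
    proof (cases "eig_lsc A w")
      case True
      obtain x where x: "x \<in> eig A w" "cdot x v \<noteq> 0" using reg[OF w(1) True] by blast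
      have x0: "x \<noteq> 0" using x(2) by auto
      define x' where "x' = complex_of_real (1 / norm x) *s x"
      have x': "x' \<in> eig A w" "norm x' = 1" using x x0 by (auto simp: x'_def eig_scale norm_scale norm_divide)
      have "fov_map A x' = z" using regular_face_singleton[OF True w(1) eig_unit_supports[OF x'] w(2)] .
      moreover have "cdot v x' \<noteq> 0" using x x0 cnj_cdot[of x v] by (auto simp: x'_def cdot_scale_right)
      ultimately show ?thesis using x' by (auto simp: nonorth_def inv_fov_map_iff)
    next
      case False
      then show ?thesis using ex z w by (auto simp: exceptional_points_def)
    qed
  qed
  moreover have "convex ?S"
  proof (rule convexI)
    fix x y and u t :: real assume *: "x \<in> ?S" "y \<in> ?S" "0 \<le> u" "0 \<le> t" "u + t = 1"
    have u: "u = 1 - t" using * by simp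
    have "u *\<^sub>R x + t *\<^sub>R y \<in> numerical_range A" using * convexD[OF convex_numerical_range] by blast
    moreover have "nonorth A v (u *\<^sub>R x + t *\<^sub>R y)"
      using nonorth_combination[of A v x y t] * u by (cases "t = 1") auto
    ultimately show "u *\<^sub>R x + t *\<^sub>R y \<in> ?S" by simp
  qed
  ultimately have "convex hull {z. z extreme_point_of numerical_range A} \<subseteq> ?S" by (rule hull_minimal)
  then show ?thesis using z Krein_Milman_Minkowski[OF compact_numerical_range convex_numerical_range, of A] by auto
qed

section \<open>Maximisers of a linear functional on the fibres\<close>

definition is_max :: "complex ^ 'n ^ 'n \<Rightarrow> complex ^ 'n \<Rightarrow> complex \<Rightarrow> complex ^ 'n \<Rightarrow> bool" where
  "is_max A v z x \<longleftrightarrow> x \<in> inv_fov_map A z \<and> (\<forall>x'\<in>inv_fov_map A z. cmod (cdot v x') \<le> cmod (cdot v x))"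

definition unique_max :: "complex ^ 'n ^ 'n \<Rightarrow> complex ^ 'n \<Rightarrow> complex \<Rightarrow> bool" where
  "unique_max A v z \<longleftrightarrow> (\<forall>x x'. is_max A v z x \<longrightarrow> is_max A v z x' \<longrightarrow> (\<exists>c. cmod c = 1 \<and> x' = c *s x))"

lemma is_max_exists:
  assumes "z \<in> numerical_range A"
  obtains x where "is_max A v z x"
proof -
  have "continuous_on (inv_fov_map A z) (\<lambda>x. cmod (cdot v x))"
    by (intro continuous_on_norm continuous_on_cdot continuous_on_const continuous_on_id)
  then obtain x where "x \<in> inv_fov_map A z" "\<forall>x'\<in>inv_fov_map A z. cmod (cdot v x') \<le> cmod (cdot v x)"
    using continuous_attains_sup[OF compact_inv_fov_map[of A z]] inv_fov_map_nonempty[OF assms] by blast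
  then show ?thesis using that by (simp add: is_max_def)
qed

lemma phase_positive:
  assumes "cdot v x \<noteq> 0"
  obtains c where "cmod c = 1" "cdot v (c *s x) = complex_of_real (cmod (cdot v x))"
proof
  show "cmod (cnj (cdot v x) / cmod (cdot v x)) = 1" using assms by (simp add: norm_divide)
  show "cdot v ((cnj (cdot v x) / cmod (cdot v x)) *s x) = complex_of_real (cmod (cdot v x))"
    using assms by (simp add: cdot_scale_right complex_norm_square[symmetric] mult.commute[of "cnj _"] power2_eq_square)
qed

text \<open>For two maximisers \<open>x1\<close>, \<open>x2\<close> with the same positive value of the functional, \<open>x1 - x2\<close> is
  annihilated by it, while \<open>x1 + x2\<close> is better than both. Hence the squared maximum, a
  concave function, decays linearly from \<open>z\<close> to zero at the value of \<open>x1 - x2\<close>.\<close>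

lemma nonunique_max_decay:
  assumes m1: "is_max A v z x1" and m2: "is_max A v z x2" and nz: "cdot v x1 \<noteq> 0"
    and ne: "\<nexists>c. cmod c = 1 \<and> x2 = c *s x1"
  obtains \<zeta> where "\<zeta> \<in> numerical_range A"
    "\<And>s p. 0 \<le> s \<Longrightarrow> s \<le> 1 \<Longrightarrow> p \<in> inv_fov_map A (z + s *\<^sub>R (\<zeta> - z)) \<Longrightarrow>
       (cmod (cdot v p))\<^sup>2 \<le> (1 - s) * (cmod (cdot v x1))\<^sup>2"
proof -
  define \<mu> where "\<mu> = cmod (cdot v x1)"
  have \<mu>: "\<mu> > 0" using nz by (simp add: \<mu>_def)
  have \<mu>2: "cmod (cdot v x2) = \<mu>" using m1 m2 by (auto simp: is_max_def \<mu>_def intro!: antisym)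
  then have nz2: "cdot v x2 \<noteq> 0" using \<mu> by auto
  obtain c1 where c1: "cmod c1 = 1" "cdot v (c1 *s x1) = complex_of_real \<mu>"
    using phase_positive[OF nz] unfolding \<mu>_def by blast
  obtain c2 where c2: "cmod c2 = 1" "cdot v (c2 *s x2) = complex_of_real \<mu>"
    using phase_positive[OF nz2] unfolding \<mu>2 by blast
  define y1 where "y1 = c1 *s x1"
  define y2 where "y2 = c2 *s x2"
  have y: "y1 \<in> inv_fov_map A z" "y2 \<in> inv_fov_map A z"
    using m1 m2 c1(1) c2(1) by (auto simp: y1_def y2_def is_max_def inv_fov_map_scale)
  have "y1 \<noteq> y2"
  proof
    assume "y1 = y2"
    moreover have "c2 \<noteq> 0" using c2(1) by auto
    ultimately have "x2 = (c1 / c2) *s x1" by (simp add: y1_def y2_def vec_eq_iff field_simps)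
    moreover have "cmod (c1 / c2) = 1" using c1 c2 by (simp add: norm_divide)
    ultimately show False using ne by blast
  qed
  define nS where "nS = (norm (y1 + y2))\<^sup>2"
  define nD where "nD = (norm (y1 - y2))\<^sup>2"
  have vS: "cdot v (y1 + y2) = complex_of_real (2 * \<mu>)" and vD: "cdot v (y1 - y2) = 0"
    using c1 c2 by (simp_all add: y1_def y2_def cdot_algebra)
  have S0: "y1 + y2 \<noteq> 0" using vS \<mu> by (metis cdot_zero_right less_irrefl mult_pos_pos of_real_eq_0_iff zero_less_numeral)
  have pos: "nS > 0" "nD > 0" using S0 \<open>y1 \<noteq> y2\<close> by (simp_all add: nS_def nD_def)
  have sum4: "nS + nD = 4" using y unfolding nS_def nD_def norm_add_cdot norm_diff_cdot by (simp add: inv_fov_map_iff)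
  obtain zm where zm: "zm \<in> numerical_range A" "fov_map A (y1 + y2) = zm * complex_of_real nS"
    unfolding nS_def by (rule fov_map_scaled_mem)
  obtain \<zeta> where \<zeta>: "\<zeta> \<in> numerical_range A" "fov_map A (y1 - y2) = \<zeta> * complex_of_real nD"
    unfolding nD_def by (rule fov_map_scaled_mem)
  have "fov_map A (y1 + y2) + fov_map A (y1 - y2) = 2 * fov_map A y1 + 2 * fov_map A y2"
    by (simp add: fov_map_def matrix_vector_right_distrib matrix_vector_mult_diff_distrib cdot_algebra)
  then have "zm * complex_of_real nS + \<zeta> * complex_of_real nD = 4 * z"
    using zm \<zeta> y by (simp add: inv_fov_map_iff)
  then have "nS *\<^sub>R zm + nD *\<^sub>R \<zeta> = (nS + nD) *\<^sub>R z" unfolding sum4 by (simp add: scaleR_conv_of_real mult.commute)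
  then have "nS *\<^sub>R (zm - z) = (- nD) *\<^sub>R (\<zeta> - z)" by (simp add: algebra_simps)
  then have "(1 / nS) *\<^sub>R (nS *\<^sub>R (zm - z)) = (1 / nS) *\<^sub>R ((- nD) *\<^sub>R (\<zeta> - z))" by (rule arg_cong)
  then have "zm - z = - ((nD / nS) *\<^sub>R (\<zeta> - z))" using pos by simp
  then have zmz: "zm = z - (nD / nS) *\<^sub>R (\<zeta> - z)" by (simp add: diff_eq_eq)
  define m where "m = complex_of_real (1 / norm (y1 + y2)) *s (y1 + y2)"
  have m: "m \<in> inv_fov_map A zm" unfolding m_def by (rule normalize_mem) (use zm S0 in \<open>simp_all add: nS_def\<close>)
  have vm: "(cmod (cdot v m))\<^sup>2 = 4 * \<mu>\<^sup>2 / nS"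
    unfolding m_def cdot_scale_right vS using \<mu>
    by (simp add: norm_mult norm_divide power_mult_distrib power_divide nS_def)
  define r where "r = nD / nS"
  have r: "r > 0" using pos by (simp add: r_def)
  have vm': "(cmod (cdot v m))\<^sup>2 = (1 + r) * \<mu>\<^sup>2"
    using pos unfolding vm sum4[symmetric] r_def by (simp add: field_simps)
  show ?thesis
  proof (rule that[OF \<zeta>(1)])
    fix s and p assume s: "0 \<le> s" "s \<le> 1" and p: "p \<in> inv_fov_map A (z + s *\<^sub>R (\<zeta> - z))"
    show "(cmod (cdot v p))\<^sup>2 \<le> (1 - s) * (cmod (cdot v x1))\<^sup>2"
    proof (rule ccontr)
      assume "\<not> ?thesis"
      then have gt: "(cmod (cdot v p))\<^sup>2 > (1 - s) * \<mu>\<^sup>2" by (simp add: \<mu>_def)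
      \<comment> \<open>On the line from \<open>z\<close> towards \<open>\<zeta>\<close>,
        \<open>zm\<close> has parameter \<open>-r\<close> and the point under \<open>p\<close> has
        parameter \<open>s\<close>; with these weights they average to \<open>z\<close>. Too large a
        value at \<open>p\<close> would let concavity beat the maximum at \<open>z\<close>.\<close>
      define t where "t = r / (s + r)"
      have t: "0 < t" "t \<le> 1" using s r by (simp_all add: t_def)
      have t1: "1 - t = s / (s + r)" using s r by (simp add: t_def field_simps)
      obtain q where q: "q \<in> inv_fov_map A ((1 - t) *\<^sub>R zm + t *\<^sub>R (z + s *\<^sub>R (\<zeta> - z)))"
        "(cmod (cdot v q))\<^sup>2 \<ge> (1 - t) * (cmod (cdot v m))\<^sup>2 + t * (cmod (cdot v p))\<^sup>2"
        using convex_combination_value[OF m p less_imp_le[OF t(1)] t(2)] by blast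
      have "(1 - t) *\<^sub>R zm + t *\<^sub>R (z + s *\<^sub>R (\<zeta> - z)) = z + (t * s - (1 - t) * r) *\<^sub>R (\<zeta> - z)"
        unfolding zmz r_def[symmetric] by (simp add: algebra_simps)
      also have "t * s - (1 - t) * r = 0" unfolding t1 by (simp add: t_def mult.commute)
      finally have "q \<in> inv_fov_map A z" using q(1) by simp
      then have "cmod (cdot v q) \<le> \<mu>" using m1 by (simp add: is_max_def \<mu>_def)
      then have "(cmod (cdot v q))\<^sup>2 \<le> \<mu>\<^sup>2" by (simp add: power_mono)
      moreover have "t * (cmod (cdot v p))\<^sup>2 > t * ((1 - s) * \<mu>\<^sup>2)" using gt t by simp
      moreover have "(1 - t) * ((1 + r) * \<mu>\<^sup>2) + t * ((1 - s) * \<mu>\<^sup>2) = \<mu>\<^sup>2"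
      proof -
        have "(1 - t) * (1 + r) + t * (1 - s) = 1"
        proof -
          have "(1 - t) * (1 + r) + t * (1 - s) = (s * (1 + r) + r * (1 - s)) / (s + r)"
            unfolding t1 by (simp only: t_def times_divide_eq_left add_divide_distrib)
          also have "s * (1 + r) + r * (1 - s) = s + r" by (simp add: algebra_simps)
          finally show ?thesis using s r by simp
        qed
        then show ?thesis by (metis distrib_right mult.assoc mult_1)
      qed
      ultimately show False using q(2) unfolding vm' by linarith
    qed
  qed
qed

text \<open>Otherwise \<open>nonunique_max_decay\<close> at \<open>s = 1\<close> gives a point over
  which the functional vanishes on the whole fibre.\<close>

lemma nonorth_unique_max:
  assumes all: "\<And>\<zeta>. \<zeta> \<in> numerical_range A \<Longrightarrow> nonorth A v \<zeta>" and z: "z \<in> numerical_range A"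
  shows "unique_max A v z"
  unfolding unique_max_def
proof (intro allI impI, rule ccontr)
  fix x x' assume m: "is_max A v z x" "is_max A v z x'" and ne: "\<nexists>c. cmod c = 1 \<and> x' = c *s x"
  obtain x0 where "x0 \<in> inv_fov_map A z" "cdot v x0 \<noteq> 0" using all[OF z] by (auto simp: nonorth_def)
  then have nz: "cdot v x \<noteq> 0" using m(1) by (auto simp: is_max_def)
  obtain \<zeta> where \<zeta>: "\<zeta> \<in> numerical_range A"
    "\<And>s p. 0 \<le> s \<Longrightarrow> s \<le> 1 \<Longrightarrow> p \<in> inv_fov_map A (z + s *\<^sub>R (\<zeta> - z)) \<Longrightarrow>
       (cmod (cdot v p))\<^sup>2 \<le> (1 - s) * (cmod (cdot v x))\<^sup>2"
    using nonunique_max_decay[OF m nz ne] by metis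
  obtain p where "p \<in> inv_fov_map A \<zeta>" "cdot v p \<noteq> 0" using all[OF \<zeta>(1)] by (auto simp: nonorth_def)
  then show False using \<zeta>(2)[of 1 p] by simp
qed

text \<open>The region strictly below the squared values is convex by
  \<open>convex_combination_value\<close>, and \<open>(q, \<beta>)\<close> lies outside it. A
  separating plane is not vertical because \<open>q\<close> is interior; normalised and made
  homogeneous in \<open>x\<close>, it becomes the majorant.\<close>

lemma supporting_plane:
  assumes q: "q \<in> interior (numerical_range A)"
    and \<beta>: "\<And>p. p \<in> inv_fov_map A q \<Longrightarrow> (cmod (cdot v p))\<^sup>2 \<le> \<beta>"
  obtains \<alpha> c where "\<And>x. (cmod (cdot v x))\<^sup>2 \<le> c * (norm x)\<^sup>2 - \<alpha> \<bullet> fov_map A x" "c - \<alpha> \<bullet> q \<le> \<beta>"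
proof -
  define G where "G = {(z, s) | z s. \<exists>x\<in>inv_fov_map A z. s < (cmod (cdot v x))\<^sup>2}"
  have Gmem: "(fov_map A x, s) \<in> G" if "norm x = 1" "s < (cmod (cdot v x))\<^sup>2" for x s
    using that by (auto simp: G_def inv_fov_map_iff)
  have "convex G"
  proof (rule convexI)
    fix g1 g2 and u t :: real assume g: "g1 \<in> G" "g2 \<in> G" and ut: "0 \<le> u" "0 \<le> t" "u + t = 1"
    obtain z1 s1 x1 where g1: "g1 = (z1, s1)" "x1 \<in> inv_fov_map A z1" "s1 < (cmod (cdot v x1))\<^sup>2" using g(1) by (auto simp: G_def)
    obtain z2 s2 x2 where g2: "g2 = (z2, s2)" "x2 \<in> inv_fov_map A z2" "s2 < (cmod (cdot v x2))\<^sup>2" using g(2) by (auto simp: G_def)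
    have u: "u = 1 - t" "t \<le> 1" using ut by auto
    obtain p where p: "p \<in> inv_fov_map A ((1 - t) *\<^sub>R z1 + t *\<^sub>R z2)"
      "(cmod (cdot v p))\<^sup>2 \<ge> (1 - t) * (cmod (cdot v x1))\<^sup>2 + t * (cmod (cdot v x2))\<^sup>2"
      using convex_combination_value[OF g1(2) g2(2) ut(2) u(2)] by blast
    have "(1 - t) * s1 + t * s2 < (1 - t) * (cmod (cdot v x1))\<^sup>2 + t * (cmod (cdot v x2))\<^sup>2"
    proof (cases "t = 0")
      case False
      then have "t * s2 < t * (cmod (cdot v x2))\<^sup>2" using g2(3) ut by simp
      moreover have "(1 - t) * s1 \<le> (1 - t) * (cmod (cdot v x1))\<^sup>2" using g1(3) u by (simp add: mult_left_mono)
      ultimately show ?thesis by linarith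
    qed (use g1(3) in simp)
    then have "(1 - t) * s1 + t * s2 < (cmod (cdot v p))\<^sup>2" using p(2) by linarith
    then show "u *\<^sub>R g1 + t *\<^sub>R g2 \<in> G" using p(1) g1(1) g2(1) u(1) unfolding G_def by auto
  qed
  obtain x0 :: "complex ^ 'a" where x0: "norm x0 = 1" using vector_choose_size[of 1] by auto
  have "G \<noteq> {}" using Gmem[OF x0, of "(cmod (cdot v x0))\<^sup>2 - 1"] by auto
  moreover have "(q, \<beta>) \<notin> G" using \<beta> by (auto simp: G_def not_less)
  ultimately obtain a b where a: "a \<noteq> 0" "\<forall>x\<in>G. a \<bullet> x \<le> b" "\<forall>x\<in>{(q, \<beta>)}. a \<bullet> x \<ge> b"
    using separating_hyperplane_sets[OF \<open>convex G\<close>, of "{(q, \<beta>)}"] by auto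
  obtain \<alpha>' \<beta>' where a': "a = (\<alpha>', \<beta>')" by (cases a)
  have le: "\<alpha>' \<bullet> fov_map A x + \<beta>' * s \<le> \<alpha>' \<bullet> q + \<beta>' * \<beta>" if "norm x = 1" "s < (cmod (cdot v x))\<^sup>2" for x s
    using a(2,3) Gmem[OF that] unfolding a' by (force simp: inner_prod_def)
  have "\<beta>' \<ge> 0"
  proof (rule ccontr)
    assume neg: "\<not> \<beta>' \<ge> 0"
    define d where "d = \<alpha>' \<bullet> q + \<beta>' * \<beta> - \<alpha>' \<bullet> fov_map A x0"
    \<comment> \<open>So low that a negative \<open>\<beta>'\<close> would give
      \<open>\<beta>' * s = \<bar>d\<bar> + 1 > d\<close>; the region is unbounded below.\<close>
    define s where "s = - (\<bar>d\<bar> + 1) / \<bar>\<beta>'\<bar> "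
    have "0 < \<bar>\<beta>'\<bar>" "- (\<bar>d\<bar> + 1) < 0" using neg by auto
    then have "s < 0" unfolding s_def by (rule divide_neg_pos[rotated])
    then have "s < (cmod (cdot v x0))\<^sup>2" by (meson less_le_trans zero_le_power2)
    from le[OF x0 this] have "\<beta>' * s \<le> d" by (simp add: d_def)
    moreover have "\<beta>' * s = \<bar>d\<bar> + 1" using neg by (simp add: s_def abs_if field_simps)
    ultimately show False by linarith
  qed
  moreover have "\<beta>' \<noteq> 0"
  proof
    assume z: "\<beta>' = 0"
    then have "\<alpha>' \<noteq> 0" using a(1) a' by (auto simp: zero_prod_def)
    have "\<alpha>' \<bullet> z \<le> \<alpha>' \<bullet> q" if zF: "z \<in> numerical_range A" for z
    proof -
      obtain x where x: "norm x = 1" "fov_map A x = z" using zF unfolding numerical_range_iff inv_fov_map_iff by blast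
      then show ?thesis using le[OF x(1), of "(cmod (cdot v x))\<^sup>2 - 1"] z by simp
    qed
    then have "supports \<alpha>' (numerical_range A) q" using q interior_subset by (auto simp: supports_def)
    then show False using supports_interior_less[OF _ q \<open>\<alpha>' \<noteq> 0\<close>] by blast
  qed
  ultimately have \<beta>': "\<beta>' > 0" by simp
  define \<alpha> where "\<alpha> = (1 / \<beta>') *\<^sub>R \<alpha>'"
  define c where "c = \<alpha> \<bullet> q + \<beta>"
  have unit: "(cmod (cdot v x))\<^sup>2 \<le> c - \<alpha> \<bullet> fov_map A x" if x: "norm x = 1" for x
  proof (rule dense_le)
    fix s assume "s < (cmod (cdot v x))\<^sup>2"
    from le[OF x this] have "(\<alpha>' \<bullet> fov_map A x + \<beta>' * s) / \<beta>' \<le> (\<alpha>' \<bullet> q + \<beta>' * \<beta>) / \<beta>'"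
      using \<beta>' by (simp add: divide_right_mono)
    then show "s \<le> c - \<alpha> \<bullet> fov_map A x" using \<beta>' by (simp add: \<alpha>_def c_def add_divide_distrib)
  qed
  have "(cmod (cdot v x))\<^sup>2 \<le> c * (norm x)\<^sup>2 - \<alpha> \<bullet> fov_map A x" for x
  proof (cases "x = 0")
    case False
    define x' where "x' = complex_of_real (1 / norm x) *s x"
    have x': "norm x' = 1" using False by (simp add: x'_def norm_scale norm_divide)
    have xx: "x = complex_of_real (norm x) *s x'" using False by (simp add: x'_def vector_smult_assoc)
    have "fov_map A x = fov_map A x' * complex_of_real ((norm x)\<^sup>2)"
      by (subst xx) (simp add: fov_map_scale mult.commute)
    then have 1: "\<alpha> \<bullet> fov_map A x = (norm x)\<^sup>2 * (\<alpha> \<bullet> fov_map A x')" by (simp only: inner_times_of_real)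
    have 2: "(cmod (cdot v x))\<^sup>2 = (norm x)\<^sup>2 * (cmod (cdot v x'))\<^sup>2"
      by (subst xx) (simp add: cdot_scale_right norm_mult power_mult_distrib)
    show ?thesis unfolding 1 2 using mult_left_mono[OF unit[OF x'], of "(norm x)\<^sup>2"] by (simp add: algebra_simps)
  qed simp
  then show ?thesis using that[of c \<alpha>] by (simp add: c_def)
qed

section \<open>Local uniqueness near an exceptional point\<close>

text \<open>The tangential Hermitian part, shifted so that for extreme \<open>z\<close> it maps the
  cone over the fibre into its orthogonal complement, see \<open>tang_orthogonal\<close>.\<close>

definition tang :: "complex ^ 'n ^ 'n \<Rightarrow> complex \<Rightarrow> complex \<Rightarrow> complex ^ 'n \<Rightarrow> complex ^ 'n" where
  "tang A w z x = herm A (\<i> * w) *v x - ((\<i> * w) \<bullet> z) *\<^sub>R x"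

lemma tang_scale: "tang A w z (c *s x) = c *s tang A w z x"
  by (simp add: tang_def vector_scalar_commute scaleR_eq_scale vector_ssub_ldistrib vector_smult_assoc mult.commute)

text \<open>The concave function \<open>max |v\<^sup>* p|\<^sup>2\<close> has an affine majorant touching it at the midpoint. With the
  assumed decay, the corresponding semidefinite form vanishes at \<open>m\<close>, so \<open>m\<close> lies in its kernel; this
  determines \<open>v\<close> up to a scalar.\<close>

lemma interior_decay_obstruction:
  assumes z0: "supports w0 (numerical_range A) z0" "norm w0 = 1" and m: "m \<in> inv_fov_map A z0"
    and \<mu>: "cdot v m \<noteq> 0" and \<zeta>: "\<zeta> \<in> numerical_range A"
    and q: "(1/2) *\<^sub>R (z0 + \<zeta>) \<in> interior (numerical_range A)"
    and \<beta>: "\<And>p. p \<in> inv_fov_map A ((1/2) *\<^sub>R (z0 + \<zeta>)) \<Longrightarrow> (cmod (cdot v p))\<^sup>2 \<le> (1/2) * (cmod (cdot v m))\<^sup>2"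
  shows "\<not> nonorth A v \<zeta>"
    "\<exists>x \<sigma>. x \<in> ext_space A z0 \<and> v = x + \<sigma> *\<^sub>R tang A w0 z0 x"
proof -
  define \<mu> where "\<mu> = (cmod (cdot v m))\<^sup>2"
  have \<mu>0: "\<mu> > 0" using \<mu> by (simp add: \<mu>_def)
  obtain \<alpha> c where pl: "\<And>x. (cmod (cdot v x))\<^sup>2 \<le> c * (norm x)\<^sup>2 - \<alpha> \<bullet> fov_map A x"
    and cq: "c - \<alpha> \<bullet> ((1/2) *\<^sub>R (z0 + \<zeta>)) \<le> (1/2) * \<mu>"
    using supporting_plane[OF q \<beta>] unfolding \<mu>_def by blast
  have 1: "\<mu> \<le> c - \<alpha> \<bullet> z0" using pl[of m] m by (simp add: \<mu>_def inv_fov_map_iff)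
  have 2: "(cmod (cdot v e))\<^sup>2 \<le> c - \<alpha> \<bullet> \<zeta>" if "e \<in> inv_fov_map A \<zeta>" for e
    using pl[of e] that by (simp add: inv_fov_map_iff)
  \<comment> \<open>The majorant is at least \<open>\<mu>\<close> at \<open>z0\<close> and
    nonnegative at \<open>\<zeta>\<close>, while its two values sum to at most \<open>\<mu>\<close>;
    so they are exactly \<open>\<mu>\<close> and 0.\<close>
  have 3: "(c - \<alpha> \<bullet> z0) + (c - \<alpha> \<bullet> \<zeta>) \<le> \<mu>" using cq by (simp add: inner_add_right algebra_simps)
  show "\<not> nonorth A v \<zeta>"
  proof
    assume "nonorth A v \<zeta>"
    then obtain e where "e \<in> inv_fov_map A \<zeta>" "cdot v e \<noteq> 0" by (auto simp: nonorth_def)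
    then show False using 1 2 3 by (smt (verit) zero_less_power2 norm_eq_zero)
  qed
  obtain e where "e \<in> inv_fov_map A \<zeta>" using \<zeta> by (auto simp: numerical_range_iff)
  then have "0 \<le> c - \<alpha> \<bullet> \<zeta>" using 2[of e] by (meson order_trans zero_le_power2)
  then have c\<mu>: "c - \<alpha> \<bullet> z0 = \<mu>" using 1 3 by linarith
  let ?B = "\<lambda>x y. complex_of_real c * cdot x y - cdot x (herm A \<alpha> *v y) - cdot x v * cdot v y"
  have sq: "cdot x v * cdot v x = complex_of_real ((cmod (cdot v x))\<^sup>2)" for x
    unfolding complex_norm_square cnj_cdot by (rule mult.commute)
  have "?B u m = 0" for u
  proof (rule psd_form[where V = UNIV and B = ?B])
    show "?B x y = cnj (?B y x)" for x y by (simp add: cnj_cdot cdot_herm_left mult.commute)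
    show "0 \<le> Re (?B x x)" for x
      unfolding sq cdot_herm_self cdot_self using pl[of x] by (simp del: of_real_power)
    show "Re (?B m m) = 0"
      unfolding sq cdot_herm_self cdot_self using m c\<mu> by (simp add: inv_fov_map_iff \<mu>_def del: of_real_power)
  qed (simp_all add: cdot_algebra matrix_vector_right_distrib vector_scalar_commute algebra_simps)
  then have "cdot u (c *\<^sub>R m - herm A \<alpha> *v m) = cdot u (cdot v m *s v)" for u
    by (simp add: cdot_algebra mult.commute)
  then have key: "c *\<^sub>R m - herm A \<alpha> *v m = cdot v m *s v" by (rule eq_of_cdot)
  \<comment> \<open>\<open>\<alpha>\<close> is split into normal and tangential parts. As
    \<open>m\<close> is an eigenvector of the normal one, only \<open>tang\<close> survives besides
    a multiple of \<open>m\<close>.\<close>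
  define a where "a = w0 \<bullet> \<alpha>"
  define b where "b = (\<i> * w0) \<bullet> \<alpha>"
  have \<alpha>: "\<alpha> = a *\<^sub>R w0 + b *\<^sub>R (\<i> * w0)"
  proof -
    have "(Re w0)\<^sup>2 + (Im w0)\<^sup>2 = 1" using z0(2) by (simp add: cmod_def)
    then show ?thesis unfolding a_def b_def by (simp add: complex_eq_iff inner_complex_def) algebra
  qed
  have "m \<in> eig A w0" using eig_iff_supports[OF m] z0 by blast
  then have hw: "herm A w0 *v m = (w0 \<bullet> z0) *\<^sub>R m" using z0 by (simp add: eig_def supports_iff_lam scaleR_eq_scale)
  have "herm A \<alpha> *v m = a *\<^sub>R (herm A w0 *v m) + b *\<^sub>R (herm A (\<i> * w0) *v m)"
    unfolding \<alpha> by (rule herm_linear)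
  also have "\<dots> = (a * (w0 \<bullet> z0) + b * ((\<i> * w0) \<bullet> z0)) *\<^sub>R m + b *\<^sub>R tang A w0 z0 m"
    unfolding hw tang_def by (simp add: algebra_simps)
  also have "a * (w0 \<bullet> z0) + b * ((\<i> * w0) \<bullet> z0) = \<alpha> \<bullet> z0"
    by (simp add: \<alpha> inner_add_left)
  finally have "cdot v m *s v = (c - \<alpha> \<bullet> z0) *\<^sub>R m - b *\<^sub>R tang A w0 z0 m"
    using key by (simp add: algebra_simps)
  then have vm: "cdot v m *s v = \<mu> *\<^sub>R m - b *\<^sub>R tang A w0 z0 m" unfolding c\<mu> .
  define x where "x = (complex_of_real \<mu> / cdot v m) *s m"
  have "v = (1 / cdot v m) *s (cdot v m *s v)" using \<mu> by (simp add: vector_smult_assoc)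
  also have "\<dots> = x + (- b / \<mu>) *\<^sub>R tang A w0 z0 x"
    unfolding vm x_def tang_scale using \<mu> \<mu>0
    by (simp add: scaleR_eq_scale vec_eq_iff field_simps)
  finally have "v = x + (- b / \<mu>) *\<^sub>R tang A w0 z0 x" .
  moreover have "x \<in> ext_space A z0"
    unfolding x_def using m by (intro ext_space_scale) (simp add: ext_space_unit inv_fov_map_iff)
  ultimately show "\<exists>x \<sigma>. x \<in> ext_space A z0 \<and> v = x + \<sigma> *\<^sub>R tang A w0 z0 x" by blast
qed

text \<open>If uniqueness fails along a sequence tending to \<open>z0\<close>, the limit \<open>\<zeta>'\<close> of the points given by
  \<open>nonunique_max_decay\<close> is a point towards which the maximum decays from \<open>z0\<close>. It differs from \<open>z0\<close> because \<open>y\<close> is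
  a limit of elements of neighbouring fibres. If the midpoint of \<open>z0\<close> and \<open>\<zeta>'\<close> is interior, then
  \<open>interior_decay_obstruction\<close> applies. Otherwise \<open>z0\<close> and \<open>\<zeta>'\<close> lie on an edge; writing a point of
  the \<open>k\<close>-th segment as a convex combination of \<open>\<zeta>'\<close> and a point \<open>r k\<close> near the midpoint and using concavity
  shows that the maximum at \<open>\<zeta>'\<close> vanishes.\<close>

lemma local_uniqueness:
  assumes int: "interior (numerical_range A) \<noteq> {}"
    and y: "lsc_at A z0 y"
    and w0: "norm w0 = 1" "supports w0 (numerical_range A) z0"
    and uniq: "\<And>w. norm w = 1 \<Longrightarrow> supports w (numerical_range A) z0 \<Longrightarrow> w = w0"
    and \<Gamma>: "compact \<Gamma>" and yv: "\<And>v. v \<in> \<Gamma> \<Longrightarrow> cdot y v \<noteq> 0"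
    and far: "\<And>v. v \<in> \<Gamma> \<Longrightarrow> (\<forall>\<zeta>\<in>numerical_range A. nonorth A v \<zeta>) \<or>
       (\<nexists>x \<sigma>. x \<in> ext_space A z0 \<and> v = x + \<sigma> *\<^sub>R tang A w0 z0 x)"
    and edge: "\<And>v \<zeta>. v \<in> \<Gamma> \<Longrightarrow> supports w0 (numerical_range A) \<zeta> \<Longrightarrow> nonorth A v \<zeta>"
  obtains \<rho> where "\<rho> > 0"
    "\<And>z v. z \<in> numerical_range A \<Longrightarrow> dist z z0 < \<rho> \<Longrightarrow> v \<in> \<Gamma> \<Longrightarrow> nonorth A v z \<and> unique_max A v z"
proof (rule ccontr)
  let ?F = "numerical_range A"
  assume "\<not> thesis"
  then have neg: "\<not> (\<exists>\<rho>>0. \<forall>z\<in>?F. dist z z0 < \<rho> \<longrightarrow> (\<forall>v\<in>\<Gamma>. nonorth A v z \<and> unique_max A v z))"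
    using that by blast
  have "\<exists>z v. z \<in> ?F \<and> dist z z0 < inverse (real (Suc k)) \<and> v \<in> \<Gamma> \<and> \<not> (nonorth A v z \<and> unique_max A v z)" for k
  proof -
    have "inverse (real (Suc k)) > 0" by simp
    then show ?thesis using neg by blast
  qed
  then obtain z v where z: "\<And>k. z k \<in> ?F" "\<And>k. dist (z k) z0 < inverse (real (Suc k))"
    and v: "\<And>k. v k \<in> \<Gamma>" and bad: "\<And>k. \<not> (nonorth A (v k) (z k) \<and> unique_max A (v k) (z k))" by metis
  have zl: "z \<longlonglongrightarrow> z0"
    by (rule tendsto_dist_iff[THEN iffD2], rule tendsto_sandwich[OF _ _ tendsto_const LIMSEQ_inverse_real_of_nat])
       (use z(2) in \<open>auto intro!: always_eventually less_imp_le\<close>)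
  \<comment> \<open>Chosen for every \<open>k\<close>, with the decay claimed only where the
    functional does not vanish on the fibre; \<open>ev\<close> shows that this holds eventually
    along the subsequence.\<close>
  have "\<exists>x \<zeta>. is_max A (v k) (z k) x \<and> \<zeta> \<in> ?F \<and> (nonorth A (v k) (z k) \<longrightarrow>
    (\<forall>s p. 0 \<le> s \<longrightarrow> s \<le> 1 \<longrightarrow> p \<in> inv_fov_map A (z k + s *\<^sub>R (\<zeta> - z k)) \<longrightarrow>
       (cmod (cdot (v k) p))\<^sup>2 \<le> (1 - s) * (cmod (cdot (v k) x))\<^sup>2))" for k
  proof (cases "nonorth A (v k) (z k)")
    case True
    then obtain x x' where m: "is_max A (v k) (z k) x" "is_max A (v k) (z k) x'" "\<nexists>c. cmod c = 1 \<and> x' = c *s x"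
      using bad[of k] unfolding unique_max_def by blast
    obtain x0 where "x0 \<in> inv_fov_map A (z k)" "cdot (v k) x0 \<noteq> 0" using True by (auto simp: nonorth_def)
    then have nz: "cdot (v k) x \<noteq> 0" using m(1) by (auto simp: is_max_def)
    obtain \<zeta> where "\<zeta> \<in> ?F"
      "\<And>s p. 0 \<le> s \<Longrightarrow> s \<le> 1 \<Longrightarrow> p \<in> inv_fov_map A (z k + s *\<^sub>R (\<zeta> - z k)) \<Longrightarrow>
         (cmod (cdot (v k) p))\<^sup>2 \<le> (1 - s) * (cmod (cdot (v k) x))\<^sup>2"
      using nonunique_max_decay[OF m(1,2) nz m(3)] by metis
    then show ?thesis using m(1) by blast
  next
    case False
    then show ?thesis using is_max_exists[OF z(1)] z(1) by metis
  qed
  then obtain x \<zeta> where x: "\<And>k. is_max A (v k) (z k) (x k)" and \<zeta>: "\<And>k. \<zeta> k \<in> ?F"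
    and ap: "\<And>k s p. nonorth A (v k) (z k) \<Longrightarrow> 0 \<le> s \<Longrightarrow> s \<le> 1 \<Longrightarrow> p \<in> inv_fov_map A (z k + s *\<^sub>R (\<zeta> k - z k)) \<Longrightarrow>
       (cmod (cdot (v k) p))\<^sup>2 \<le> (1 - s) * (cmod (cdot (v k) (x k)))\<^sup>2"
    by metis
  define X where "X k = (v k, x k, \<zeta> k)" for k
  have "\<forall>k. X k \<in> \<Gamma> \<times> sphere 0 1 \<times> ?F" using v x \<zeta> by (auto simp: X_def is_max_def inv_fov_map_iff)
  moreover have "compact (\<Gamma> \<times> sphere (0 :: complex ^ 'a) 1 \<times> ?F)"
    by (intro compact_Times compact_numerical_range \<Gamma>) auto
  ultimately obtain l f where l: "l \<in> \<Gamma> \<times> sphere 0 1 \<times> ?F" "strict_mono f" "(X \<circ> f) \<longlonglongrightarrow> l"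
    unfolding compact_def by blast
  obtain v' m \<zeta>' where l': "l = (v', m, \<zeta>')" by (cases l)
  have vl: "(\<lambda>k. v (f k)) \<longlonglongrightarrow> v'" and xl: "(\<lambda>k. x (f k)) \<longlonglongrightarrow> m" and \<zeta>l: "(\<lambda>k. \<zeta> (f k)) \<longlonglongrightarrow> \<zeta>'"
    using tendsto_fst[OF l(3)] tendsto_fst[OF tendsto_snd[OF l(3)]] tendsto_snd[OF tendsto_snd[OF l(3)]]
    by (simp_all add: X_def l' o_def)
  have mem: "v' \<in> \<Gamma>" "norm m = 1" "\<zeta>' \<in> ?F" using l(1) l' by auto
  have zfl: "(\<lambda>k. z (f k)) \<longlonglongrightarrow> z0" using LIMSEQ_subseq_LIMSEQ[OF zl l(2)] by (simp add: o_def)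
  have "(\<lambda>k. fov_map A (x (f k))) \<longlonglongrightarrow> fov_map A m" by (rule tendsto_fov_map[OF xl])
  moreover have "fov_map A (x (f k)) = z (f k)" for k using x by (simp add: is_max_def inv_fov_map_iff)
  ultimately have "fov_map A m = z0" using LIMSEQ_unique zfl by simp
  then have m: "m \<in> inv_fov_map A z0" using mem by (simp add: inv_fov_map_iff)
  have z0F: "z0 \<in> ?F" using m by (auto simp: numerical_range_iff)
  obtain \<eta> where \<eta>: "\<And>k. \<eta> k \<in> inv_fov_map A (z (f k))" "\<eta> \<longlonglongrightarrow> y" using lsc_at_sequence[OF y z(1) zfl] by blast
  have v\<eta>: "(\<lambda>k. cdot (v (f k)) (\<eta> k)) \<longlonglongrightarrow> cdot v' y" by (intro tendsto_cdot vl \<eta>)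
  have v'y: "cdot v' y \<noteq> 0" using yv[OF mem(1)] cnj_cdot[of y v'] by auto
  have ev: "\<forall>\<^sub>F k in sequentially. nonorth A (v (f k)) (z (f k))"
    using tendsto_imp_eventually_ne[OF v\<eta> v'y] by (rule eventually_mono) (use \<eta>(1) in \<open>auto simp: nonorth_def\<close>)
  define \<mu> where "\<mu> = (cmod (cdot v' m))\<^sup>2"
  have \<mu>l: "(\<lambda>k. (cmod (cdot (v (f k)) (x (f k))))\<^sup>2) \<longlonglongrightarrow> \<mu>"
    unfolding \<mu>_def by (intro tendsto_power tendsto_norm tendsto_cdot vl xl)
  have "cmod (cdot v' y) \<le> cmod (cdot v' m)"
  proof (rule LIMSEQ_le)
    show "(\<lambda>k. cmod (cdot (v (f k)) (\<eta> k))) \<longlonglongrightarrow> cmod (cdot v' y)" by (rule tendsto_norm[OF v\<eta>])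
    show "(\<lambda>k. cmod (cdot (v (f k)) (x (f k)))) \<longlonglongrightarrow> cmod (cdot v' m)" by (intro tendsto_norm tendsto_cdot vl xl)
    show "\<exists>N. \<forall>n\<ge>N. cmod (cdot (v (f n)) (\<eta> n)) \<le> cmod (cdot (v (f n)) (x (f n)))"
      using x \<eta>(1) by (auto simp: is_max_def)
  qed
  then have v'm: "cdot v' m \<noteq> 0" using v'y by auto
  have limit: "(cmod (cdot v' p))\<^sup>2 \<le> (1 - s) * \<mu>"
    if s: "0 \<le> s" "s \<le> 1" and p: "lsc_at A (z0 + s *\<^sub>R (\<zeta>' - z0)) p" for s p
  proof -
    let ?q = "\<lambda>k. z (f k) + s *\<^sub>R (\<zeta> (f k) - z (f k))"
    have qF: "?q k \<in> ?F" for k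
    proof -
      have "?q k = (1 - s) *\<^sub>R z (f k) + s *\<^sub>R \<zeta> (f k)" by (simp add: algebra_simps)
      then show ?thesis using convexD[OF convex_numerical_range z(1) \<zeta>, of "1 - s" s "f k" "f k"] s by simp
    qed
    have ql: "?q \<longlonglongrightarrow> z0 + s *\<^sub>R (\<zeta>' - z0)" by (intro tendsto_intros zfl \<zeta>l)
    obtain u where u: "\<And>k. u k \<in> inv_fov_map A (?q k)" "u \<longlonglongrightarrow> p" using lsc_at_sequence[OF p qF ql] by blast
    show ?thesis
    proof (rule LIMSEQ_le)
      show "(\<lambda>k. (cmod (cdot (v (f k)) (u k)))\<^sup>2) \<longlonglongrightarrow> (cmod (cdot v' p))\<^sup>2"
        by (intro tendsto_power tendsto_norm tendsto_cdot vl u)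
      show "(\<lambda>k. (1 - s) * (cmod (cdot (v (f k)) (x (f k))))\<^sup>2) \<longlonglongrightarrow> (1 - s) * \<mu>"
        by (intro tendsto_intros \<mu>l)
      show "\<exists>N. \<forall>n\<ge>N. (cmod (cdot (v (f n)) (u n)))\<^sup>2 \<le> (1 - s) * (cmod (cdot (v (f n)) (x (f n))))\<^sup>2"
        using ev ap[OF _ s u(1)] unfolding eventually_sequentially by blast
    qed
  qed
  define q where "q = (1/2) *\<^sub>R (z0 + \<zeta>')"
  have qz: "z0 + (1/2) *\<^sub>R (\<zeta>' - z0) = q" by (simp add: q_def algebra_simps scaleR_left.add[symmetric])
  show False
  proof (cases "\<zeta>' = z0")
    case True
    then show False using limit[of 1 y] y v'y by simp
  next
    case ne: False
    show False
    proof (cases "q \<in> interior ?F")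
      case True
      have "(cmod (cdot v' p))\<^sup>2 \<le> (1/2) * (cmod (cdot v' m))\<^sup>2" if "p \<in> inv_fov_map A q" for p
        using limit[of "1/2" p] conical_lsc[OF conical_interior[OF True] that] unfolding qz \<mu>_def by simp
      from interior_decay_obstruction[OF w0(2,1) m v'm mem(3) True[unfolded q_def] this[unfolded q_def]]
      show False using far[OF mem(1)] mem(3) by blast
    next
      case False
      have qF: "q \<in> ?F" using convexD[OF convex_numerical_range z0F mem(3), of "1/2" "1/2"] by (simp add: q_def scaleR_add_right)
      obtain w where w: "norm w = 1" "supports w ?F q" using supports_exists[OF convex_numerical_range qF False int] by blast
      have lez: "w \<bullet> z0 \<le> w \<bullet> q" "w \<bullet> \<zeta>' \<le> w \<bullet> q" using w(2) z0F mem(3) by (auto simp: supports_def)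
      have "2 * (w \<bullet> q) = w \<bullet> z0 + w \<bullet> \<zeta>'" by (simp add: q_def inner_add_right)
      then have eqz: "w \<bullet> z0 = w \<bullet> q" "w \<bullet> \<zeta>' = w \<bullet> q" using lez by linarith+
      then have "supports w ?F z0" using w(2) z0F by (auto simp: supports_def)
      then have ww0: "w = w0" using uniq w(1) by blast
      have s\<zeta>: "supports w0 ?F \<zeta>'" using w(2) mem(3) eqz ww0 by (auto simp: supports_def)
      then obtain e where e: "e \<in> inv_fov_map A \<zeta>'" "cdot v' e \<noteq> 0" using edge[OF mem(1)] by (auto simp: nonorth_def)
      obtain p0 where p0: "p0 \<in> interior ?F" using int by blast
      have "w \<bullet> p0 < w \<bullet> q" using supports_interior_less[OF w(2) p0] w(1) by force
      moreover have "q \<in> open_segment z0 \<zeta>'" using ne by (auto simp: in_segment q_def scaleR_add_right intro!: exI[of _ "1/2"])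
      ultimately obtain \<rho> where \<rho>: "\<rho> > 0" "\<And>r. dist r q < \<rho> \<Longrightarrow> w \<bullet> r \<le> w \<bullet> q \<Longrightarrow> r \<in> ?F"
        using half_disc[OF convex_numerical_range _ z0F mem(3) eqz, of p0] p0 interior_subset by blast
      \<comment> \<open>Large enough that \<open>N\<close> times the squared value at
        \<open>e\<close> cannot be bounded by \<open>\<mu> / 2\<close>.\<close>
      define N where "N = real (nat \<lceil>\<mu> / (cmod (cdot v' e))\<^sup>2\<rceil>) + 1"
      have N: "N \<ge> 1" "N * (cmod (cdot v' e))\<^sup>2 > \<mu>"
      proof -
        have "\<mu> / (cmod (cdot v' e))\<^sup>2 < N" unfolding N_def by linarith
        then show "N * (cmod (cdot v' e))\<^sup>2 > \<mu>" using e(2) by (simp add: pos_divide_less_eq)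
      qed (simp add: N_def)
      \<comment> \<open>With \<open>t = 1 / (N + 1)\<close>, \<open>(1 - t) \<zeta>' + t r k\<close>
        is the point of the \<open>k\<close>-th segment at parameter \<open>1 - t / 2\<close>, where
        the squared maximum has decayed to the fraction \<open>t / 2\<close>. As \<open>r k\<close>
        tends to \<open>q\<close>, the half disc puts it into the range.\<close>
      define r where "r k = (1/2) *\<^sub>R (z (f k) + \<zeta> (f k)) + N *\<^sub>R (\<zeta> (f k) - \<zeta>')" for k
      have "r \<longlonglongrightarrow> (1/2) *\<^sub>R (z0 + \<zeta>') + N *\<^sub>R (\<zeta>' - \<zeta>')" unfolding r_def by (intro tendsto_intros zfl \<zeta>l)
      then have "r \<longlonglongrightarrow> q" by (simp add: q_def)
      then have ev2: "\<forall>\<^sub>F k in sequentially. dist (r k) q < \<rho>" using \<rho>(1) by (rule tendstoD)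
      have rF: "r k \<in> ?F" if "dist (r k) q < \<rho>" for k
      proof (rule \<rho>(2)[OF that])
        have "w \<bullet> z (f k) \<le> w \<bullet> q" "w \<bullet> \<zeta> (f k) \<le> w \<bullet> q" using w(2) z(1) \<zeta> by (auto simp: supports_def)
        moreover have "N * (w \<bullet> \<zeta> (f k) - w \<bullet> \<zeta>') \<le> 0"
          using calculation(2) eqz(2) N(1) by (simp add: mult_nonneg_nonpos)
        moreover have "w \<bullet> r k = (w \<bullet> z (f k) + w \<bullet> \<zeta> (f k)) / 2 + N * (w \<bullet> \<zeta> (f k) - w \<bullet> \<zeta>')"
          by (simp add: r_def inner_add_right inner_diff_right)
        ultimately show "w \<bullet> r k \<le> w \<bullet> q" by argo
      qed
      have step: "N * (cmod (cdot (v (f k)) e))\<^sup>2 \<le> (1/2) * (cmod (cdot (v (f k)) (x (f k))))\<^sup>2"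
        if no: "nonorth A (v (f k)) (z (f k))" and d: "dist (r k) q < \<rho>" for k
      proof -
        obtain g where g: "g \<in> inv_fov_map A (r k)" using rF[OF d] by (auto simp: numerical_range_iff)
        define t where "t = 1 / (N + 1)"
        have t: "0 \<le> t" "t \<le> 1" using N(1) by (simp_all add: t_def)
        have t1: "1 - t = N / (N + 1)" using N(1) by (simp add: t_def field_simps)
        obtain p where p: "p \<in> inv_fov_map A ((1 - t) *\<^sub>R \<zeta>' + t *\<^sub>R r k)"
          "(cmod (cdot (v (f k)) p))\<^sup>2 \<ge> (1 - t) * (cmod (cdot (v (f k)) e))\<^sup>2 + t * (cmod (cdot (v (f k)) g))\<^sup>2"
          using convex_combination_value[OF e(1) g t] by blast
        have "(1 - t) *\<^sub>R \<zeta>' + t *\<^sub>R r k = z (f k) + (1 - t / 2) *\<^sub>R (\<zeta> (f k) - z (f k))"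
        proof -
          have tN: "t * N = 1 - t" using N(1) by (simp add: t_def field_simps)
          have "t *\<^sub>R r k = (t / 2) *\<^sub>R (z (f k) + \<zeta> (f k)) + (1 - t) *\<^sub>R (\<zeta> (f k) - \<zeta>')"
            by (simp add: r_def scaleR_add_right tN)
          then have "(1 - t) *\<^sub>R \<zeta>' + t *\<^sub>R r k = (t / 2) *\<^sub>R z (f k) + (t / 2 + (1 - t)) *\<^sub>R \<zeta> (f k)"
            unfolding scaleR_add_right scaleR_diff_right scaleR_add_left by simp
          also have "t / 2 + (1 - t) = 1 - t / 2" by simp
          finally show ?thesis by (simp add: scaleR_diff_right scaleR_diff_left)
        qed
        then have "(cmod (cdot (v (f k)) p))\<^sup>2 \<le> (1 - (1 - t / 2)) * (cmod (cdot (v (f k)) (x (f k))))\<^sup>2"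
          using ap[OF no, of "1 - t / 2" p] p(1) t by simp
        moreover have "0 \<le> t * (cmod (cdot (v (f k)) g))\<^sup>2" using t by simp
        ultimately have "(1 - t) * (cmod (cdot (v (f k)) e))\<^sup>2 \<le> (t / 2) * (cmod (cdot (v (f k)) (x (f k))))\<^sup>2"
          using p(2) by simp
        moreover have "1 - t = t * N" unfolding t1 by (simp add: t_def)
        ultimately have "t * (N * (cmod (cdot (v (f k)) e))\<^sup>2) \<le> t * ((1/2) * (cmod (cdot (v (f k)) (x (f k))))\<^sup>2)"
          by simp
        moreover have "0 < t" using N(1) by (simp add: t_def)
        ultimately show ?thesis by (simp only: mult_le_cancel_left_pos)
      qed
      have "N * (cmod (cdot v' e))\<^sup>2 \<le> (1/2) * \<mu>"
      proof (rule LIMSEQ_le)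
        show "(\<lambda>k. N * (cmod (cdot (v (f k)) e))\<^sup>2) \<longlonglongrightarrow> N * (cmod (cdot v' e))\<^sup>2"
          by (intro tendsto_intros tendsto_cdot vl)
        show "(\<lambda>k. (1/2) * (cmod (cdot (v (f k)) (x (f k))))\<^sup>2) \<longlonglongrightarrow> (1/2) * \<mu>" by (intro tendsto_intros \<mu>l)
        show "\<exists>M. \<forall>k\<ge>M. N * (cmod (cdot (v (f k)) e))\<^sup>2 \<le> (1/2) * (cmod (cdot (v (f k)) (x (f k))))\<^sup>2"
          using eventually_elim2[OF ev ev2 step] unfolding eventually_sequentially .
      qed
      moreover have "0 \<le> \<mu>" by (simp add: \<mu>_def)
      ultimately show False using N(2) by linarith
    qed
  qed
qed

section \<open>Deforming the functional at an exceptional point\<close>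

lemma bounded_linear_scale: "bounded_linear (\<lambda>x :: complex ^ 'n. c *s x)"
  by (simp add: linear_conv_bounded_linear[symmetric] linear_iff vector_add_ldistrib scaleR_eq_scale vector_smult_assoc mult.commute)

lemmas continuous_on_scale = bounded_linear.continuous_on[OF bounded_linear_scale]

lemma continuous_on_tang: "continuous_on S f \<Longrightarrow> continuous_on S (\<lambda>t. tang A w z (f t))"
  unfolding tang_def by (intro continuous_on_diff continuous_on_matrix continuous_on_scaleR continuous_on_const)

lemma csubspace_ext_space: "z extreme_point_of numerical_range A \<Longrightarrow> csubspace (ext_space A z)"
  using ext_space_parallelogram[of z A] ext_space_scale[of _ A z]
  by (simp add: csubspace_def) (simp add: ext_space_def)

lemma ext_space_induct:
  assumes u: "u \<in> ext_space A z" and unit: "\<And>r. r \<in> inv_fov_map A z \<Longrightarrow> P r"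
    and scale: "\<And>c r. P r \<Longrightarrow> P (c *s r)" and zero: "P 0"
  shows "P u"
proof (cases "u = 0")
  case False
  have "P (complex_of_real (norm u) *s (complex_of_real (1 / norm u) *s u))"
    by (intro scale unit ext_space_normalize u False)
  then show ?thesis using False by (simp add: vector_smult_assoc)
qed (use zero in simp)

lemma tang_orthogonal:
  assumes "z extreme_point_of numerical_range A" "u \<in> ext_space A z" "x \<in> ext_space A z"
  shows "cdot u (tang A w z x) = 0"
  unfolding tang_def cdot_diff_right cdot_scaleR_right ext_space_herm[OF assms] by simp

text \<open>A vanishing tangential part makes \<open>u\<close> an eigenvector in the directions
  \<open>w\<close> and \<open>\<i> * w\<close>, hence reducing. As \<open>u\<close> is not
  orthogonal to the approximable \<open>y\<close>, the range would be conical at \<open>z\<close>,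
  and \<open>y'\<close> would be approximable as well.\<close>

lemma tang_nonzero:
  assumes w: "norm w = 1" "supports w (numerical_range A) z"
    and y: "lsc_at A z y" and y': "y' \<in> inv_fov_map A z" "\<not> lsc_at A z y'"
    and u: "u \<in> ext_space A z" "cdot y u \<noteq> 0"
  shows "tang A w z u \<noteq> 0"
proof
  assume 0: "tang A w z u = 0"
  have u0: "u \<noteq> 0" using u by auto
  define r where "r = complex_of_real (1 / norm u) *s u"
  have r: "r \<in> inv_fov_map A z" unfolding r_def by (rule ext_space_normalize[OF u(1) u0])
  have "tang A w z r = 0" unfolding r_def tang_scale 0 by simp
  then have 1: "herm A (\<i> * w) *v r = complex_of_real ((\<i> * w) \<bullet> z) *s r"
    by (simp add: tang_def scaleR_eq_scale)
  have "r \<in> eig A w" using eig_iff_supports[OF r] w by blast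
  then have 2: "herm A w *v r = complex_of_real (w \<bullet> z) *s r" using w by (simp add: eig_def supports_iff_lam)
  have "(Re w)\<^sup>2 + (Im w)\<^sup>2 = 1" using w(1) by (simp add: cmod_def)
  then have "Im (cnj w * (\<i> * w)) \<noteq> 0" by (simp add: power2_eq_square)
  then have "reducing A z r" by (rule reducing_two_directions[OF 2 1])
  moreover have "cdot y r \<noteq> 0" using u u0 by (simp add: r_def cdot_scale_right)
  ultimately have "conical (numerical_range A) z" using lsc_reducing_conical[OF y r] by blast
  then show False using conical_lsc y' by blast
qed

text \<open>First a multiple of \<open>\<i> *s tang A w0 z0 x\<close> is added to \<open>v\<close>, large enough to dominate the component of \<open>v\<close> orthogonal
  to the extremal space, then the component in the extremal space is rotated into the line of \<open>y\<close>.
  Imaginary multiples of the tangential vector keep away from the bad functionals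
  of \<open>interior_decay_obstruction\<close>, whose multiples are real.\<close>

lemma local_path:
  assumes int: "interior (numerical_range A) \<noteq> {}"
    and y: "lsc_at A z0 y" and y': "y' \<in> inv_fov_map A z0" "\<not> lsc_at A z0 y'"
    and gen: "\<And>\<zeta>. \<zeta> \<in> numerical_range A \<Longrightarrow> nonorth A v \<zeta>" and yv: "cdot y v \<noteq> 0"
  obtains \<gamma> :: "real \<Rightarrow> complex ^ 'n" and \<rho> where "continuous_on {0..1} \<gamma>" "\<gamma> 1 = v" "\<rho> > 0"
    "\<And>u. u \<in> inv_fov_map A z0 \<Longrightarrow> cdot u (\<gamma> 0) = cdot y v * cdot u y"
    "\<And>z \<tau>. z \<in> numerical_range A \<Longrightarrow> dist z z0 < \<rho> \<Longrightarrow> \<tau> \<in> {0..1} \<Longrightarrow> nonorth A (\<gamma> \<tau>) z \<and> unique_max A (\<gamma> \<tau>) z"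
proof -
  let ?F = "numerical_range A"
  define E where "E = ext_space A z0"
  have ex: "z0 extreme_point_of ?F" by (rule nonlsc_extreme[OF int y'])
  then have z0F: "z0 \<in> ?F" by (simp add: extreme_point_of_def)
  have "z0 \<notin> interior ?F" using conical_lsc[OF conical_interior] y' by blast
  then obtain w0 where w0: "norm w0 = 1" "supports w0 ?F z0"
    using supports_exists[OF convex_numerical_range z0F _ int] by blast
  have uniq: "w = w0" if "norm w = 1" "supports w ?F z0" for w
    using nonlsc_unique_support[OF int y' that w0] .
  have E: "csubspace E" unfolding E_def by (rule csubspace_ext_space[OF ex])
  have Es: "c *s u \<in> E" "r *\<^sub>R u \<in> E" "u - u' \<in> E" if "u \<in> E" "u' \<in> E" for c r u u'
    using that E csubspace_diff[OF E] by (auto simp: csubspace_def scaleR_eq_scale)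
  define K where "K = tang A w0 z0"
  have K: "cdot u (K u') = 0" if "u \<in> E" "u' \<in> E" for u u'
    using tang_orthogonal[OF ex] that unfolding K_def E_def by blast
  have K0: "K u \<noteq> 0" if "u \<in> E" "cdot y u \<noteq> 0" for u
    using tang_nonzero[OF w0 y y'] that unfolding K_def E_def by blast
  have yu: "y \<in> inv_fov_map A z0" by (rule lsc_at_mem[OF y])
  then have yE: "y \<in> E" and yn: "cdot y y = 1" by (simp_all add: E_def ext_space_unit inv_fov_map_iff cdot_self)
  define x where "x = proj E v"
  define \<eta> where "\<eta> = v - x"
  have xE: "x \<in> E" and \<eta>: "\<And>u. u \<in> E \<Longrightarrow> cdot u \<eta> = 0" using proj[OF E] by (simp_all add: x_def \<eta>_def)
  have v: "v = x + \<eta>" by (simp add: \<eta>_def)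
  have yx: "cdot y x = cdot y v" using \<eta>[OF yE] by (simp add: v cdot_add_right)
  \<comment> \<open>The component of \<open>x\<close> orthogonal to \<open>y\<close>.
    \<open>U t\<close> removes it gradually and keeps the pairing with \<open>y\<close>, so
    \<open>K (U t)\<close> never vanishes.\<close>
  define x' where "x' = x - cdot y x *s y"
  have x'E: "x' \<in> E" unfolding x'_def by (intro Es(3)[OF xE Es(1)[OF yE yE]] xE)
  have yx': "cdot y x' = 0" by (simp add: x'_def cdot_algebra yn)
  define U where "U t = x - t *\<^sub>R x'" for t
  have UE: "U t \<in> E" for t unfolding U_def by (intro Es(3)[OF xE Es(2)[OF x'E x'E]] xE)
  have yU: "cdot y (U t) = cdot y v" for t by (simp add: U_def cdot_algebra yx' yx)
  have contU: "continuous_on S (\<lambda>t. K (U (f t)))" if "continuous_on S f" for S and f :: "real \<Rightarrow> real"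
    unfolding K_def U_def by (intro continuous_on_tang continuous_intros that)
  have "continuous_on {0..1} (\<lambda>t. norm (K (U t)))" by (intro continuous_on_norm contU continuous_on_id)
  then obtain t0 where t0: "\<And>t. 0 \<le> t \<Longrightarrow> t \<le> 1 \<Longrightarrow> norm (K (U t0)) \<le> norm (K (U t))"
    using continuous_attains_inf[of "{0..1::real}" "\<lambda>t. norm (K (U t))"] by force
  define \<kappa> where "\<kappa> = norm (K (U t0))"
  have \<kappa>: "\<kappa> > 0" using K0[OF UE] yU yv by (simp add: \<kappa>_def)
  \<comment> \<open>The size makes \<open>\<bar>S\<bar> * \<kappa>\<close> exceed
    \<open>norm \<eta>\<close>, which excludes bad functionals on the leg \<open>a = 1\<close>. On
    the leg \<open>t = 0\<close> a bad functional would need \<open>Im (cdot (K x) \<eta>)\<close>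
    to be a negative multiple of \<open>S\<close>, which the sign of \<open>S\<close>
    excludes.\<close>
  define S where "S = (if Im (cdot (K x) \<eta>) \<ge> 0 then 1 else - 1) * ((norm \<eta> + 1) / \<kappa>)"
  have S: "\<bar>S\<bar> * \<kappa> = norm \<eta> + 1" using \<kappa> by (simp add: S_def abs_mult)
  define G where "G a t = v - t *\<^sub>R x' + a *\<^sub>R ((\<i> * S) *s K (U t))" for a t
  have Geq: "G a t = U t + (\<eta> + a *\<^sub>R ((\<i> * S) *s K (U t)))" for a t by (simp add: G_def U_def v)
  have perp: "cdot u (\<eta> + a *\<^sub>R ((\<i> * S) *s K (U t))) = 0" if "u \<in> E" for u a t
    using \<eta>[OF that] K[OF that UE] by (simp add: cdot_algebra)
  \<comment> \<open>Two legs: \<open>a\<close> runs from 0 to 1 at \<open>t = 0\<close>, then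
    \<open>t\<close> from 0 to 1 at \<open>a = 1\<close>.\<close>
  define P where "P = (\<lambda>a t. (a = 1 \<and> 0 \<le> t \<and> t \<le> (1 :: real)) \<or> (t = 0 \<and> 0 \<le> (a :: real) \<and> a \<le> (1 :: real)))"
  have yG: "cdot y (G a t) \<noteq> 0" for a t
    using perp[OF yE, of a t] yU[of t] yv by (simp add: Geq cdot_add_right)
  have far: "(\<forall>\<zeta>\<in>?F. nonorth A (G a t) \<zeta>) \<or> (\<nexists>X \<sigma>. X \<in> ext_space A z0 \<and> G a t = X + \<sigma> *\<^sub>R tang A w0 z0 X)"
    if P: "P a t" for a t
  proof (cases "a = 0")
    case True
    then have "G a t = v" using P by (simp add: P_def G_def)
    then show ?thesis using gen by simp
  next
    case False
    have "\<not> G a t = X + \<sigma> *\<^sub>R K X" if X: "X \<in> E" for X \<sigma>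
    proof
      assume eq: "G a t = X + \<sigma> *\<^sub>R K X"
      \<comment> \<open>Both sides are a vector of \<open>E\<close> plus one orthogonal to
        \<open>E\<close>; comparing the parts in \<open>E\<close> gives
        \<open>X = U t\<close>.\<close>
      have d: "U t - X \<in> E" by (rule Es(3)[OF UE X])
      have "U t - X = \<sigma> *\<^sub>R K X - (\<eta> + a *\<^sub>R ((\<i> * S) *s K (U t)))"
        using eq unfolding Geq by (simp add: algebra_simps)
      then have "cdot (U t - X) (U t - X) = cdot (U t - X) (\<sigma> *\<^sub>R K X - (\<eta> + a *\<^sub>R ((\<i> * S) *s K (U t))))" by simp
      also have "\<dots> = 0" unfolding cdot_diff_right perp[OF d] using K[OF d X] by (simp add: cdot_scaleR_right)
      finally have "U t = X" by (simp add: cdot_self)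
      then have "\<eta> = \<sigma> *\<^sub>R K (U t) - a *\<^sub>R ((\<i> * S) *s K (U t))" using eq unfolding Geq by (simp add: algebra_simps)
      then have e: "\<eta> = (complex_of_real \<sigma> - \<i> * complex_of_real (a * S)) *s K (U t)"
        by (simp add: scaleR_eq_scale vector_smult_assoc vector_sub_rdistrib mult.left_commute)
      show False
      proof (cases "a = 1")
        case True
        then have t: "0 \<le> t" "t \<le> 1" using P by (auto simp: P_def)
        have "\<bar>S\<bar> \<le> cmod (complex_of_real \<sigma> - \<i> * complex_of_real (a * S))"
          using abs_Im_le_cmod[of "complex_of_real \<sigma> - \<i> * complex_of_real (a * S)"] True by simp
        then have "\<bar>S\<bar> * \<kappa> \<le> cmod (complex_of_real \<sigma> - \<i> * complex_of_real (a * S)) * norm (K (U t))"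
          using t0[OF t] \<kappa> by (intro mult_mono) (auto simp: \<kappa>_def)
        also have "\<dots> = norm \<eta>" using arg_cong[OF e, of norm] by (simp only: norm_scale)
        finally show False using S by simp
      next
        case F: False
        then have t: "t = 0" "0 < a" using P False by (auto simp: P_def)
        have Ux: "U t = x" by (simp add: U_def t)
        have "cdot (K x) \<eta> = (complex_of_real \<sigma> - \<i> * complex_of_real (a * S)) * complex_of_real ((norm (K x))\<^sup>2)"
          by (subst e) (simp only: Ux cdot_scale_right cdot_self)
        then have im: "Im (cdot (K x) \<eta>) = - (a * (norm (K x))\<^sup>2) * S" by (simp add: mult.commute mult.left_commute)
        have "K x \<noteq> 0" using K0[OF xE] yx yv by simp
        then have pos: "a * (norm (K x))\<^sup>2 > 0" using t by simp
        have S0: "(norm \<eta> + 1) / \<kappa> > 0" using \<kappa> by (simp add: add_nonneg_pos)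
        show False
        proof (cases "Im (cdot (K x) \<eta>) \<ge> 0")
          case True
          then have "S > 0" using S0 by (simp add: S_def)
          then have "a * (norm (K x))\<^sup>2 * S > 0" using pos by simp
          then show False using True im by simp
        next
          case False
          then have "S = - 1 * ((norm \<eta> + 1) / \<kappa>)" by (simp only: S_def if_False)
          then have "S < 0" using S0 by linarith
          then have "a * (norm (K x))\<^sup>2 * S < 0" using pos by (simp add: mult_pos_neg)
          then show False using False im by simp
        qed
      qed
    qed
    then show ?thesis unfolding E_def K_def by blast
  qed
  have edge: "nonorth A (G a t) \<zeta>" if \<zeta>: "supports w0 ?F \<zeta>" for a t \<zeta>
  proof (cases "\<zeta> = z0")
    case True
    have "cdot (G a t) y \<noteq> 0" using yG[of a t] cnj_cdot[of y "G a t"] by auto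
    then show ?thesis using yu True by (auto simp: nonorth_def)
  next
    case False
    show ?thesis
    proof (rule edge_end[OF w0(1) ex w0(2) \<zeta> False])
      fix T b s assume T: "T = \<i> * w0 \<or> T = - (\<i> * w0)" and b: "supports w0 ?F b"
        and min: "\<And>\<zeta>'. supports w0 ?F \<zeta>' \<Longrightarrow> T \<bullet> z0 \<le> T \<bullet> \<zeta>' \<and> T \<bullet> \<zeta>' \<le> T \<bullet> b"
        and lt: "T \<bullet> z0 < T \<bullet> b" and s: "0 < s" "s \<le> 1" and \<zeta>s: "\<zeta> = (1 - s) *\<^sub>R z0 + s *\<^sub>R b"
      have "b \<in> ?F" using b by (simp add: supports_def)
      then obtain e where e: "e \<in> inv_fov_map A b" "cdot v e \<noteq> 0" using gen by (auto simp: nonorth_def)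
      \<comment> \<open>Vectors over the far end of the edge are orthogonal to \<open>E\<close> and
        to its image under \<open>K\<close>, so along the whole path the pairing with
        \<open>e\<close> remains that of \<open>v\<close>.\<close>
      have eu: "cdot e u = 0 \<and> cdot e (K u) = 0" if "u \<in> E" for u
      proof (rule ext_space_induct[OF that[unfolded E_def]])
        fix r assume r: "r \<in> inv_fov_map A z0"
        show "cdot e r = 0 \<and> cdot e (K r) = 0"
          using edge_orthogonal[OF w0 b T min lt r e(1)] by (simp add: K_def tang_def cdot_algebra)
      next
        fix c r assume "cdot e r = 0 \<and> cdot e (K r) = 0"
        then show "cdot e (c *s r) = 0 \<and> cdot e (K (c *s r)) = 0" by (simp add: K_def tang_scale cdot_scale_right)
      qed (simp add: K_def tang_def)
      have "cdot e (G a t) = cdot e v"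
        using eu[OF x'E] eu[OF UE] by (simp add: G_def cdot_algebra)
      then have "cdot (G a t) e \<noteq> 0" using e(2) cnj_cdot[of e "G a t"] cnj_cdot[of e v] by auto
      then have "nonorth A (G a t) b" using e(1) by (auto simp: nonorth_def)
      then have "nonorth A (G a t) ((1 - (1 - s)) *\<^sub>R b + (1 - s) *\<^sub>R z0)"
        by (rule nonorth_combination[OF _ z0F]) (use s in auto)
      then show ?thesis by (simp add: \<zeta>s add.commute)
    qed
  qed
  \<comment> \<open>The two legs traversed backwards, half of the unit interval each:
    \<open>G 0 0 = v\<close> at 1 and \<open>G 1 1\<close> at 0.\<close>
  define \<gamma> where "\<gamma> \<tau> = G (min 1 (2 * (1 - \<tau>))) (max 0 (1 - 2 * \<tau>))" for \<tau>
  have P\<gamma>: "P (min 1 (2 * (1 - \<tau>))) (max 0 (1 - 2 * \<tau>))" if "\<tau> \<in> {0..1}" for \<tau>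
    using that by (cases "\<tau> \<le> 1/2") (auto simp: P_def min_def max_def)
  have cont: "continuous_on {0..1} \<gamma>"
    unfolding \<gamma>_def G_def by (intro continuous_intros continuous_on_scale contU)
  have comp: "compact (\<gamma> ` {0..1})" by (intro compact_continuous_image cont) simp
  obtain \<rho> where \<rho>: "\<rho> > 0" "\<And>z v. z \<in> ?F \<Longrightarrow> dist z z0 < \<rho> \<Longrightarrow> v \<in> \<gamma> ` {0..1} \<Longrightarrow> nonorth A v z \<and> unique_max A v z"
  proof (rule local_uniqueness[OF int y w0 uniq comp, of thesis])
    fix v assume "v \<in> \<gamma> ` {0..1}"
    then obtain \<tau> where \<tau>: "\<tau> \<in> {0..1}" "v = \<gamma> \<tau>" by blast
    show "cdot y v \<noteq> 0" unfolding \<tau>(2) \<gamma>_def by (rule yG)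
    show "(\<forall>\<zeta>\<in>?F. nonorth A v \<zeta>) \<or> (\<nexists>x \<sigma>. x \<in> ext_space A z0 \<and> v = x + \<sigma> *\<^sub>R tang A w0 z0 x)"
      unfolding \<tau>(2) \<gamma>_def by (rule far[OF P\<gamma>[OF \<tau>(1)]])
    show "nonorth A v \<zeta>" if "supports w0 ?F \<zeta>" for \<zeta> unfolding \<tau>(2) \<gamma>_def by (rule edge[OF that])
  qed blast+
  show ?thesis
  proof (rule that[OF cont _ \<rho>(1)])
    show "\<gamma> 1 = v" by (simp add: \<gamma>_def G_def)
    show "cdot u (\<gamma> 0) = cdot y v * cdot u y" if "u \<in> inv_fov_map A z0" for u
    proof -
      have "u \<in> E" using that by (simp add: E_def ext_space_unit inv_fov_map_iff)
      then have "cdot u (\<gamma> 0) = cdot u (U 1)" using perp[of u 1 1] by (simp add: \<gamma>_def Geq cdot_add_right)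
      then show ?thesis by (simp add: U_def x'_def yx cdot_scale_right)
    qed
    show "nonorth A (\<gamma> \<tau>) z \<and> unique_max A (\<gamma> \<tau>) z" if "z \<in> ?F" "dist z z0 < \<rho>" "\<tau> \<in> {0..1}" for z \<tau>
      using \<rho>(2) that by blast
  qed
qed

section \<open>Continuous selections\<close>

text \<open>Let \<open>m\<close> be a cluster value of \<open>h\<close> at \<open>z\<close>.
  Approximability of \<open>h z\<close> carries maximality of the nearby values over to
  \<open>m\<close>, so \<open>m\<close> equals \<open>h z\<close> up to a phase, and the positive
  pairing with \<open>V z\<close> makes the phase 1.\<close>

lemma maximiser_selection:
  assumes V: "continuous_on UNIV V"
    and um: "\<And>z. z \<in> numerical_range A \<Longrightarrow> nonorth A (V z) z \<and> unique_max A (V z) z"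
    and M: "M \<subseteq> numerical_range A" and lsc: "\<And>z x. z \<in> M \<Longrightarrow> is_max A (V z) z x \<Longrightarrow> lsc_at A z x"
  obtains h where "\<And>z. z \<in> numerical_range A \<Longrightarrow> h z \<in> inv_fov_map A z" "continuous_on M h"
proof -
  let ?F = "numerical_range A"
  have "\<exists>x. is_max A (V z) z x \<and> cdot (V z) x = complex_of_real (cmod (cdot (V z) x)) \<and> cdot (V z) x \<noteq> 0"
    if z: "z \<in> ?F" for z
  proof -
    obtain x where x: "is_max A (V z) z x" using is_max_exists[OF z] by blast
    obtain x0 where "x0 \<in> inv_fov_map A z" "cdot (V z) x0 \<noteq> 0" using um[OF z] by (auto simp: nonorth_def)
    then have nz: "cdot (V z) x \<noteq> 0" using x by (auto simp: is_max_def)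
    obtain c where c: "cmod c = 1" "cdot (V z) (c *s x) = complex_of_real (cmod (cdot (V z) x))"
      using phase_positive[OF nz] by blast
    then have "cmod (cdot (V z) (c *s x)) = cmod (cdot (V z) x)" by simp
    then have "is_max A (V z) z (c *s x)" using x c(1) by (simp add: is_max_def inv_fov_map_scale)
    then show ?thesis using c nz by (intro exI[of _ "c *s x"]) simp
  qed
  then obtain h where h: "\<And>z. z \<in> ?F \<Longrightarrow> is_max A (V z) z (h z)"
    "\<And>z. z \<in> ?F \<Longrightarrow> cdot (V z) (h z) = complex_of_real (cmod (cdot (V z) (h z)))"
    "\<And>z. z \<in> ?F \<Longrightarrow> cdot (V z) (h z) \<noteq> 0" by metis
  have hm: "h z \<in> inv_fov_map A z" if "z \<in> ?F" for z using h(1)[OF that] by (simp add: is_max_def)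
  have "continuous_on M h"
    unfolding continuous_on_iff
  proof (rule ccontr)
    assume "\<not> (\<forall>x\<in>M. \<forall>e>0. \<exists>d>0. \<forall>x'\<in>M. dist x' x < d \<longrightarrow> dist (h x') (h x) < e)"
    then obtain z e where z: "z \<in> M" and e: "e > 0"
      and no: "\<And>d. d > 0 \<Longrightarrow> \<exists>z'\<in>M. dist z' z < d \<and> dist (h z') (h z) \<ge> e" by (meson not_less)
    have "\<exists>z'\<in>M. dist z' z < inverse (real (Suc k)) \<and> dist (h z') (h z) \<ge> e" for k by (rule no) simp
    then obtain \<xi> where \<xi>: "\<And>k. \<xi> k \<in> M" "\<And>k. dist (\<xi> k) z < inverse (real (Suc k))" "\<And>k. dist (h (\<xi> k)) (h z) \<ge> e"
      by metis
    have \<xi>l: "\<xi> \<longlonglongrightarrow> z"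
      by (rule tendsto_dist_iff[THEN iffD2], rule tendsto_sandwich[OF _ _ tendsto_const LIMSEQ_inverse_real_of_nat])
         (use \<xi>(2) in \<open>auto intro!: always_eventually less_imp_le\<close>)
    have zF: "z \<in> ?F" and \<xi>F: "\<And>k. \<xi> k \<in> ?F" using z \<xi>(1) M by auto
    have "\<forall>k. (h \<circ> \<xi>) k \<in> sphere 0 1" using hm[OF \<xi>F] by (auto simp: inv_fov_map_iff)
    then obtain m f where m: "m \<in> sphere 0 1" and f: "strict_mono f" and hl: "((h \<circ> \<xi>) \<circ> f) \<longlonglongrightarrow> m"
      using compact_sphere[of "0 :: complex ^ 'a" 1] unfolding compact_def by blast
    have hl: "(\<lambda>k. h (\<xi> (f k))) \<longlonglongrightarrow> m" using hl by (simp add: o_def)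
    have fl: "(\<lambda>k. \<xi> (f k)) \<longlonglongrightarrow> z" using LIMSEQ_subseq_LIMSEQ[OF \<xi>l f] by (simp add: o_def)
    have Vl: "(\<lambda>k. V (\<xi> (f k))) \<longlonglongrightarrow> V z"
      using continuous_on_tendsto_compose[OF V fl] by simp
    have "(\<lambda>k. fov_map A (h (\<xi> (f k)))) \<longlonglongrightarrow> fov_map A m" by (rule tendsto_fov_map[OF hl])
    moreover have "fov_map A (h (\<xi> (f k))) = \<xi> (f k)" for k using hm[OF \<xi>F] by (simp add: inv_fov_map_iff)
    ultimately have "fov_map A m = z" using LIMSEQ_unique fl by simp
    then have mm: "m \<in> inv_fov_map A z" using m by (simp add: inv_fov_map_iff)
    have Vhl: "(\<lambda>k. cdot (V (\<xi> (f k))) (h (\<xi> (f k)))) \<longlonglongrightarrow> cdot (V z) m" by (intro tendsto_cdot Vl hl)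
    have "lsc_at A z (h z)" by (rule lsc[OF z h(1)[OF zF]])
    then obtain \<eta> where \<eta>: "\<And>k. \<eta> k \<in> inv_fov_map A (\<xi> (f k))" "\<eta> \<longlonglongrightarrow> h z"
      using lsc_at_sequence[OF _ \<xi>F fl] by blast
    have "cmod (cdot (V z) (h z)) \<le> cmod (cdot (V z) m)"
    proof (rule LIMSEQ_le)
      show "(\<lambda>k. cmod (cdot (V (\<xi> (f k))) (\<eta> k))) \<longlonglongrightarrow> cmod (cdot (V z) (h z))" by (intro tendsto_norm tendsto_cdot Vl \<eta>)
      show "(\<lambda>k. cmod (cdot (V (\<xi> (f k))) (h (\<xi> (f k))))) \<longlonglongrightarrow> cmod (cdot (V z) m)" by (rule tendsto_norm[OF Vhl])
      show "\<exists>N. \<forall>n\<ge>N. cmod (cdot (V (\<xi> (f n))) (\<eta> n)) \<le> cmod (cdot (V (\<xi> (f n))) (h (\<xi> (f n))))"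
        using h(1)[OF \<xi>F] \<eta>(1) by (auto simp: is_max_def)
    qed
    moreover have "cmod (cdot (V z) m) \<le> cmod (cdot (V z) (h z))" using h(1)[OF zF] mm by (simp add: is_max_def)
    ultimately have cm: "cmod (cdot (V z) m) = cmod (cdot (V z) (h z))" by simp
    then have "is_max A (V z) z m" using h(1)[OF zF] mm by (simp add: is_max_def)
    then obtain c where c: "cmod c = 1" "m = c *s h z" using um[OF zF] h(1)[OF zF] unfolding unique_max_def by blast
    have "(\<lambda>k. complex_of_real (cmod (cdot (V (\<xi> (f k))) (h (\<xi> (f k)))))) \<longlonglongrightarrow> complex_of_real (cmod (cdot (V z) m))"
      by (intro tendsto_of_real tendsto_norm Vhl)
    moreover have "(\<lambda>k. complex_of_real (cmod (cdot (V (\<xi> (f k))) (h (\<xi> (f k)))))) = (\<lambda>k. cdot (V (\<xi> (f k))) (h (\<xi> (f k))))"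
      by (intro ext h(2)[symmetric] \<xi>F)
    ultimately have "cdot (V z) m = complex_of_real (cmod (cdot (V z) (h z)))"
      using LIMSEQ_unique[OF Vhl] cm by simp
    then have "cdot (V z) m = cdot (V z) (h z)" by (rule trans[OF _ h(2)[OF zF, symmetric]])
    then have "c = 1" using h(3)[OF zF] by (simp add: c(2) cdot_scale_right)
    then have "(\<lambda>k. h (\<xi> (f k))) \<longlonglongrightarrow> h z" using hl c(2) by simp
    then have "(\<lambda>k. dist (h (\<xi> (f k))) (h z)) \<longlonglongrightarrow> 0" by (rule tendsto_dist_iff[THEN iffD1])
    then have "e \<le> 0" by (rule LIMSEQ_le_const) (use \<xi>(3) in auto)
    then show False using e by simp
  qed
  then show ?thesis using that hm by blast
qed

lemma cdot_equality_case:
  assumes "norm x = 1" "norm y = 1" "1 \<le> cmod (cdot y x)"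
  shows "\<exists>c. cmod c = 1 \<and> x = c *s y"
proof -
  have le: "cmod (cdot y x) \<le> 1" using cmod_cdot_le[of y x] assms by simp
  then have c: "cmod (cdot y x) = 1" using assms by simp
  have "cdot (x - cdot y x *s y) (x - cdot y x *s y) = cdot x x - cdot y x * cnj (cdot y x)"
    using assms by (simp only: cdot_algebra cdot_self[of y] cnj_cdot) simp
  also have "\<dots> = 0" using c assms by (simp add: complex_norm_square[symmetric] cdot_self)
  finally have "x = cdot y x *s y" by (simp add: cdot_self)
  then show ?thesis using c by blast
qed

text \<open>At continuity points outside \<open>J\<close> every fibre vector is approximable, so any
  maximiser will do. At a point of \<open>J\<close> the functional is the value at 0 of the path
  from \<open>local_path\<close>, and equality in Cauchy-Schwarz makes every maximiser a unit
  multiple of the chosen \<open>y\<close>; away from \<open>J\<close> it is the generic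
  \<open>v\<close>.\<close>

lemma selection_interior:
  fixes A :: "complex ^ 'n ^ 'n"
  assumes int: "interior (numerical_range A) \<noteq> {}"
  obtains h where "\<And>z. z \<in> numerical_range A \<Longrightarrow> h z \<in> inv_fov_map A z"
    "continuous_on {z \<in> numerical_range A. \<exists>y. lsc_at A z y} h"
proof -
  let ?F = "numerical_range A"
  let ?X = "exceptional_points A"
  define J where "J = {z \<in> ?F. (\<exists>y. lsc_at A z y) \<and> (\<exists>y\<in>inv_fov_map A z. \<not> lsc_at A z y)}"
  have "J \<subseteq> ?X" using nonlsc_exceptional[OF int] by (auto simp: J_def)
  then have J: "finite J" using finite_exceptional_points[of A] finite_subset by blast
  obtain y where y: "\<And>j. j \<in> J \<Longrightarrow> lsc_at A j (y j)" using bchoice[of J "\<lambda>j y. lsc_at A j y"] by (auto simp: J_def)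
  have "\<forall>a\<in>?X. \<exists>e. e \<in> inv_fov_map A a"
    using inv_fov_map_nonempty by (auto simp: exceptional_points_def extreme_point_of_def)
  then obtain e where e: "\<And>a. a \<in> ?X \<Longrightarrow> e a \<in> inv_fov_map A a" by metis
  have ne: "x \<noteq> 0" if "x \<in> inv_fov_map A z" for x z using that by (auto simp: inv_fov_map_iff)
  have "finite (e ` ?X \<union> y ` J)" using finite_exceptional_points[of A] J by simp
  moreover have "0 \<notin> e ` ?X \<union> y ` J" using ne e lsc_at_mem[OF y] by fastforce
  ultimately obtain v where v: "\<And>u. u \<in> e ` ?X \<union> y ` J \<Longrightarrow> cdot u v \<noteq> 0"
    and reg: "\<And>w. norm w = 1 \<Longrightarrow> eig_lsc A w \<Longrightarrow> \<exists>x\<in>eig A w. cdot x v \<noteq> 0"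
    using generic_vector[of "e ` ?X \<union> y ` J" A] by blast
  have exn: "nonorth A v a" if "a \<in> ?X" for a
  proof -
    have "cdot (e a) v \<noteq> 0" using v that by blast
    then have "cdot v (e a) \<noteq> 0" using cnj_cdot[of v "e a"] by auto
    then show ?thesis using e[OF that] by (auto simp: nonorth_def)
  qed
  have gen: "nonorth A v z" if "z \<in> ?F" for z by (rule nonorth_everywhere[OF int exn reg that])
  define Q where "Q j \<gamma> \<rho> \<longleftrightarrow> continuous_on {0..1} \<gamma> \<and> \<gamma> (1::real) = v \<and> \<rho> > 0 \<and>
    (\<forall>u\<in>inv_fov_map A j. cdot u (\<gamma> 0) = cdot (y j) v * cdot u (y j)) \<and>
    (\<forall>z \<tau>. z \<in> ?F \<longrightarrow> dist z j < \<rho> \<longrightarrow> \<tau> \<in> {0..1} \<longrightarrow> nonorth A (\<gamma> \<tau>) z \<and> unique_max A (\<gamma> \<tau>) z)"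
    for j \<gamma> \<rho>
  have "\<exists>\<gamma> \<rho>. Q j \<gamma> \<rho>" if j: "j \<in> J" for j
  proof -
    obtain y' where y': "y' \<in> inv_fov_map A j" "\<not> lsc_at A j y'" using j by (auto simp: J_def)
    have "cdot (y j) v \<noteq> 0" using v j by blast
    then show ?thesis using local_path[OF int y[OF j] y' gen] unfolding Q_def by metis
  qed
  then obtain \<gamma> \<rho>' where Q: "\<And>j. j \<in> J \<Longrightarrow> Q j (\<gamma> j) (\<rho>' j)" by metis
  have \<gamma>: "continuous_on {0..1} (\<gamma> j)" "\<gamma> j 1 = v" and \<rho>': "\<rho>' j > 0"
    and \<gamma>0: "u \<in> inv_fov_map A j \<Longrightarrow> cdot u (\<gamma> j 0) = cdot (y j) v * cdot u (y j)"
    and um: "z \<in> ?F \<Longrightarrow> dist z j < \<rho>' j \<Longrightarrow> \<tau> \<in> {0..1} \<Longrightarrow> nonorth A (\<gamma> j \<tau>) z \<and> unique_max A (\<gamma> j \<tau>) z"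
    if "j \<in> J" for j u z \<tau>
    using Q[OF that] unfolding Q_def by blast+
  \<comment> \<open>Half the mutual distances keep the balls around \<open>J\<close> disjoint; the
    element 1 keeps \<open>D\<close> nonempty when \<open>J\<close> is empty.\<close>
  define D where "D = insert 1 (\<rho>' ` J \<union> (\<lambda>(i, j). dist i j / 2) ` {p \<in> J \<times> J. fst p \<noteq> snd p})"
  have D: "finite D" "D \<noteq> {}" using J by (auto simp: D_def)
  define \<rho> where "\<rho> = Min D"
  have "\<forall>d\<in>D. d > 0" using \<rho>' by (auto simp: D_def)
  then have \<rho>: "\<rho> > 0" using D by (simp add: \<rho>_def)
  have \<rho>le: "\<rho> \<le> d" if "d \<in> D" for d using D that by (simp add: \<rho>_def)
  have \<rho>1: "\<rho> \<le> \<rho>' j" if "j \<in> J" for j using that by (intro \<rho>le) (simp add: D_def)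
  have \<rho>2: "2 * \<rho> \<le> dist i j" if "i \<in> J" "j \<in> J" "i \<noteq> j" for i j
  proof -
    have "dist i j / 2 \<in> D" using that by (force simp: D_def)
    then show ?thesis using \<rho>le by fastforce
  qed
  \<comment> \<open>At most one summand is nonzero at each \<open>z\<close>; the sum makes
    continuity across the balls immediate.\<close>
  define V where "V z = v + (\<Sum>j\<in>J. \<gamma> j (min 1 (dist z j / \<rho>)) - v)" for z
  have V_near: "V z = \<gamma> j (dist z j / \<rho>)" if j: "j \<in> J" "dist z j < \<rho>" for z j
  proof -
    have "\<gamma> i (min 1 (dist z i / \<rho>)) - v = 0" if i: "i \<in> J - {j}" for i
    proof -
      have "2 * \<rho> \<le> dist i j" using i j(1) by (intro \<rho>2) auto
      moreover have "dist i j \<le> dist z i + dist z j" by (rule dist_triangle3)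
      ultimately have "dist z i / \<rho> \<ge> 1" using j(2) \<rho> by simp
      then show ?thesis using \<gamma>(2) i by (simp add: min_def)
    qed
    then have "V z = v + (\<gamma> j (min 1 (dist z j / \<rho>)) - v)"
      unfolding V_def sum.remove[OF J j(1)] by simp
    then show ?thesis using j \<rho> by (simp add: min_def)
  qed
  have V_far: "V z = v" if far: "\<And>j. j \<in> J \<Longrightarrow> \<not> dist z j < \<rho>" for z
  proof -
    have "\<gamma> j (min 1 (dist z j / \<rho>)) - v = 0" if "j \<in> J" for j
      using far[OF that] \<gamma>(2)[OF that] \<rho> by (simp add: min_def)
    then show ?thesis unfolding V_def by simp
  qed
  have contV: "continuous_on UNIV V"
    unfolding V_def
  proof (intro continuous_on_add continuous_on_const continuous_on_sum continuous_on_diff)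
    fix j assume j: "j \<in> J"
    have "continuous_on UNIV (\<lambda>z. min 1 (dist z j / \<rho>))" using \<rho> by (intro continuous_intros) auto
    moreover have "(\<lambda>z. min 1 (dist z j / \<rho>)) ` UNIV \<subseteq> {0..1}" using \<rho> by auto
    ultimately show "continuous_on UNIV (\<lambda>z. \<gamma> j (min 1 (dist z j / \<rho>)))"
      using continuous_on_compose2[OF \<gamma>(1)[OF j]] by blast
  qed
  have Vum: "nonorth A (V z) z \<and> unique_max A (V z) z" if z: "z \<in> ?F" for z
  proof (cases "\<exists>j\<in>J. dist z j < \<rho>")
    case True
    then obtain j where j: "j \<in> J" "dist z j < \<rho>" by blast
    have "dist z j < \<rho>' j" "dist z j / \<rho> \<in> {0..1}" using j \<rho>1[OF j(1)] \<rho> by auto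
    then show ?thesis unfolding V_near[OF j] by (intro um j z)
  next
    case False
    then have "V z = v" using V_far by blast
    then show ?thesis using gen[OF z] nonorth_unique_max[OF gen z] by simp
  qed
  have Vlsc: "lsc_at A z x" if z: "z \<in> {z \<in> ?F. \<exists>y. lsc_at A z y}" and x: "is_max A (V z) z x" for z x
  proof (cases "z \<in> J")
    case False
    then show ?thesis using z x by (auto simp: J_def is_max_def)
  next
    case True
    have V0: "V z = \<gamma> z 0" using V_near[OF True, of z] \<rho> by simp
    have val: "cmod (cdot (V z) u) = cmod (cdot (y z) v) * cmod (cdot (y z) u)" if "u \<in> inv_fov_map A z" for u
    proof -
      have "cmod (cdot (V z) u) = cmod (cdot u (V z))" by (metis cnj_cdot complex_mod_cnj)
      also have "\<dots> = cmod (cdot (y z) v) * cmod (cdot u (y z))" unfolding V0 \<gamma>0[OF True that] by (rule norm_mult)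
      also have "cmod (cdot u (y z)) = cmod (cdot (y z) u)" by (metis cnj_cdot complex_mod_cnj)
      finally show ?thesis .
    qed
    have yz: "y z \<in> inv_fov_map A z" and xz: "x \<in> inv_fov_map A z"
      using lsc_at_mem[OF y[OF True]] x by (auto simp: is_max_def)
    have "cmod (cdot (V z) (y z)) \<le> cmod (cdot (V z) x)" using x yz by (simp add: is_max_def)
    moreover have "cdot (y z) v \<noteq> 0" using v True by blast
    ultimately have "cmod (cdot (y z) (y z)) \<le> cmod (cdot (y z) x)" unfolding val[OF yz] val[OF xz] by simp
    then have "1 \<le> cmod (cdot (y z) x)" using yz by (simp add: inv_fov_map_iff cdot_self)
    then obtain c where "cmod c = 1" "x = c *s y z"
      using cdot_equality_case[of x "y z"] xz yz by (auto simp: inv_fov_map_iff)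
    then show ?thesis using lsc_at_scale y[OF True] by blast
  qed
  have "{z \<in> ?F. \<exists>y. lsc_at A z y} \<subseteq> ?F" by blast
  from maximiser_selection[OF contV Vum this Vlsc] show ?thesis using that by blast
qed

text \<open>The range lies on a line, hence is a segment or a point. Vectors over two distinct ends
  are orthogonal without cross terms by \<open>edge_orthogonal\<close>, so coefficients
  \<open>sqrt (1 - s)\<close> and \<open>sqrt s\<close> give values affine in
  \<open>s\<close>.\<close>

lemma selection_degenerate:
  fixes A :: "complex ^ 'n ^ 'n"
  assumes int: "interior (numerical_range A) = {}"
  obtains h where "\<And>z. z \<in> numerical_range A \<Longrightarrow> h z \<in> inv_fov_map A z"
    "continuous_on (numerical_range A) h"
proof -
  let ?F = "numerical_range A"
  obtain a0 c0 where a0: "a0 \<noteq> 0" "?F \<subseteq> {x. a0 \<bullet> x = c0}"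
    using empty_interior_subset_hyperplane[OF convex_numerical_range int] by blast
  define w where "w = (1 / norm a0) *\<^sub>R a0"
  have w: "norm w = 1" using a0 by (simp add: w_def)
  have wc: "w \<bullet> z = c0 / norm a0" if "z \<in> ?F" for z using a0 that by (auto simp: w_def)
  have sup: "supports w ?F z" if "z \<in> ?F" for z using that wc by (auto simp: supports_def)
  have w0: "w \<noteq> 0" using w by auto
  define T where "T = \<i> * w"
  obtain a b where a: "supports w ?F a" and b: "supports w ?F b"
    and ab: "\<And>\<zeta>. supports w ?F \<zeta> \<Longrightarrow> T \<bullet> a \<le> T \<bullet> \<zeta> \<and> T \<bullet> \<zeta> \<le> T \<bullet> b"
    using face_ends[OF w] unfolding T_def by metis
  have aF: "a \<in> ?F" and bF: "b \<in> ?F" using a b by (auto simp: supports_def)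
  obtain u u' where u: "u \<in> inv_fov_map A a" and u': "u' \<in> inv_fov_map A b"
    using aF bF by (auto simp: numerical_range_iff)
  show ?thesis
  proof (cases "T \<bullet> a < T \<bullet> b")
    case False
    have "z = a" if "z \<in> ?F" for z
    proof (rule planar_eq[OF _ _ w0])
      show "w \<bullet> z = w \<bullet> a" using wc that aF by simp
      show "(\<i> * w) \<bullet> z = (\<i> * w) \<bullet> a" using ab[OF sup[OF that]] False unfolding T_def by linarith
    qed
    then show ?thesis using that[of "\<lambda>_. u"] u by auto
  next
    case True
    have orth: "cdot u' u = 0" "\<And>\<alpha>. cdot u' (herm A \<alpha> *v u) = 0"
      using edge_orthogonal[OF w a b _ ab True u u'] by (auto simp: T_def)
    have orth': "cdot u u' = 0" "\<And>\<alpha>. cdot u (herm A \<alpha> *v u') = 0"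
      using orth cnj_cdot[of u' u] cnj_cdot_herm[of u' A _ u] by auto
    have orthA: "cdot u' (A *v u) = 0" "cdot u (A *v u') = 0"
      unfolding matrix_eq_herm[of A] using orth orth' by (simp_all add: cdot_algebra)
    define s where "s z = T \<bullet> (z - a) / (T \<bullet> (b - a))" for z
    define h where "h z = sqrt (1 - s z) *\<^sub>R u + sqrt (s z) *\<^sub>R u'" for z
    have d: "T \<bullet> (b - a) > 0" using True by (simp add: inner_diff_right)
    have "h z \<in> inv_fov_map A z" if z: "z \<in> ?F" for z
    proof -
      have s01: "0 \<le> s z" "s z \<le> 1" using ab[OF sup[OF z]] d by (simp_all add: s_def inner_diff_right)
      have zeq: "z = (1 - s z) *\<^sub>R a + s z *\<^sub>R b"
      proof (rule planar_eq[OF _ _ w0])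
        show "w \<bullet> z = w \<bullet> ((1 - s z) *\<^sub>R a + s z *\<^sub>R b)"
          using wc[OF z] wc[OF aF] wc[OF bF] by (simp add: inner_add_right algebra_simps)
        have "s z * (T \<bullet> (b - a)) = T \<bullet> (z - a)" using d by (simp add: s_def)
        then show "(\<i> * w) \<bullet> z = (\<i> * w) \<bullet> ((1 - s z) *\<^sub>R a + s z *\<^sub>R b)"
          unfolding T_def[symmetric] by (simp add: inner_add_right inner_diff_right algebra_simps)
      qed
      have "cdot (h z) (h z) = complex_of_real ((sqrt (1 - s z))\<^sup>2 + (sqrt (s z))\<^sup>2)"
        using u u' orth orth'
        by (simp only: h_def cdot_algebra inv_fov_map_iff cdot_self[of u] cdot_self[of u'] power2_eq_square of_real_add of_real_mult) simp
      then have "norm (h z) = 1" using s01 csphere_iff[of "h z"] by (simp add: csphere_def)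
      moreover have "fov_map A (h z) = complex_of_real ((sqrt (1 - s z))\<^sup>2) * a + complex_of_real ((sqrt (s z))\<^sup>2) * b"
      proof -
        have "fov_map A (h z) = fov_map A (complex_of_real (sqrt (1 - s z)) *s u) + fov_map A (complex_of_real (sqrt (s z)) *s u')"
          unfolding h_def scaleR_eq_scale fov_map_add using orthA by (simp add: cdot_algebra vector_scalar_commute)
        then show ?thesis using u u' by (simp add: fov_map_scale inv_fov_map_iff)
      qed
      ultimately show ?thesis using s01 zeq by (simp add: inv_fov_map_iff scaleR_conv_of_real)
    qed
    moreover have "continuous_on ?F h"
      unfolding h_def s_def using d by (intro continuous_intros) auto
    ultimately show ?thesis using that by blast
  qed
qed

lemma selection_exists:
  "\<exists>h. (\<forall>z\<in>numerical_range A. h z \<in> inv_fov_map A z) \<and>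
     continuous_on {z \<in> numerical_range A. \<exists>y. lsc_at A z y} h"
proof (cases "interior (numerical_range A) = {}")
  case True
  obtain h where h: "\<And>z. z \<in> numerical_range A \<Longrightarrow> h z \<in> inv_fov_map A z" "continuous_on (numerical_range A) h"
    using selection_degenerate[OF True] by metis
  have "continuous_on {z \<in> numerical_range A. \<exists>y. lsc_at A z y} h"
    by (rule continuous_on_subset[OF h(2)]) auto
  then show ?thesis using h(1) by blast
next
  case False
  show ?thesis by (rule selection_interior[OF False]) blast
qed

theorem theorem1:
  fixes A :: "complex ^ 'n ^ 'n"
  shows "((\<forall>z\<in>numerical_range A. weakly_continuous_at (numerical_range A) (inv_fov_map A) z)
            \<longrightarrow> (\<exists>h. continuous_selection A (numerical_range A) h))
       \<and> (\<forall>W G. finite W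
            \<and> W = {z \<in> numerical_range A.
                     \<not> weakly_continuous_at (numerical_range A) (inv_fov_map A) z}
            \<and> W \<subseteq> frontier (numerical_range A) \<and> open G \<and> W \<subseteq> G
            \<longrightarrow> (\<exists>h. continuous_selection A (numerical_range A - G) h))"
proof -
  obtain h where h: "\<forall>z\<in>numerical_range A. h z \<in> inv_fov_map A z"
    and cont: "continuous_on {z \<in> numerical_range A. \<exists>y. lsc_at A z y} h"
    using selection_exists[of A] by blast
  have sel: "continuous_selection A M h"
    if M: "M \<subseteq> numerical_range A" and wc: "\<And>z. z \<in> M \<Longrightarrow> weakly_continuous_at (numerical_range A) (inv_fov_map A) z" for M
  proof -
    have "M \<subseteq> {z \<in> numerical_range A. \<exists>y. lsc_at A z y}" using M weakly_continuous_lsc[OF wc] by blast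
    then show ?thesis
      using continuous_on_subset[OF cont] h M 
      unfolding continuous_selection_def inv_fov_map_def by blast
  qed
  show ?thesis
  proof (intro conjI allI impI)
    assume "\<forall>z\<in>numerical_range A. weakly_continuous_at (numerical_range A) (inv_fov_map A) z"
    then show "\<exists>h. continuous_selection A (numerical_range A) h" using sel by blast
  next
    fix W G assume WG: "finite W
            \<and> W = {z \<in> numerical_range A.
                     \<not> weakly_continuous_at (numerical_range A) (inv_fov_map A) z}
            \<and> W \<subseteq> frontier (numerical_range A) \<and> open G \<and> W \<subseteq> G"
    have "continuous_selection A (numerical_range A - G) h" by (rule sel) (use WG in auto)
    then show "\<exists>h. continuous_selection A (numerical_range A - G) h" by blast
  qed
qed

end
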